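(* Let $H(t)$, $t\in[0,T]$, be a twice continuously differentiable family of Hermitian operators on a finite-dimensional Hilbert space with $\|H(t)\|\le\alpha$ for all $t$. Let $L$ be a positive integer, $h=T/L$, $t_j=jh$, and $M$ a positive integer. Then there exist absolute constants $c,C>0$ such that if $h\le c/\alpha$, $$\big\|U_{\mathrm{exact}}(T,0)-\tilde U_2(T,0)\big\|\le CT\Big(\min\{C_{\mathrm{comm}}h^2,\;C'_Hh^4\}+\frac{h}{M}\max_{s\in[0,T]}\|H'(s)\|\Big),$$ where $C'_H$ is a prefactor depending only on $\alpha$ and on $\sup_{t\in[0,T]}\|\tfrac{d^p}{dt^p}H(t)\|$ for $p=1,2$.
   Context: $\|\cdot\|$ is the spectral norm. $U_{\mathrm{exact}}(T,0)=\mathcal{T}\exp(-i\int_0^TH(s)ds)$ is the unitary solving $i\partial_tU(t,0)=H(t)U(t,0)$, $U(0,0)=I$, at time $T$. $C_{\mathrm{comm}}:=\max_j\sup_{s,t,\tau\in[t_j,t_{j+1}]}\|[H(\tau),[H(s),H(t)]]\|$. For each $j$, $$\tilde U_2(t_{j+1},t_j):=\exp\Big\{-i\sum_{p=0}^{M-1}H\big(t_j+\tfrac{ph}{M}\big)\frac{h}{M}+\frac12\sum_{p=0}^{M-1}\Big[\sum_{q=1}^{p}H\big(t_j+\tfrac{qh}{M}\big)\frac{h}{M},\;H\big(t_j+\tfrac{ph}{M}\big)\Big]\frac{h}{M}\Big\},$$ and $\tilde U_2(T,0):=\tilde U_2(t_L,t_{L-1})\cdots\tilde U_2(t_2,t_1)\tilde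 U_2(t_1,t_0)$. *)

theory Defs
  imports "HOL-Analysis.Analysis" "Jordan_Normal_Form.Matrix"
begin

text \<open>Operators on the finite-dimensional Hilbert space C^n are represented by
  n x n complex matrices (type complex mat, dimension n an ordinary natural number,
  so that it can be quantified inside the statement).\<close>

definition vnorm :: "complex vec \<Rightarrow> real" where
  "vnorm v = sqrt (\<Sum>i<dim_vec v. (cmod (v $ i))\<^sup>2)"

definition opnorm :: "complex mat \<Rightarrow> real" where
  "opnorm A = Sup {vnorm (A *\<^sub>v v) | v. v \<in> carrier_vec (dim_col A) \<and> vnorm v \<le> 1}"

definition hermitian_mat :: "nat \<Rightarrow> complex mat \<Rightarrow> bool" where
  "hermitian_mat n A \<longleftrightarrow> A \<in> carrier_mat n n \<and>
     (\<forall>i<n. \<forall>j<n. A $$ (i, j) = cnj (A $$ (j, i)))"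

definition comm :: "complex mat \<Rightarrow> complex mat \<Rightarrow> complex mat" where
  "comm A B = A * B - B * A"

definition msum :: "nat \<Rightarrow> ('i \<Rightarrow> complex mat) \<Rightarrow> 'i set \<Rightarrow> complex mat" where
  "msum n f S = mat n n (\<lambda>(i, j). \<Sum>p\<in>S. f p $$ (i, j))"

definition mexp :: "complex mat \<Rightarrow> complex mat" where
  "mexp A = mat (dim_row A) (dim_col A) (\<lambda>(i, j). \<Sum>k. (A ^\<^sub>m k) $$ (i, j) / of_nat (fact k))"

definition mat_deriv_on ::
  "nat \<Rightarrow> (real \<Rightarrow> complex mat) \<Rightarrow> (real \<Rightarrow> complex mat) \<Rightarrow> real set \<Rightarrow> bool" where
  "mat_deriv_on n F F' S \<longleftrightarrow> (\<forall>t\<in>S. F t \<in> carrier_mat n n \<and> F' t \<in> carrier_mat n n \<and>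
     (\<forall>i<n. \<forall>j<n. ((\<lambda>s. F s $$ (i, j)) has_vector_derivative (F' t $$ (i, j))) (at t within S)))"

definition mat_continuous_on :: "nat \<Rightarrow> (real \<Rightarrow> complex mat) \<Rightarrow> real set \<Rightarrow> bool" where
  "mat_continuous_on n F S \<longleftrightarrow> (\<forall>i<n. \<forall>j<n. continuous_on S (\<lambda>s. F s $$ (i, j)))"

definition U2_step :: "nat \<Rightarrow> (real \<Rightarrow> complex mat) \<Rightarrow> nat \<Rightarrow> real \<Rightarrow> real \<Rightarrow> complex mat" where
  "U2_step n H M h tj = mexp
     ((- \<i>) \<cdot>\<^sub>m msum n (\<lambda>p. complex_of_real (h / real M) \<cdot>\<^sub>m H (tj + real p * h / real M)) {..<M}
      + (1/2) \<cdot>\<^sub>m msum n (\<lambda>p. complex_of_real (h / real M) \<cdot>\<^sub>m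
            comm (msum n (\<lambda>q. complex_of_real (h / real M) \<cdot>\<^sub>m H (tj + real q * h / real M)) {1..p})
                 (H (tj + real p * h / real M))) {..<M})"

fun U2_prod :: "nat \<Rightarrow> (real \<Rightarrow> complex mat) \<Rightarrow> nat \<Rightarrow> real \<Rightarrow> nat \<Rightarrow> complex mat" where
  "U2_prod n H M h 0 = 1\<^sub>m n"
| "U2_prod n H M h (Suc k) = U2_step n H M h (real k * h) * U2_prod n H M h k"

end

(* Let A = -iH and let X1' = A, X2' = [A, X1]/2 be the first two terms of the Magnus series
   on one step. If X = X1 + X2, then exp X satisfies U' = A U up to a residual that consists
   only of brackets of length at least three. A Gronwall argument for the right derivative
   of the norm (skew operators generate contractions) bounds the local error by the
   step length times the supremum of the residual. Reducing longer brackets by the Jacobi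
   identity and h * alpha <= 1 bounds the residual by Ccomm h^2. Expanding A at the left
   end of the step, the terms of third order in h cancel, which gives h^4. Replacing the
   integrals by left Riemann sums costs h (h/M) sup |H'| in each step. *)

theory Submission
  imports Defs
begin

text \<open>The dimension \<open>n\<close> is a variable of the statement, so the matrices of one
  size are not a type, whereas exponentials and limits need a Banach algebra. The analysis therefore
  runs in an abstract algebra in which a closed real subspace \<open>S\<close> plays the part of the
  skew-Hermitian operators, and matrices enter only at the end. The derivative of
  \<open>exp (X t)\<close> for noncommuting \<open>X\<close> is an infinite series of brackets with
  \<open>X t\<close>. It is never formed: a finite increment of \<open>X\<close> is inserted into
  the first three terms of the series, \<open>dexp3\<close>, and the truncation adds the bracket
  \<open>[X,[X,[X,Y]]]\<close> to the residual. Only right difference quotients are bounded, so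
  norms and distances, which need not be differentiable, can be followed in time. The condition on
  \<open>h\<close> may involve \<alpha> but not the derivatives of \<open>H\<close>, which would
  enter through the Taylor expansion; a separate argument for large \<open>h\<close> removes
  them.\<close>

section \<open>Growth estimates and contractive exponentials\<close>

text \<open>Among the times at which the bound with slope \<open>\<rho> + \<epsilon>\<close> holds
  there is a last one by compactness; if it came before \<open>b\<close>, the increment condition
  would produce a later one. Then \<epsilon> tends to 0.\<close>

lemma dini_growth:
  fixes f :: "real \<Rightarrow> real"
  assumes "a \<le> b" and cont: "continuous_on {a..b} f"
    and step: "\<And>t \<epsilon>. a \<le> t \<Longrightarrow> t < b \<Longrightarrow> \<epsilon> > 0 \<Longrightarrow>
                 \<forall>\<^sub>F k in at_right 0. f (t + k) \<le> f t + k * (\<rho> + \<epsilon>)"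
  shows "f b \<le> f a + (b - a) * \<rho>"
proof -
  have main: "f b \<le> f a + (b - a) * (\<rho> + \<epsilon>)" if "\<epsilon> > 0" for \<epsilon>
  proof -
    define g where "g t = f t - (\<rho> + \<epsilon>) * t" for t
    define Z where "Z = {t \<in> {a..b}. g t \<le> g a}"
    have "continuous_on {a..b} g"
      unfolding g_def by (intro continuous_intros cont)
    then have "closed Z"
      unfolding Z_def by (rule continuous_on_closed_Collect_le) (auto intro!: continuous_intros)
    moreover have "bounded Z" unfolding Z_def by (rule bounded_subset[of "{a..b}"]) auto
    ultimately have "compact Z" by (simp add: compact_eq_bounded_closed)
    moreover have "a \<in> Z" using \<open>a \<le> b\<close> by (auto simp: Z_def)
    ultimately obtain c where c: "c \<in> Z" "\<And>t. t \<in> Z \<Longrightarrow> t \<le> c"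
      using compact_attains_sup[of Z] by blast
    have "c = b"
    proof (rule ccontr)
      assume "c \<noteq> b"
      then have cb: "a \<le> c" "c < b" using c(1) by (auto simp: Z_def)
      have "\<forall>\<^sub>F k in at_right 0. f (c + k) \<le> f c + k * (\<rho> + \<epsilon>) \<and> 0 < k \<and> k < b - c"
        using cb by (intro eventually_conj step \<open>\<epsilon> > 0\<close>) (auto simp: eventually_at_right_less
            intro: eventually_at_right_real eventually_at_rightI[of 0 "b - c"])
      then obtain k where k: "f (c + k) \<le> f c + k * (\<rho> + \<epsilon>)" "0 < k" "k < b - c"
        using eventually_happens'[OF trivial_limit_at_right_real] by blast
      then have "g (c + k) \<le> g c" by (simp add: g_def algebra_simps)
      then have "c + k \<in> Z" using c(1) k cb by (auto simp: Z_def)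
      with c(2) k show False by force
    qed
    with c(1) show ?thesis by (simp add: Z_def g_def algebra_simps)
  qed
  show ?thesis
  proof (rule field_le_epsilon)
    fix e :: real assume "e > 0"
    \<comment> \<open>The summand 1 keeps the denominator positive when
      \<open>a = b\<close>.\<close>
    define \<epsilon> where "\<epsilon> = e / (1 + (b - a))"
    have "\<epsilon> > 0" using \<open>e > 0\<close> \<open>a \<le> b\<close> by (simp add: \<epsilon>_def)
    moreover have "(b - a) * \<epsilon> \<le> e"
      using \<open>e > 0\<close> \<open>a \<le> b\<close> by (simp add: \<epsilon>_def field_simps)
    ultimately show "f b \<le> f a + (b - a) * \<rho> + e"
      using main[of \<epsilon>] by (simp add: algebra_simps)
  qed
qed

text \<open>Since \<open>t < b\<close>, approaching \<open>t\<close> from the right stays inside the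
  interval, so the derivative within it yields the one-sided quotients that the growth lemmas
  use.\<close>

lemma has_vector_derivative_at_right_quotient:
  assumes "(f has_vector_derivative f') (at t within {a..b})" "a \<le> t" "t < b"
  shows "((\<lambda>k. (f (t + k) - f t) /\<^sub>R k) \<longlongrightarrow> f') (at_right 0)"
proof -
  have eq: "at t within {a..b} \<ge> at_right t"
  proof -
    have "at_right t = at t within {t<..<b}"
      using assms(3) by (subst at_within_nhd[of _ "{..<b}" _ "{t<..<b}"]) auto
    also have "\<dots> \<le> at t within {a..b}"
      using assms by (intro at_le) auto
    finally show ?thesis .
  qed
  have "((\<lambda>x. norm (f x - f t - (x - t) *\<^sub>R f') / norm (x - t)) \<longlongrightarrow> 0) (at t within {a..b})"
    using assms(1) unfolding has_vector_derivative_def has_derivative_iff_norm by simp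
  then have "((\<lambda>x. norm (f x - f t - (x - t) *\<^sub>R f') / norm (x - t)) \<longlongrightarrow> 0) (at_right t)"
    using eq by (rule tendsto_mono[rotated])
  then have "((\<lambda>k. norm (f (t + k) - f t - k *\<^sub>R f') / norm k) \<longlongrightarrow> 0) (at_right 0)"
    by (subst (asm) filterlim_at_right_to_0) (simp add: add.commute)
  moreover have "\<forall>\<^sub>F k in at_right 0.
      norm (f (t + k) - f t - k *\<^sub>R f') / norm k = norm ((f (t + k) - f t) /\<^sub>R k - f')"
    using eventually_at_right_less[of "0::real"]
  proof eventually_elim
    case (elim k)
    then have "(f (t + k) - f t) /\<^sub>R k - f' = (f (t + k) - f t - k *\<^sub>R f') /\<^sub>R k"
      by (simp add: algebra_simps)
    then show ?case by (simp add: divide_inverse mult.commute)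
  qed
  ultimately have "((\<lambda>k. norm ((f (t + k) - f t) /\<^sub>R k - f')) \<longlongrightarrow> 0) (at_right 0)"
    by (rule Lim_transform_eventually)
  then show ?thesis by (simp add: tendsto_norm_zero_iff LIM_zero_iff)
qed

lemma norm_vector_derivative_bound:
  fixes f :: "real \<Rightarrow> 'b::real_normed_vector"
  assumes "\<And>t. t \<in> {a..b} \<Longrightarrow> (f has_vector_derivative f' t) (at t within {a..b})"
    and "\<And>t. t \<in> {a..b} \<Longrightarrow> norm (f' t) \<le> B" "s \<in> {a..b}" "t \<in> {a..b}"
  shows "norm (f t - f s) \<le> B * \<bar>t - s\<bar>"
proof -
  have "norm (f t - f s) \<le> B * norm (t - s)"
  proof (rule differentiable_bound[of "{a..b}" f "\<lambda>t h. h *\<^sub>R f' t"])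
    show "onorm (\<lambda>h. h *\<^sub>R f' x) \<le> B" if "x \<in> {a..b}" for x
      using assms(2)[OF that]
      by (intro onorm_le) (metis abs_ge_zero mult.commute mult_right_mono norm_scaleR real_norm_def)
  qed (use assms in \<open>auto simp: has_vector_derivative_def\<close>)
  then show ?thesis by simp
qed

section \<open>Brackets and an axiomatic form of skew-Hermitian operators\<close>

definition lie_bracket :: "'a::ring \<Rightarrow> 'a \<Rightarrow> 'a" where
  "lie_bracket x y = x * y - y * x"

lemma norm_lie_bracket_le:
  fixes x y :: "'a::real_normed_algebra"
  shows "norm (lie_bracket x y) \<le> 2 * norm x * norm y"
proof -
  have "norm (lie_bracket x y) \<le> norm (x * y) + norm (y * x)"
    unfolding lie_bracket_def by (rule norm_triangle_ineq4)
  also have "\<dots> \<le> norm x * norm y + norm y * norm x"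
    by (intro add_mono norm_mult_ineq)
  finally show ?thesis by simp
qed

text \<open>Supplies linearity in each argument, limits and derivatives of brackets from the general
  theory of bounded bilinear maps.\<close>

interpretation lie_bracket: bounded_bilinear "lie_bracket :: 'a::real_normed_algebra \<Rightarrow> 'a \<Rightarrow> 'a"
proof
  show "\<exists>K. \<forall>a b::'a. norm (lie_bracket a b) \<le> norm a * norm b * K"
    using norm_lie_bracket_le by (intro exI[of _ 2]) (auto simp: mult.commute mult.left_commute)
qed (auto simp: lie_bracket_def algebra_simps)

text \<open>Along a curve the derivative of \<open>exp X\<close> is \<open>dexp_X(X') exp X\<close>
  with \<open>dexp_X = (e^{ad X} - 1) / ad X\<close>. These are the first three terms of that
  series, where \<open>ad x = lie_bracket x\<close>.\<close>

definition dexp3 :: "'a::real_normed_algebra \<Rightarrow> 'a \<Rightarrow> 'a" where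
  "dexp3 x y = y + lie_bracket x y /\<^sub>R 2 + lie_bracket x (lie_bracket x y) /\<^sub>R 6"

text \<open>Skew-Hermitian operators form a real Lie algebra but are not closed under products,
  hence the axiom on brackets. The last axiom is all that is kept of unitarity:
  \<open>norm (1 + x)\<close> exceeds 1 only to second order in \<open>x\<close>.\<close>

locale skew_algebra =
  fixes S :: "'a::{real_normed_algebra_1,banach} set"
  assumes subspace_S: "subspace S" and closed_S: "closed S"
    and bracket_S: "x \<in> S \<Longrightarrow> y \<in> S \<Longrightarrow> lie_bracket x y \<in> S"
    and norm_one_plus_sq: "x \<in> S \<Longrightarrow> (norm (1 + x))\<^sup>2 \<le> 1 + (norm x)\<^sup>2"
begin

lemmas S_intros = subspace_add[OF subspace_S] subspace_diff[OF subspace_S]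
  subspace_scale[OF subspace_S] subspace_0[OF subspace_S] subspace_neg[OF subspace_S]
  subspace_sum[OF subspace_S] bracket_S

lemma norm_one_plus_le:
  assumes "x \<in> S"
  shows "norm (1 + x) \<le> 1 + (norm x)\<^sup>2"
proof (rule power2_le_imp_le)
  show "(norm (1 + x))\<^sup>2 \<le> (1 + (norm x)\<^sup>2)\<^sup>2"
  proof -
    have "(1 + (norm x)\<^sup>2)\<^sup>2 = 1 + (norm x)\<^sup>2 + ((norm x)\<^sup>2 + ((norm x)\<^sup>2)\<^sup>2)"
      by (simp add: power2_eq_square algebra_simps)
    moreover have "0 \<le> (norm x)\<^sup>2 + ((norm x)\<^sup>2)\<^sup>2" by simp
    ultimately show ?thesis using norm_one_plus_sq[OF assms] by linarith
  qed
qed simp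

text \<open>An Euler step \<open>(1 + k A) y\<close> enlarges the norm by a factor
  \<open>1 + O(k^2)\<close> only, because \<open>A\<close> lies in \<open>S\<close>. To first order
  in \<open>k\<close> all growth comes from the defect \<rho>, and no factor exponential in
  \<open>norm A\<close> appears.\<close>

lemma growth:
  assumes "a \<le> b" and cont: "continuous_on {a..b} y"
    and A: "\<And>t. t \<in> {a..b} \<Longrightarrow> A t \<in> S"
    and step: "\<And>t \<epsilon>. a \<le> t \<Longrightarrow> t < b \<Longrightarrow> \<epsilon> > 0 \<Longrightarrow>
       \<forall>\<^sub>F k in at_right 0. norm (y (t + k) - y t - k *\<^sub>R (A t * y t)) \<le> k * (\<rho> + \<epsilon>)"
  shows "norm (y b) \<le> norm (y a) + (b - a) * \<rho>"
proof (rule dini_growth[OF \<open>a \<le> b\<close>])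
  show "continuous_on {a..b} (\<lambda>t. norm (y t))" by (intro continuous_intros cont)
  fix t \<epsilon> :: real assume t: "a \<le> t" "t < b" "\<epsilon> > 0"
  \<comment> \<open>\<open>k * (k * K)\<close> is the second-order growth of an Euler step. For
    small \<open>k\<close> it uses up one half of \<epsilon>, the defect the other half.\<close>
  define K where "K = (norm (A t))\<^sup>2 * norm (y t)"
  have "((\<lambda>k. k * K) \<longlongrightarrow> 0 * K) (at_right 0)" by (intro tendsto_intros)
  then have "\<forall>\<^sub>F k in at_right 0. k * K < \<epsilon> / 2"
    using t by (intro order_tendstoD(2)) auto
  moreover have "\<forall>\<^sub>F k in at_right 0. norm (y (t + k) - y t - k *\<^sub>R (A t * y t)) \<le> k * (\<rho> + \<epsilon> / 2)"
    using step[of t "\<epsilon> / 2"] t by simp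
  ultimately show "\<forall>\<^sub>F k in at_right 0. norm (y (t + k)) \<le> norm (y t) + k * (\<rho> + \<epsilon>)"
    using eventually_at_right_less[of 0]
  proof eventually_elim
    case (elim k)
    have "y (t + k) = (1 + k *\<^sub>R A t) * y t + (y (t + k) - y t - k *\<^sub>R (A t * y t))"
      by (simp add: algebra_simps)
    then have "norm (y (t + k)) \<le> norm ((1 + k *\<^sub>R A t) * y t) + norm (y (t + k) - y t - k *\<^sub>R (A t * y t))"
      by (metis norm_triangle_ineq)
    also have "\<dots> \<le> (1 + (norm (k *\<^sub>R A t))\<^sup>2) * norm (y t) + k * (\<rho> + \<epsilon> / 2)"
    proof (rule add_mono)
      have "norm ((1 + k *\<^sub>R A t) * y t) \<le> norm (1 + k *\<^sub>R A t) * norm (y t)" by (rule norm_mult_ineq)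
      also have "\<dots> \<le> (1 + (norm (k *\<^sub>R A t))\<^sup>2) * norm (y t)"
        using A[of t] t by (intro mult_right_mono norm_one_plus_le S_intros) auto
      finally show "norm ((1 + k *\<^sub>R A t) * y t) \<le> (1 + (norm (k *\<^sub>R A t))\<^sup>2) * norm (y t)" .
      show "norm (y (t + k) - y t - k *\<^sub>R (A t * y t)) \<le> k * (\<rho> + \<epsilon> / 2)"
        using elim t by auto
    qed
    also have "\<dots> = norm (y t) + k * (k * K) + k * (\<rho> + \<epsilon> / 2)"
      by (simp add: K_def algebra_simps power_mult_distrib power2_eq_square)
    also have "\<dots> \<le> norm (y t) + k * (\<epsilon> / 2) + k * (\<rho> + \<epsilon> / 2)"
      using elim by (intro add_mono mult_left_mono) auto
    finally show ?case by (simp add: algebra_simps)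
  qed
qed

lemma growth_derivative:
  assumes "a \<le> b"
    and der: "\<And>t. t \<in> {a..b} \<Longrightarrow> (y has_vector_derivative A t * y t + r t) (at t within {a..b})"
    and A: "\<And>t. t \<in> {a..b} \<Longrightarrow> A t \<in> S"
    and r: "\<And>t. t \<in> {a..b} \<Longrightarrow> norm (r t) \<le> \<rho>"
  shows "norm (y b) \<le> norm (y a) + (b - a) * \<rho>"
proof (rule growth[OF \<open>a \<le> b\<close> _ A])
  show "continuous_on {a..b} y"
    by (rule continuous_on_vector_derivative[OF der])
  fix t \<epsilon> :: real assume t: "a \<le> t" "t < b" "\<epsilon> > 0"
  have "((\<lambda>k. norm ((y (t + k) - y t) /\<^sub>R k - A t * y t)) \<longlongrightarrow> norm (A t * y t + r t - A t * y t)) (at_right 0)"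
    by (intro tendsto_intros has_vector_derivative_at_right_quotient[OF der]) (use t in auto)
  then have "\<forall>\<^sub>F k in at_right 0. norm ((y (t + k) - y t) /\<^sub>R k - A t * y t) < \<rho> + \<epsilon>"
    using r[of t] t by (intro order_tendstoD) auto
  then show "\<forall>\<^sub>F k in at_right 0. norm (y (t + k) - y t - k *\<^sub>R (A t * y t)) \<le> k * (\<rho> + \<epsilon>)"
    using eventually_at_right_less[of 0]
  proof eventually_elim
    case (elim k)
    have "y (t + k) - y t - k *\<^sub>R (A t * y t) = k *\<^sub>R ((y (t + k) - y t) /\<^sub>R k - A t * y t)"
      using elim by (simp add: algebra_simps)
    then show ?case using elim by (simp add: mult_left_mono)
  qed
qed auto

lemma norm_exp_le_1:
  assumes "x \<in> S"
  shows "norm (exp x) \<le> 1"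
proof -
  have "norm (exp (1 *\<^sub>R x)) \<le> norm (exp (0 *\<^sub>R x)) + (1 - 0) * 0"
    by (rule growth_derivative[where A = "\<lambda>_. x" and r = "\<lambda>_. 0"])
      (auto simp: assms intro!: has_vector_derivative_at_within[OF exp_scaleR_has_vector_derivative_left])
  then show ?thesis by simp
qed

text \<open>The difference \<open>z\<close> of \<open>exp (s x)\<close> and \<open>exp (s y)\<close>
  solves \<open>z' = x z + (x - y) exp (s y)\<close>. The source term is at most
  \<open>norm (x - y)\<close> because \<open>exp (s y)\<close> is a contraction, whence the
  Lipschitz constant 1.\<close>

lemma norm_exp_diff_le:
  assumes "x \<in> S" "y \<in> S"
  shows "norm (exp x - exp y) \<le> norm (x - y)"
proof -
  have "norm (exp (1 *\<^sub>R x) - exp (1 *\<^sub>R y)) \<le> norm (exp (0 *\<^sub>R x) - exp (0 *\<^sub>R y)) + (1 - 0) * norm (x - y)"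
  proof (rule growth_derivative[where A = "\<lambda>_. x" and r = "\<lambda>s. (x - y) * exp (s *\<^sub>R y)"
        and y = "\<lambda>s. exp (s *\<^sub>R x) - exp (s *\<^sub>R y)"])
    fix s :: real assume "s \<in> {0..1}"
    show "((\<lambda>s. exp (s *\<^sub>R x) - exp (s *\<^sub>R y)) has_vector_derivative
         x * (exp (s *\<^sub>R x) - exp (s *\<^sub>R y)) + (x - y) * exp (s *\<^sub>R y)) (at s within {0..1})"
      by (rule has_vector_derivative_eq_rhs)
        (auto simp: algebra_simps
          intro!: has_vector_derivative_diff has_vector_derivative_at_within[OF exp_scaleR_has_vector_derivative_left])
    have "norm ((x - y) * exp (s *\<^sub>R y)) \<le> norm (x - y) * norm (exp (s *\<^sub>R y))" by (rule norm_mult_ineq)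
    also have "\<dots> \<le> norm (x - y)"
      using norm_exp_le_1[of "s *\<^sub>R y"] S_intros assms by (intro mult_left_le) auto
    finally show "norm ((x - y) * exp (s *\<^sub>R y)) \<le> norm (x - y)" .
  qed (use assms in auto)
  then show ?thesis by simp
qed

text \<open>The distance to \<open>S\<close> has slope 0: a point of \<open>S\<close> shifted by
  \<open>k f'(t)\<close> stays in \<open>S\<close>, so over a short time \<open>k\<close> the
  distance grows by at most \<open>k \<epsilon>\<close>. This is what places the Magnus terms in
  \<open>S\<close>.\<close>

lemma antiderivative_in_S:
  assumes "a \<le> b" "\<And>t. t \<in> {a..b} \<Longrightarrow> (f has_vector_derivative f' t) (at t within {a..b})"
    and "\<And>t. t \<in> {a..b} \<Longrightarrow> f' t \<in> S" "f a \<in> S"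
  shows "f b \<in> S"
proof -
  have ne: "S \<noteq> {}" using S_intros by auto
  have "infdist (f b) S \<le> infdist (f a) S + (b - a) * 0"
  proof (rule dini_growth[OF \<open>a \<le> b\<close>])
    show "continuous_on {a..b} (\<lambda>t. infdist (f t) S)"
      using assms by (intro continuous_intros continuous_on_vector_derivative)
    fix t \<epsilon> :: real assume t: "a \<le> t" "t < b" "\<epsilon> > 0"
    have "((\<lambda>k. norm ((f (t + k) - f t) /\<^sub>R k - f' t)) \<longlongrightarrow> norm (f' t - f' t)) (at_right 0)"
      using t by (intro tendsto_intros has_vector_derivative_at_right_quotient[OF assms(2)]) auto
    then have "\<forall>\<^sub>F k in at_right 0. norm ((f (t + k) - f t) /\<^sub>R k - f' t) < \<epsilon>"
      using t by (intro order_tendstoD) auto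
    then show "\<forall>\<^sub>F k in at_right 0. infdist (f (t + k)) S \<le> infdist (f t) S + k * (0 + \<epsilon>)"
      using eventually_at_right_less[of 0]
    proof eventually_elim
      case (elim k)
      have e: "norm (f (t + k) - f t - k *\<^sub>R f' t) \<le> k * \<epsilon>"
      proof -
        have "f (t + k) - f t - k *\<^sub>R f' t = k *\<^sub>R ((f (t + k) - f t) /\<^sub>R k - f' t)"
          using elim by (simp add: algebra_simps)
        then show ?thesis using elim by (simp add: mult_left_mono)
      qed
      have "infdist (f (t + k)) S - k * \<epsilon> \<le> infdist (f t) S"
        unfolding infdist_notempty[OF ne, of "f t"]
      proof (rule cINF_greatest[OF ne])
        fix z assume "z \<in> S"
        then have "z + k *\<^sub>R f' t \<in> S" using assms(3)[of t] t by (auto intro!: S_intros)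
        then have "infdist (f (t + k)) S \<le> dist (f (t + k)) (z + k *\<^sub>R f' t)" by (rule infdist_le)
        also have "\<dots> = norm ((f t - z) + (f (t + k) - f t - k *\<^sub>R f' t))"
          by (simp add: dist_norm algebra_simps)
        also have "\<dots> \<le> norm (f t - z) + k * \<epsilon>" using e by (intro norm_triangle_le) auto
        finally show "infdist (f (t + k)) S - k * \<epsilon> \<le> dist (f t) z" by (simp add: dist_norm)
      qed
      then show ?case by simp
    qed
  qed
  then have "infdist (f b) S = 0" using assms(4) infdist_nonneg[of "f b" S] by simp
  then show ?thesis using in_closed_iff_infdist_zero[OF closed_S ne] by simp
qed

end

section \<open>Local error of an exponential ansatz\<close>

context skew_algebra
begin

text \<open>\<open>P s\<close> truncates the integral of \<open>e^{r ad x} d\<close> over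
  \<open>r\<close> in \<open>[0,s]\<close>. It satisfies \<open>P' = d + [x,P]\<close> up to
  \<open>(s^3/6) B3\<close>, so \<open>(1 + P s) exp (s x)\<close> solves the equation of
  \<open>exp (s (x + d))\<close> with a defect made of this bracket and of \<open>d P\<close>, which
  is quadratic in \<open>d\<close>. The quadratic part disappears once increments are divided by
  their length.\<close>

lemma norm_exp_add_expansion:
  assumes "x \<in> S" "d \<in> S"
  shows "norm (exp (x + d) - (1 + dexp3 x d) * exp x)
    \<le> norm (lie_bracket x (lie_bracket x (lie_bracket x d))) + (norm d)\<^sup>2 * (1 + norm x + (norm x)\<^sup>2)"
proof -
  define B1 where "B1 = lie_bracket x d"
  define B2 where "B2 = lie_bracket x B1"
  define B3 where "B3 = lie_bracket x B2"
  define P where "P s = s *\<^sub>R d + (s\<^sup>2 / 2) *\<^sub>R B1 + (s ^ 3 / 6) *\<^sub>R B2" for s :: real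
  define r where "r s = ((s ^ 3 / 6) *\<^sub>R B3 + d * P s) * exp (s *\<^sub>R x)" for s :: real
  define \<rho> where "\<rho> = norm B3 + (norm d)\<^sup>2 * (1 + norm x + (norm x)\<^sup>2)"
  have nB1: "norm B1 \<le> 2 * norm x * norm d" unfolding B1_def by (rule norm_lie_bracket_le)
  have nB2: "norm B2 \<le> 4 * (norm x)\<^sup>2 * norm d"
  proof -
    have "norm B2 \<le> 2 * norm x * norm B1" unfolding B2_def by (rule norm_lie_bracket_le)
    also have "\<dots> \<le> 2 * norm x * (2 * norm x * norm d)" using nB1 by (intro mult_left_mono) auto
    finally show ?thesis by (simp add: power2_eq_square)
  qed
  have "norm (exp (1 *\<^sub>R (x + d)) - (1 + P 1) * exp (1 *\<^sub>R x))
      \<le> norm (exp (0 *\<^sub>R (x + d)) - (1 + P 0) * exp (0 *\<^sub>R x)) + (1 - 0) * \<rho>"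
  proof (rule growth_derivative[where A = "\<lambda>_. x + d" and r = r
        and y = "\<lambda>s. exp (s *\<^sub>R (x + d)) - (1 + P s) * exp (s *\<^sub>R x)"])
    fix s :: real assume s: "s \<in> {0..1}"
    have dP: "(P has_vector_derivative d + s *\<^sub>R B1 + (s\<^sup>2 / 2) *\<^sub>R B2) (at s within {0..1})"
      unfolding P_def
      by (auto intro!: derivative_eq_intros simp: has_vector_derivative_def fun_eq_iff algebra_simps
          power2_eq_square power3_eq_cube)
    have "((\<lambda>s. exp (s *\<^sub>R (x + d)) - (1 + P s) * exp (s *\<^sub>R x)) has_vector_derivative
         (x + d) * exp (s *\<^sub>R (x + d)) - ((1 + P s) * (x * exp (s *\<^sub>R x))
           + (0 + (d + s *\<^sub>R B1 + (s\<^sup>2 / 2) *\<^sub>R B2)) * exp (s *\<^sub>R x))) (at s within {0..1})"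
      by (intro has_vector_derivative_diff has_vector_derivative_mult has_vector_derivative_add dP
          has_vector_derivative_const has_vector_derivative_at_within[OF exp_scaleR_has_vector_derivative_left])
    moreover have "(x + d) * exp (s *\<^sub>R (x + d)) - ((1 + P s) * (x * exp (s *\<^sub>R x))
           + (0 + (d + s *\<^sub>R B1 + (s\<^sup>2 / 2) *\<^sub>R B2)) * exp (s *\<^sub>R x))
       = (x + d) * (exp (s *\<^sub>R (x + d)) - (1 + P s) * exp (s *\<^sub>R x)) + r s"
    proof -
      have "lie_bracket x (P s) = s *\<^sub>R B1 + (s\<^sup>2 / 2) *\<^sub>R B2 + (s ^ 3 / 6) *\<^sub>R B3"
        unfolding P_def B1_def B2_def B3_def
        by (simp add: lie_bracket.add_right lie_bracket.scaleR_right)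
      then have "(s ^ 3 / 6) *\<^sub>R B3 = x * P s - P s * x - s *\<^sub>R B1 - (s\<^sup>2 / 2) *\<^sub>R B2"
        by (simp add: lie_bracket_def)
      then show ?thesis unfolding r_def by (simp only:) (simp add: algebra_simps)
    qed
    ultimately show "((\<lambda>s. exp (s *\<^sub>R (x + d)) - (1 + P s) * exp (s *\<^sub>R x)) has_vector_derivative
         (x + d) * (exp (s *\<^sub>R (x + d)) - (1 + P s) * exp (s *\<^sub>R x)) + r s) (at s within {0..1})"
      by simp
    have s3: "\<bar>s ^ 3 / 6\<bar> \<le> 1 / 6" "s\<^sup>2 / 2 \<le> 1 / 2" "\<bar>s\<bar> \<le> 1"
      using s by (auto simp: power_le_one abs_le_iff)
    have "norm (P s) \<le> norm (s *\<^sub>R d) + norm ((s\<^sup>2 / 2) *\<^sub>R B1) + norm ((s ^ 3 / 6) *\<^sub>R B2)"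
      unfolding P_def by (meson add_right_mono norm_triangle_ineq order_trans)
    also have "\<dots> = \<bar>s\<bar> * norm d + (s\<^sup>2 / 2) * norm B1 + \<bar>s ^ 3 / 6\<bar> * norm B2" by simp
    also have "\<dots> \<le> 1 * norm d + (1 / 2) * (2 * norm x * norm d) + (1 / 6) * (4 * (norm x)\<^sup>2 * norm d)"
      by (intro add_mono mult_mono nB1 nB2 s3) auto
    also have "\<dots> \<le> norm d * (1 + norm x + (norm x)\<^sup>2)" by (simp add: algebra_simps)
    finally have nP: "norm (P s) \<le> norm d * (1 + norm x + (norm x)\<^sup>2)" .
    have "norm (r s) \<le> norm ((s ^ 3 / 6) *\<^sub>R B3 + d * P s) * norm (exp (s *\<^sub>R x))"
      unfolding r_def by (rule norm_mult_ineq)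
    also have "\<dots> \<le> norm ((s ^ 3 / 6) *\<^sub>R B3 + d * P s)"
      using assms by (intro mult_left_le norm_exp_le_1 S_intros) auto
    also have "\<dots> \<le> \<bar>s ^ 3 / 6\<bar> * norm B3 + norm d * norm (P s)"
      by (rule norm_triangle_le, rule add_mono) (auto intro: norm_mult_ineq)
    also have "\<dots> \<le> 1 * norm B3 + norm d * (norm d * (1 + norm x + (norm x)\<^sup>2))"
      using s3 by (intro add_mono mult_mono nP) auto
    finally show "norm (r s) \<le> \<rho>" by (simp add: \<rho>_def power2_eq_square algebra_simps)
  qed (use assms S_intros in auto)
  moreover have "P 1 = dexp3 x d"
    by (simp add: P_def B1_def B2_def dexp3_def)
  moreover have "P 0 = 0"
    by (simp add: P_def)
  ultimately show ?thesis
    unfolding \<rho>_def B1_def B2_def B3_def by simp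
qed

lemma continuous_on_exp_S: "continuous_on S exp"
  unfolding continuous_on_iff dist_norm
  by (meson norm_exp_diff_le order.strict_trans1)

text \<open>A start value \<open>V a\<close> of norm at most 1 in place of the identity lets a
  single solution on the whole time interval serve every step. Instead of differentiating
  \<open>exp (X t)\<close>, the increment \<open>d\<close> of \<open>X\<close> over
  \<open>[t,t+k]\<close> is passed to \<open>norm_exp_add_expansion\<close>.\<close>

lemma magnus_step_error:
  assumes "a \<le> b"
    and V: "\<And>t. t \<in> {a..b} \<Longrightarrow> (V has_vector_derivative A t * V t) (at t within {a..b})"
    and X: "\<And>t. t \<in> {a..b} \<Longrightarrow> (X has_vector_derivative Y t) (at t within {a..b})"
    and "X a = 0" "norm (V a) \<le> 1"
    and AS: "\<And>t. t \<in> {a..b} \<Longrightarrow> A t \<in> S" and XS: "\<And>t. t \<in> {a..b} \<Longrightarrow> X t \<in> S"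
    and \<rho>: "\<And>t. t \<in> {a..b} \<Longrightarrow> norm (dexp3 (X t) (Y t) - A t)
        + norm (lie_bracket (X t) (lie_bracket (X t) (lie_bracket (X t) (Y t)))) \<le> \<rho>"
  shows "norm (V b - exp (X b) * V a) \<le> (b - a) * \<rho>"
proof -
  define W where "W t = V t - exp (X t) * V a" for t
  have "norm (W b) \<le> norm (W a) + (b - a) * \<rho>"
  proof (rule growth[OF \<open>a \<le> b\<close> _ AS])
    show "continuous_on {a..b} W"
      unfolding W_def using XS
      by (intro continuous_intros continuous_on_vector_derivative[OF V] continuous_on_compose2[OF continuous_on_exp_S]
          continuous_on_vector_derivative[OF X]) auto
    fix t \<epsilon> :: real assume t: "a \<le> t" "t < b" "\<epsilon> > 0"
    then have tab: "t \<in> {a..b}" by auto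
    define ad3 where "ad3 y = lie_bracket (X t) (lie_bracket (X t) (lie_bracket (X t) y))" for y
    have lin: "linear (dexp3 (X t))" "linear ad3"
      unfolding dexp3_def ad3_def
      by (auto intro!: linearI simp: lie_bracket.add_right lie_bracket.scaleR_right algebra_simps)
    define q where "q k = (X (t + k) - X t) /\<^sub>R k" for k
    \<comment> \<open>The defect per unit length: the error of the quotient of \<open>V\<close>, the
      mismatch of \<open>dexp3\<close>, the truncated bracket, and the quadratic part, which keeps a
      factor \<open>k\<close> and vanishes in the limit.\<close>
    define e where "e k = norm ((V (t + k) - V t) /\<^sub>R k - A t * V t) + norm (dexp3 (X t) (q k) - A t)
       + norm (ad3 (q k)) + k * ((norm (q k))\<^sup>2 * (1 + norm (X t) + (norm (X t))\<^sup>2))" for k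
    have q: "(q \<longlongrightarrow> Y t) (at_right 0)"
      unfolding q_def using has_vector_derivative_at_right_quotient[OF X] t by auto
    have "(e \<longlongrightarrow> norm (A t * V t - A t * V t) + norm (dexp3 (X t) (Y t) - A t)
       + norm (ad3 (Y t)) + 0 * ((norm (Y t))\<^sup>2 * (1 + norm (X t) + (norm (X t))\<^sup>2))) (at_right 0)"
      unfolding e_def dexp3_def ad3_def
      by (intro tendsto_intros q lie_bracket.tendsto has_vector_derivative_at_right_quotient[OF V])
        (use t in auto)
    then have "\<forall>\<^sub>F k in at_right 0. e k < \<rho> + \<epsilon>"
      using \<rho>[OF tab] t by (intro order_tendstoD(2)) (auto simp: ad3_def)
    moreover have "\<forall>\<^sub>F k in at_right 0. k < b - t"
      using t by (intro eventually_at_rightI[of 0 "b - t"]) auto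
    ultimately show "\<forall>\<^sub>F k in at_right 0. norm (W (t + k) - W t - k *\<^sub>R (A t * W t)) \<le> k * (\<rho> + \<epsilon>)"
      using eventually_at_right_less[of 0]
    proof eventually_elim
      case (elim k)
      define d where "d = X (t + k) - X t"
      have dq: "d = k *\<^sub>R q k" using elim by (simp add: d_def q_def)
      have dS: "d \<in> S" "X t \<in> S" unfolding d_def using t elim by (auto intro!: S_intros XS)
      define F where "F = exp (X t + d) - (1 + dexp3 (X t) d) * exp (X t)"
      have "W (t + k) - W t - k *\<^sub>R (A t * W t)
         = k *\<^sub>R ((V (t + k) - V t) /\<^sub>R k - A t * V t)
           - (F + k *\<^sub>R ((dexp3 (X t) (q k) - A t) * exp (X t))) * V a"
        using elim unfolding W_def F_def dq linear_scale[OF lin(1)]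
        by (simp add: dq[symmetric], simp add: d_def algebra_simps)
      also have "norm \<dots> \<le> norm (k *\<^sub>R ((V (t + k) - V t) /\<^sub>R k - A t * V t))
           + norm ((F + k *\<^sub>R ((dexp3 (X t) (q k) - A t) * exp (X t))) * V a)"
        by (rule norm_triangle_ineq4)
      also have "norm ((F + k *\<^sub>R ((dexp3 (X t) (q k) - A t) * exp (X t))) * V a)
          \<le> norm F + k * norm (dexp3 (X t) (q k) - A t)"
      proof -
        have "norm ((F + k *\<^sub>R ((dexp3 (X t) (q k) - A t) * exp (X t))) * V a)
          \<le> norm (F + k *\<^sub>R ((dexp3 (X t) (q k) - A t) * exp (X t))) * norm (V a)" by (rule norm_mult_ineq)
        also have "\<dots> \<le> norm (F + k *\<^sub>R ((dexp3 (X t) (q k) - A t) * exp (X t)))"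
          using assms by (intro mult_left_le) auto
        also have "\<dots> \<le> norm F + k * norm ((dexp3 (X t) (q k) - A t) * exp (X t))"
          using elim by (intro norm_triangle_le) auto
        also have "norm ((dexp3 (X t) (q k) - A t) * exp (X t))
            \<le> norm (dexp3 (X t) (q k) - A t) * norm (exp (X t))" by (rule norm_mult_ineq)
        also have "\<dots> \<le> norm (dexp3 (X t) (q k) - A t)"
          using dS by (intro mult_left_le norm_exp_le_1) auto
        finally show ?thesis using elim by (simp add: mult_left_mono)
      qed
      also have "norm F \<le> norm (ad3 d) + (norm d)\<^sup>2 * (1 + norm (X t) + (norm (X t))\<^sup>2)"
        unfolding F_def ad3_def using dS by (intro norm_exp_add_expansion)
      also have "\<dots> = k * norm (ad3 (q k)) + k * (k * ((norm (q k))\<^sup>2 * (1 + norm (X t) + (norm (X t))\<^sup>2)))"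
        using elim unfolding dq linear_scale[OF lin(2)] by (simp add: power_mult_distrib power2_eq_square)
      finally have "norm (W (t + k) - W t - k *\<^sub>R (A t * W t)) \<le> k * e k"
        unfolding e_def norm_scaleR abs_of_pos[OF \<open>0 < k\<close>] distrib_left by linarith
      also have "\<dots> \<le> k * (\<rho> + \<epsilon>)" using elim by (intro mult_left_mono) auto
      finally show ?case .
    qed
  qed
  then show ?thesis by (simp add: W_def \<open>X a = 0\<close>)
qed

end

section \<open>The residual of the second-order Magnus approximation\<close>

lemma norm_le_of_derivative:
  fixes f :: "real \<Rightarrow> 'b::real_normed_vector"
  assumes "\<And>s. s \<in> {a..b} \<Longrightarrow> (f has_vector_derivative f' s) (at s within {a..b})" "f a = 0"
    and "t \<in> {a..b}" "\<And>s. s \<in> {a..t} \<Longrightarrow> norm (f' s) \<le> B"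
  shows "norm (f t) \<le> B * (t - a)"
proof -
  have "norm (f t - f a) \<le> B * \<bar>t - a\<bar>"
    by (rule norm_vector_derivative_bound[of a t f f'])
      (use assms in \<open>auto intro!: has_vector_derivative_within_subset[of f _ _ "{a..b}" "{a..t}"]\<close>)
  then show ?thesis using assms by simp
qed

lemma norm_lie_bracket_mono:
  fixes x y :: "'a::real_normed_algebra"
  assumes "norm x \<le> p" "norm y \<le> q"
  shows "norm (lie_bracket x y) \<le> 2 * p * q"
proof -
  have "norm x * norm y \<le> p * q"
    using assms by (intro mult_mono) (auto intro: order_trans[OF norm_ge_zero])
  then show ?thesis using norm_lie_bracket_le[of x y] by simp
qed

lemma lie_bracket_swap: "lie_bracket y x = - lie_bracket x y" for x y :: "'a::ring"
  by (simp add: lie_bracket_def)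

lemma jacobi: "lie_bracket x (lie_bracket y z) = lie_bracket (lie_bracket x y) z + lie_bracket y (lie_bracket x z)"
  for x y z :: "'a::ring"
  by (simp add: lie_bracket_def algebra_simps)

lemmas lie_bracket_linear = lie_bracket.add_left lie_bracket.add_right lie_bracket.diff_left
  lie_bracket.diff_right lie_bracket.scaleR_left lie_bracket.scaleR_right
  lie_bracket.minus_left lie_bracket.minus_right

lemma has_vector_derivative_lie_bracket_right:
  fixes f :: "real \<Rightarrow> 'a::real_normed_algebra"
  assumes "(f has_vector_derivative f') F"
  shows "((\<lambda>t. lie_bracket z (f t)) has_vector_derivative lie_bracket z f') F"
  using assms by (rule bounded_linear.has_vector_derivative[OF lie_bracket.bounded_linear_right])

lemma has_vector_derivative_lie_bracket_left:
  fixes f :: "real \<Rightarrow> 'a::real_normed_algebra"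
  assumes "(f has_vector_derivative f') F"
  shows "((\<lambda>t. lie_bracket (f t) z) has_vector_derivative lie_bracket f' z) F"
  using assms by (rule bounded_linear.has_vector_derivative[OF lie_bracket.bounded_linear_left])

lemma has_vector_derivative_scaleR_const:
  assumes "(g has_real_derivative g') F"
  shows "((\<lambda>s. g s *\<^sub>R v) has_vector_derivative g' *\<^sub>R v) F"
  using assms unfolding has_real_derivative_iff_has_vector_derivative
  by (rule bounded_linear.has_vector_derivative[OF bounded_linear_scaleR_left])

text \<open>The Magnus terms are given by derivative and initial value, so that bounds pass from
  \<open>A\<close> to \<open>X1\<close> and \<open>X2\<close> by the mean value inequality and no
  integral has to be estimated.\<close>

locale magnus_terms =
  fixes A X1 X2 :: "real \<Rightarrow> 'a::real_normed_algebra_1" and a b :: real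
  assumes a_le_b: "a \<le> b"
    and X1: "\<And>t. t \<in> {a..b} \<Longrightarrow> (X1 has_vector_derivative A t) (at t within {a..b})"
    and X2: "\<And>t. t \<in> {a..b} \<Longrightarrow>
          (X2 has_vector_derivative lie_bracket (A t) (X1 t) /\<^sub>R 2) (at t within {a..b})"
    and X1_a: "X1 a = 0" and X2_a: "X2 a = 0"
begin

definition X where "X t = X1 t + X2 t"
definition Y2 where "Y2 t = lie_bracket (A t) (X1 t) /\<^sub>R 2"
definition Y where "Y t = A t + Y2 t"
text \<open>The defect in exactly the form that \<open>magnus_step_error\<close> has to
  bound.\<close>

definition residual where
  "residual t = norm (dexp3 (X t) (Y t) - A t)
     + norm (lie_bracket (X t) (lie_bracket (X t) (lie_bracket (X t) (Y t))))"

lemma X_derivative: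
  "t \<in> {a..b} \<Longrightarrow> (X has_vector_derivative Y t) (at t within {a..b})"
  unfolding X_def[abs_def] Y_def Y2_def by (intro has_vector_derivative_add X1 X2)

lemma X_a: "X a = 0"
  by (simp add: X_def X1_a X2_a)

text \<open>The bracket of the first Magnus term with \<open>A\<close> cancels \<open>Y2\<close>.\<close>

lemma dexp3_residual:
  "dexp3 (X t) (Y t) - A t = lie_bracket (X2 t) (A t) /\<^sub>R 2 + lie_bracket (X t) (Y2 t) /\<^sub>R 2
     + lie_bracket (X t) (lie_bracket (X t) (Y t)) /\<^sub>R 6"
proof -
  have "lie_bracket (X t) (Y t) /\<^sub>R 2 =
      - Y2 t + lie_bracket (X2 t) (A t) /\<^sub>R 2 + lie_bracket (X t) (Y2 t) /\<^sub>R 2"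
    unfolding X_def Y_def Y2_def
    by (simp add: lie_bracket_linear lie_bracket_swap[of "X1 t" "A t"] scaleR_right_distrib scaleR_right_diff_distrib)
  then show ?thesis unfolding dexp3_def Y_def by simp
qed

context
  fixes \<alpha> :: real
  assumes A_le: "\<And>t. t \<in> {a..b} \<Longrightarrow> norm (A t) \<le> \<alpha>" and small: "(b - a) * \<alpha> \<le> 1"
begin

lemma \<alpha>_nonneg: "\<alpha> \<ge> 0"
  using A_le[of a] a_le_b norm_ge_zero[of "A a"] by (meson atLeastAtMost_iff order_refl order_trans)

lemma norm_X1_le: "norm (X1 t) \<le> \<alpha> * (t - a)" if "t \<in> {a..b}"
  by (rule norm_le_of_derivative[OF X1 X1_a]) (use A_le that in auto)

lemma time_small: "\<alpha> * (t - a) \<le> 1" if "t \<in> {a..b}"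
proof -
  have "\<alpha> * (t - a) \<le> \<alpha> * (b - a)" using \<alpha>_nonneg that by (intro mult_left_mono) auto
  then show ?thesis using small by (simp add: mult.commute)
qed

lemma norm_X1_le_1: "norm (X1 t) \<le> 1" if "t \<in> {a..b}"
  using norm_X1_le[OF that] time_small[OF that] by simp

lemma norm_Y2_le: "norm (Y2 t) \<le> \<alpha>" if "t \<in> {a..b}"
  using norm_lie_bracket_mono[OF A_le[OF that] norm_X1_le_1[OF that]] by (simp add: Y2_def)

lemma norm_X2_le_1: "norm (X2 t) \<le> 1" if "t \<in> {a..b}"
proof -
  have "norm (X2 t) \<le> \<alpha> * (t - a)"
    by (rule norm_le_of_derivative[OF X2 X2_a]) (use norm_Y2_le that in \<open>auto simp: Y2_def\<close>)
  then show ?thesis using time_small[OF that] by simp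
qed

text \<open>Traced back to \<open>A\<close>, every bracket in the residual has at least three
  factors. Replacing a factor \<open>A\<close> by its antiderivative \<open>X1\<close> gains a
  factor \<open>h\<close>, so the basic brackets are at most \<open>n = \<kappa> h^2\<close>;
  surplus factors are bounded in norm, where \<open>h \<alpha> <= 1\<close> is used.\<close>

lemma residual_commutator_bound:
  assumes t: "t \<in> {a..b}"
    and \<kappa>: "\<And>\<tau> s t. \<tau> \<in> {a..b} \<Longrightarrow> s \<in> {a..b} \<Longrightarrow> t \<in> {a..b} \<Longrightarrow>
        norm (lie_bracket (A \<tau>) (lie_bracket (A s) (A t))) \<le> \<kappa>"
  shows "residual t \<le> 90 * \<kappa> * (b - a)\<^sup>2"
proof -
  define h n where "h = b - a" and "n = \<kappa> * h\<^sup>2"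
  have h: "h \<ge> 0" "\<alpha> * h \<le> 1" using a_le_b small by (simp_all add: h_def mult.commute)
  have \<kappa>0: "\<kappa> \<ge> 0" using \<kappa>[OF t t t] norm_ge_zero order_trans by blast
  have le_h: "c * (u - a) \<le> c * h" if "c \<ge> 0" "u \<in> {a..b}" for c u
    using that by (auto simp: h_def intro: mult_left_mono)
  have b1: "norm (lie_bracket (A \<tau>) (lie_bracket (A s) (X1 u))) \<le> \<kappa> * h"
    if "\<tau> \<in> {a..b}" "s \<in> {a..b}" "u \<in> {a..b}" for \<tau> s u
  proof -
    have "norm (lie_bracket (A \<tau>) (lie_bracket (A s) (X1 u))) \<le> \<kappa> * (u - a)"
      by (rule norm_le_of_derivative[where f = "\<lambda>u. lie_bracket (A \<tau>) (lie_bracket (A s) (X1 u))",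
            OF has_vector_derivative_lie_bracket_right[OF has_vector_derivative_lie_bracket_right[OF X1]]])
        (use that \<kappa> in \<open>auto simp: X1_a lie_bracket.zero_right\<close>)
    then show ?thesis using le_h[OF \<kappa>0 that(3)] by linarith
  qed
  have b2: "norm (lie_bracket (X1 v) (lie_bracket (A s) (X1 u))) \<le> n"
    if "v \<in> {a..b}" "s \<in> {a..b}" "u \<in> {a..b}" for v s u
  proof -
    have "norm (lie_bracket (X1 v) (lie_bracket (A s) (X1 u))) \<le> (\<kappa> * h) * (v - a)"
      by (rule norm_le_of_derivative[where f = "\<lambda>v. lie_bracket (X1 v) (lie_bracket (A s) (X1 u))",
            OF has_vector_derivative_lie_bracket_left[OF X1]])
        (use that b1 in \<open>auto simp: X1_a lie_bracket.zero_left\<close>)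
    also have "\<dots> \<le> (\<kappa> * h) * h" using \<kappa>0 h that by (intro le_h) auto
    finally show ?thesis by (simp add: n_def power2_eq_square)
  qed
  have b3: "norm (lie_bracket (A s) (X2 u)) \<le> n" if "s \<in> {a..b}" "u \<in> {a..b}" for s u
  proof -
    have "norm (lie_bracket (A s) (X2 u)) \<le> (\<kappa> * h) * (u - a)"
    proof (rule norm_le_of_derivative[where f = "\<lambda>u. lie_bracket (A s) (X2 u)",
            OF has_vector_derivative_lie_bracket_right[OF X2]])
      fix w assume "w \<in> {a..u}"
      then have "norm (lie_bracket (A s) (lie_bracket (A w) (X1 w))) \<le> \<kappa> * h"
        using that by (intro b1) auto
      then show "norm (lie_bracket (A s) (lie_bracket (A w) (X1 w) /\<^sub>R 2)) \<le> \<kappa> * h"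
        by (simp add: lie_bracket.scaleR_right)
          (use norm_ge_zero[of "lie_bracket (A s) (lie_bracket (A w) (X1 w))"] in linarith)
    qed (use that in \<open>auto simp: X2_a lie_bracket.zero_right\<close>)
    also have "\<dots> \<le> (\<kappa> * h) * h" using \<kappa>0 h that by (intro le_h) auto
    finally show ?thesis by (simp add: n_def power2_eq_square)
  qed
  have b4: "norm (lie_bracket (X1 v) (X2 u)) \<le> n * h" if "v \<in> {a..b}" "u \<in> {a..b}" for v u
  proof -
    have "norm (lie_bracket (X1 v) (X2 u)) \<le> n * (v - a)"
      by (rule norm_le_of_derivative[where f = "\<lambda>v. lie_bracket (X1 v) (X2 u)",
            OF has_vector_derivative_lie_bracket_left[OF X1]])
        (use that b3 in \<open>auto simp: X1_a lie_bracket.zero_left\<close>)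
    also have "\<dots> \<le> n * h" using \<kappa>0 h that by (intro le_h) (auto simp: n_def)
    finally show ?thesis .
  qed
  have n0: "n \<ge> 0" using \<kappa>0 by (simp add: n_def)
  have X1n: "norm (X1 t) \<le> 1" and X2n: "norm (X2 t) \<le> 1" and An: "norm (A t) \<le> \<alpha>"
    using t by (auto intro: norm_X1_le_1 norm_X2_le_1 A_le)
  have Xn: "norm (X t) \<le> 2" unfolding X_def using X1n X2n by (intro norm_triangle_le) auto
  have X2A: "norm (lie_bracket (X2 t) (A t)) \<le> n"
    using b3[OF t t] by (simp add: lie_bracket_swap[of "X2 t"])
  have X1Y: "norm (lie_bracket (X1 t) (lie_bracket (A t) (X1 t))) \<le> n"
    using t by (intro b2)
  \<comment> \<open>\<open>X2\<close> is built from brackets itself, so this is not a nested bracket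
    of the form that \<kappa> controls. The Jacobi identity turns it into brackets containing
    \<open>[X2,A]\<close> or \<open>[X2,X1]\<close>, which \<open>b3\<close> and \<open>b4\<close>
    bound.\<close>
  have X2Y: "norm (lie_bracket (X2 t) (lie_bracket (A t) (X1 t))) \<le> 4 * n"
  proof -
    have "norm (lie_bracket (lie_bracket (X2 t) (A t)) (X1 t)) \<le> 2 * n * 1"
      by (intro norm_lie_bracket_mono X2A X1n)
    moreover have "norm (lie_bracket (A t) (lie_bracket (X2 t) (X1 t))) \<le> 2 * \<alpha> * (n * h)"
      using b4[OF t t] by (intro norm_lie_bracket_mono An) (simp add: lie_bracket_swap[of "X2 t"])
    moreover have "2 * \<alpha> * (n * h) \<le> 2 * n"
      using mult_left_mono[OF h(2) n0] by (simp add: ac_simps)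
    ultimately show ?thesis
      unfolding jacobi[of "X2 t" "A t" "X1 t"] by (intro norm_triangle_le) linarith
  qed
  have XY2: "norm (lie_bracket (X t) (Y2 t)) \<le> 3 * n"
  proof -
    have "norm (lie_bracket (X t) (lie_bracket (A t) (X1 t))) \<le> n + 4 * n"
      unfolding X_def lie_bracket.add_left by (intro norm_triangle_mono X1Y X2Y)
    then show ?thesis using n0 by (simp add: Y2_def lie_bracket.scaleR_right)
  qed
  have XXX1A: "norm (lie_bracket (X t) (lie_bracket (X1 t) (A t))) \<le> n + 4 * n"
    unfolding X_def lie_bracket.add_left lie_bracket_swap[of "X1 t" "A t"] lie_bracket.minus_right norm_minus_cancel
    using norm_triangle_mono[OF X1Y X2Y] by (simp add: norm_minus_commute)
  have XXY: "norm (lie_bracket (X t) (lie_bracket (X t) (Y t))) \<le> 21 * n"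
  proof -
    have "norm (lie_bracket (X t) (lie_bracket (X2 t) (A t))) \<le> 2 * 2 * n"
      by (intro norm_lie_bracket_mono Xn X2A)
    moreover have "norm (lie_bracket (X t) (lie_bracket (X t) (Y2 t))) \<le> 2 * 2 * (3 * n)"
      by (intro norm_lie_bracket_mono Xn XY2)
    moreover have "lie_bracket (X t) (lie_bracket (X t) (Y t)) =
      (lie_bracket (X t) (lie_bracket (X1 t) (A t)) + lie_bracket (X t) (lie_bracket (X2 t) (A t)))
       + lie_bracket (X t) (lie_bracket (X t) (Y2 t))"
      unfolding Y_def by (simp add: X_def lie_bracket_linear algebra_simps)
    ultimately have "norm (lie_bracket (X t) (lie_bracket (X t) (Y t))) \<le> (n + 4 * n + 2 * 2 * n) + 2 * 2 * (3 * n)"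
      using XXX1A by (simp only:) (intro norm_triangle_mono)
    then show ?thesis by simp
  qed
  have "norm (lie_bracket (X t) (lie_bracket (X t) (lie_bracket (X t) (Y t)))) \<le> 2 * 2 * (21 * n)"
    by (intro norm_lie_bracket_mono Xn XXY)
  moreover have "norm (dexp3 (X t) (Y t) - A t) \<le> (n / 2 + 3 * n / 2) + 21 * n / 6"
    unfolding dexp3_residual using X2A XY2 XXY by (intro norm_triangle_mono) auto
  \<comment> \<open>In units of \<open>n\<close> the total is
    \<open>2 + 3.5 + 84 = 89.5\<close>.\<close>
  ultimately have "residual t \<le> 90 * n"
    unfolding residual_def using n0 by linarith
  then show ?thesis by (simp add: n_def h_def)
qed

end

text \<open>With \<open>u = t - a\<close>, \<open>c = [a0, b0]\<close> and \<open>d = [a0, c]\<close>, the terms of the residual contribute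
  \<open>u^3/24 d\<close>, \<open>- u^3/8 d\<close> and \<open>u^3/12 d\<close>, which add up to zero. The remainders are estimated
  in the dimensionless variable \<open>x = N u\<close>.\<close>

lemma residual_fourth_order:
  assumes t: "t \<in> {a..b}" and N: "N \<ge> 0" "N * (b - a) \<le> 1"
    and A_le: "\<And>s. s \<in> {a..b} \<Longrightarrow> norm (A s) \<le> N"
    and b0: "norm b0 \<le> N\<^sup>2"
    and taylor: "\<And>s. s \<in> {a..b} \<Longrightarrow> norm (A s - A a - (s - a) *\<^sub>R b0) \<le> N ^ 3 * (s - a)\<^sup>2"
  shows "residual t \<le> 6000 * N ^ 5 * (t - a) ^ 4"
proof -
  define a0 where "a0 = A a"
  have a0: "norm a0 \<le> N" unfolding a0_def using a_le_b by (intro A_le) auto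
  define e where "e s = A s - a0 - (s - a) *\<^sub>R b0" for s
  define c d where "c = lie_bracket a0 b0" and "d = lie_bracket a0 c"
  define e1 where "e1 s = X1 s - (s - a) *\<^sub>R a0 - ((s - a)\<^sup>2 / 2) *\<^sub>R b0" for s
  define r where "r s = lie_bracket a0 (e1 s) + (s - a) *\<^sub>R lie_bracket b0 (e1 s) + lie_bracket (e s) (X1 s)" for s
  \<comment> \<open>The leading term of \<open>[A,X1]/2\<close> is \<open>- (u^2/4) c\<close> with
    \<open>u = s - a\<close>; integrated, it gives \<open>- (u^3/12) c\<close>, and
    \<open>e2\<close> is the rest of \<open>X2\<close>.\<close>
  define e2 where "e2 s = X2 s + ((s - a) ^ 3 / 12) *\<^sub>R c" for s
  \<comment> \<open>The linear term vanishes since \<open>[a0,a0] = 0\<close>. The quadratic one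
    collects \<open>u^2/2\<close> from \<open>[a0,b0]\<close> and \<open>- u^2\<close> from
    \<open>[b0,a0]\<close>.\<close>
  have bracket_AX1: "lie_bracket (A s) (X1 s) = - ((s - a)\<^sup>2 / 2) *\<^sub>R c + r s" for s
  proof -
    define u where "u = s - a"
    have As: "A s = a0 + u *\<^sub>R b0 + e s" by (simp add: e_def u_def)
    have Xs: "X1 s = u *\<^sub>R a0 + (u\<^sup>2 / 2) *\<^sub>R b0 + e1 s" by (simp add: e1_def u_def)
    have "lie_bracket (A s) (X1 s) = lie_bracket a0 (X1 s) + u *\<^sub>R lie_bracket b0 (X1 s) + lie_bracket (e s) (X1 s)"
      unfolding As by (simp add: lie_bracket_linear)
    moreover have "lie_bracket a0 (X1 s) = (u\<^sup>2 / 2) *\<^sub>R c + lie_bracket a0 (e1 s)"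
      unfolding Xs c_def by (simp add: lie_bracket_linear lie_bracket_def[of a0 a0])
    moreover have "lie_bracket b0 (X1 s) = - u *\<^sub>R c + lie_bracket b0 (e1 s)"
      unfolding Xs c_def by (simp add: lie_bracket_linear lie_bracket_def[of b0 b0] lie_bracket_swap[of b0 a0])
    ultimately have "lie_bracket (A s) (X1 s) = ((u\<^sup>2 / 2) *\<^sub>R c + (u * (- u)) *\<^sub>R c) + r s"
      unfolding r_def u_def[symmetric]
      by (simp only: scaleR_right_distrib scaleR_scaleR add_ac)
    also have "(u\<^sup>2 / 2) *\<^sub>R c + (u * (- u)) *\<^sub>R c = (- (u\<^sup>2 / 2)) *\<^sub>R c"
      unfolding scaleR_left_distrib[symmetric] by (simp add: power2_eq_square)
    finally show ?thesis by (simp add: u_def)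
  qed
  have e1': "(e1 has_vector_derivative e s) (at s within {a..b})" if "s \<in> {a..b}" for s
  proof -
    have "(e1 has_vector_derivative A s - 1 *\<^sub>R a0 - (s - a) *\<^sub>R b0) (at s within {a..b})"
      unfolding e1_def
      by (intro has_vector_derivative_diff X1[OF that] has_vector_derivative_scaleR_const)
        (auto intro!: derivative_eq_intros)
    then show ?thesis by (simp add: e_def)
  qed
  have e2': "(e2 has_vector_derivative r s /\<^sub>R 2) (at s within {a..b})" if "s \<in> {a..b}" for s
  proof -
    have "(e2 has_vector_derivative lie_bracket (A s) (X1 s) /\<^sub>R 2 + ((s - a)\<^sup>2 / 4) *\<^sub>R c) (at s within {a..b})"
      unfolding e2_def
      by (intro has_vector_derivative_add X2[OF that] has_vector_derivative_scaleR_const)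
        (auto intro!: derivative_eq_intros)
    then show ?thesis by (simp add: bracket_AX1 algebra_simps)
  qed
  have small: "N * (s - a) \<le> 1" if "s \<in> {a..b}" for s
    by (rule order_trans[OF _ N(2)]) (use that N in \<open>auto intro: mult_left_mono\<close>)
  have ub0: "norm ((s - a) *\<^sub>R b0) \<le> N * (N * (s - a))" if "s \<in> {a..b}" for s
    using that mult_left_mono[OF b0, of "s - a"] by (simp add: power2_eq_square ac_simps)
  have e_le: "norm (e s) \<le> N * (N * (s - a))\<^sup>2" if "s \<in> {a..b}" for s
    using taylor[OF that] by (simp add: e_def a0_def power_mult_distrib power2_eq_square power3_eq_cube ac_simps)
  have X1_le: "norm (X1 s) \<le> N * (s - a)" if "s \<in> {a..b}" for s
    by (rule norm_le_of_derivative[OF X1 X1_a]) (use A_le that in auto)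
  have mono: "(N * (v - a)) ^ k \<le> (N * (w - a)) ^ k" if "a \<le> v" "v \<le> w" for v w k
    using that N by (intro power_mono mult_left_mono) auto
  have e1_le: "norm (e1 s) \<le> (N * (s - a)) ^ 3" if s: "s \<in> {a..b}" for s
  proof -
    have "norm (e1 s) \<le> (N * (N * (s - a))\<^sup>2) * (s - a)"
    proof (rule norm_le_of_derivative[OF e1'])
      fix w assume w: "w \<in> {a..s}"
      have "norm (e w) \<le> N * (N * (w - a))\<^sup>2" using w s by (intro e_le) auto
      also have "\<dots> \<le> N * (N * (s - a))\<^sup>2" using w N by (intro mult_left_mono mono) auto
      finally show "norm (e w) \<le> N * (N * (s - a))\<^sup>2" .
    qed (use s in \<open>auto simp: e1_def X1_a\<close>)
    then show ?thesis by (simp add: power2_eq_square power3_eq_cube ac_simps)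
  qed
  have r_le: "norm (r s) \<le> 6 * N * (N * (s - a)) ^ 3" if s: "s \<in> {a..b}" for s
  proof -
    define x where "x = N * (s - a)"
    have x: "0 \<le> x" "x \<le> 1" using small[OF s] N s by (auto simp: x_def)
    have "norm (lie_bracket a0 (e1 s)) \<le> 2 * N * x ^ 3"
      unfolding x_def by (intro norm_lie_bracket_mono a0 e1_le s)
    moreover have "norm ((s - a) *\<^sub>R lie_bracket b0 (e1 s)) \<le> 2 * (N * x) * x ^ 3"
      unfolding lie_bracket.scaleR_left[symmetric] x_def
      by (intro norm_lie_bracket_mono ub0 e1_le s)
    moreover have "2 * (N * x) * x ^ 3 \<le> 2 * N * x ^ 3"
      using mult_left_mono[OF power_decreasing[of 3 4 x] N(1)] x by (simp add: power_numeral_reduce ac_simps)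
    moreover have "norm (lie_bracket (e s) (X1 s)) \<le> 2 * (N * x\<^sup>2) * x"
      unfolding x_def by (intro norm_lie_bracket_mono e_le X1_le s)
    ultimately have "norm (r s) \<le> 2 * N * x ^ 3 + 2 * N * x ^ 3 + 2 * (N * x\<^sup>2) * x"
      unfolding r_def by (intro norm_triangle_mono) linarith+
    then show ?thesis by (simp add: x_def[symmetric] power2_eq_square power3_eq_cube)
  qed
  have e2_le: "norm (e2 t) \<le> 3 * (N * (t - a)) ^ 4"
  proof -
    have "norm (e2 t) \<le> (3 * N * (N * (t - a)) ^ 3) * (t - a)"
    proof (rule norm_le_of_derivative[OF e2'])
      fix w assume w: "w \<in> {a..t}"
      have "norm (r w) \<le> 6 * N * (N * (w - a)) ^ 3" using w t by (intro r_le) auto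
      also have "\<dots> \<le> 6 * N * (N * (t - a)) ^ 3" using w N by (intro mult_left_mono mono) auto
      finally show "norm (r w /\<^sub>R 2) \<le> 3 * N * (N * (t - a)) ^ 3" by simp
    qed (use t in \<open>auto simp: e2_def X2_a\<close>)
    then show ?thesis by (simp add: eval_nat_numeral ac_simps)
  qed
  define u x where "u = t - a" and "x = N * u"
  have u0: "u \<ge> 0" and x: "0 \<le> x" "x \<le> 1" using small[OF t] N t by (auto simp: x_def u_def)
  have p1: "x ^ 3 \<le> x\<^sup>2" "x ^ 4 \<le> x ^ 3" "x ^ 3 \<le> x"
    and p2: "N * x\<^sup>2 \<le> N * x" "N * x ^ 3 \<le> N * x\<^sup>2" "N * x ^ 4 \<le> N * x ^ 3" "N * x ^ 5 \<le> N * x ^ 4"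
    using x N power_decreasing[of 1 2 x] power_decreasing[of 1 3 x]
    by (auto intro!: power_decreasing mult_left_mono)
  have ub0': "norm (u *\<^sub>R b0) \<le> N * x" and e': "norm (e t) \<le> N * x\<^sup>2" and X1': "norm (X1 t) \<le> x"
    and e1'': "norm (e1 t) \<le> x ^ 3" and r': "norm (r t) \<le> 6 * N * x ^ 3" and e2'': "norm (e2 t) \<le> 3 * x ^ 4"
    using ub0[OF t] e_le[OF t] X1_le[OF t] e1_le[OF t] r_le[OF t] e2_le by (simp_all add: u_def x_def)
  have An: "norm (A t) \<le> N" by (rule A_le[OF t])
  \<comment> \<open>\<open>g\<close> and, below, \<open>f1\<close> are the deviations of
    \<open>A t\<close> from \<open>a0\<close> and of \<open>X1 t\<close> from \<open>u a0\<close>.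
    They are one power of \<open>x\<close> smaller than these, so in the brackets of the residual
    only the leading parts reach third order.\<close>
  define g where "g = u *\<^sub>R b0 + e t"
  have At: "A t = a0 + g" by (simp add: g_def e_def u_def)
  have g: "norm g \<le> 2 * N * x"
    unfolding g_def using p2 by (intro order_trans[OF norm_triangle_mono[OF ub0' e']]) simp
  define f1 where "f1 = (u\<^sup>2 / 2) *\<^sub>R b0 + e1 t"
  have X1t: "X1 t = u *\<^sub>R a0 + f1" by (simp add: f1_def e1_def u_def)
  have f1: "norm f1 \<le> 2 * x\<^sup>2"
  proof -
    have "norm ((u\<^sup>2 / 2) *\<^sub>R b0) = (u / 2) * norm (u *\<^sub>R b0)" using u0 by (simp add: power2_eq_square)
    also have "\<dots> \<le> (u / 2) * (N * x)" using u0 ub0' by (intro mult_left_mono) auto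
    also have "\<dots> = x\<^sup>2 / 2" by (simp add: x_def power2_eq_square)
    finally show ?thesis unfolding f1_def using p1 e1'' zero_le_power2[of x] by (intro norm_triangle_le) linarith
  qed
  have ua0: "norm (u *\<^sub>R a0) \<le> x" using u0 mult_left_mono[OF a0 u0] by (simp add: x_def mult.commute)
  have uc: "norm (u *\<^sub>R c) \<le> 2 * N * (N * x)"
    unfolding c_def lie_bracket.scaleR_right[symmetric] by (intro norm_lie_bracket_mono a0 ub0')
  have u2c: "norm (u\<^sup>2 *\<^sub>R c) \<le> 2 * N * x\<^sup>2"
    using mult_left_mono[OF uc u0] u0 by (simp add: x_def power2_eq_square ac_simps)
  have u3c: "norm (u ^ 3 *\<^sub>R c) \<le> 2 * x ^ 3"
    using mult_left_mono[OF u2c u0] u0 by (simp add: x_def power2_eq_square power3_eq_cube ac_simps)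
  have X2t: "X2 t = - (u ^ 3 / 12) *\<^sub>R c + e2 t" by (simp add: e2_def u_def)
  have X2n: "norm (X2 t) \<le> 4 * x ^ 3"
  proof -
    have "norm (- (u ^ 3 / 12) *\<^sub>R c) \<le> x ^ 3"
      using u3c u0 by simp (use zero_le_power[OF x(1), of 3] in linarith)
    then show ?thesis unfolding X2t using e2'' p1 by (intro norm_triangle_le) linarith
  qed
  have Y2t: "Y2 t = - (u\<^sup>2 / 4) *\<^sub>R c + r t /\<^sub>R 2"
    unfolding Y2_def bracket_AX1 by (simp add: u_def scaleR_right_distrib scaleR_right_diff_distrib)
  have Y2n: "norm (Y2 t) \<le> 4 * N * x\<^sup>2"
  proof -
    have "norm (- (u\<^sup>2 / 4) *\<^sub>R c) \<le> N * x\<^sup>2"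
      using u2c by simp (use mult_nonneg_nonneg[OF N(1) zero_le_power2[of x]] in linarith)
    moreover have "norm (r t /\<^sub>R 2) \<le> 3 * (N * x ^ 3)" using r' by simp
    ultimately show ?thesis unfolding Y2t using p2 by (intro norm_triangle_le) linarith
  qed
  define r1 where "r1 = lie_bracket (e2 t) (A t) - lie_bracket ((u ^ 3 / 12) *\<^sub>R c) g"
  have r1: "lie_bracket (X2 t) (A t) = (u ^ 3 / 12) *\<^sub>R d + r1"
  proof -
    have "lie_bracket (X2 t) (A t) = - (u ^ 3 / 12) *\<^sub>R lie_bracket c (a0 + g) + lie_bracket (e2 t) (A t)"
      unfolding X2t lie_bracket.add_left lie_bracket.scaleR_left by (simp add: At)
    then show ?thesis unfolding r1_def d_def
      by (simp add: lie_bracket_linear lie_bracket_swap[of c a0] algebra_simps)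
  qed
  have r1n: "norm r1 \<le> 7 * (N * x ^ 4)"
  proof -
    have "norm (lie_bracket (e2 t) (A t)) \<le> 2 * (3 * x ^ 4) * N" by (intro norm_lie_bracket_mono e2'' An)
    moreover have "norm (lie_bracket ((u ^ 3 / 12) *\<^sub>R c) g) \<le> 2 * (x ^ 3 / 6) * (2 * N * x)"
      using u3c u0 by (intro norm_lie_bracket_mono g) (simp add: mult.commute)
    moreover have "2 * (x ^ 3 / 6) * (2 * N * x) \<le> N * x ^ 4"
      using N x by (simp add: power_numeral_reduce)
    ultimately show ?thesis unfolding r1_def by (intro order_trans[OF norm_triangle_ineq4]) (simp add: ac_simps)
  qed
  define r2 where "r2 = lie_bracket (u *\<^sub>R a0) (r t) /\<^sub>R 2 + lie_bracket f1 (Y2 t) + lie_bracket (X2 t) (Y2 t)"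
  have r2: "lie_bracket (X t) (Y2 t) = - (u ^ 3 / 4) *\<^sub>R d + r2"
  proof -
    have "lie_bracket (u *\<^sub>R a0) (Y2 t) = - (u ^ 3 / 4) *\<^sub>R d + lie_bracket (u *\<^sub>R a0) (r t) /\<^sub>R 2"
      unfolding Y2t d_def by (simp add: lie_bracket_linear power2_eq_square power3_eq_cube)
    then show ?thesis unfolding X_def X1t r2_def by (simp add: lie_bracket.add_left)
  qed
  have r2n: "norm r2 \<le> 54 * (N * x ^ 4)"
  proof -
    have "norm (lie_bracket (u *\<^sub>R a0) (r t)) \<le> 2 * x * (6 * N * x ^ 3)" by (intro norm_lie_bracket_mono ua0 r')
    then have "norm (lie_bracket (u *\<^sub>R a0) (r t) /\<^sub>R 2) \<le> 6 * (N * x ^ 4)" by (simp add: eval_nat_numeral ac_simps)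
    moreover have "norm (lie_bracket f1 (Y2 t)) \<le> 2 * (2 * x\<^sup>2) * (4 * N * x\<^sup>2)" by (intro norm_lie_bracket_mono f1 Y2n)
    then have "norm (lie_bracket f1 (Y2 t)) \<le> 16 * (N * x ^ 4)" by (simp add: eval_nat_numeral ac_simps)
    moreover have "norm (lie_bracket (X2 t) (Y2 t)) \<le> 2 * (4 * x ^ 3) * (4 * N * x\<^sup>2)" by (intro norm_lie_bracket_mono X2n Y2n)
    then have "norm (lie_bracket (X2 t) (Y2 t)) \<le> 32 * (N * x ^ 5)" by (simp add: eval_nat_numeral ac_simps)
    then have "norm (lie_bracket (X2 t) (Y2 t)) \<le> 32 * (N * x ^ 4)" using p2 by linarith
    ultimately have "norm r2 \<le> (6 * (N * x ^ 4) + 16 * (N * x ^ 4)) + 32 * (N * x ^ 4)"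
      unfolding r2_def by (intro norm_triangle_mono)
    then show ?thesis by simp
  qed
  have Xn: "norm (X t) \<le> 5 * x"
    unfolding X_def using X1' X2n p1 by (intro norm_triangle_le) linarith
  define Z where "Z = lie_bracket (X t) (Y t)"
  define z where "z = - r t + lie_bracket (X2 t) (A t) + lie_bracket (X t) (Y2 t)"
  have Zt: "Z = (u\<^sup>2 / 2) *\<^sub>R c + z"
    unfolding Z_def z_def Y_def lie_bracket.add_right
    by (simp add: X_def lie_bracket.add_left lie_bracket_swap[of "X1 t" "A t"] bracket_AX1 u_def)
  have zn: "norm z \<le> 54 * (N * x ^ 3)"
  proof -
    have "norm (- r t) \<le> 6 * (N * x ^ 3)" using r' by simp
    moreover have "norm (lie_bracket (X2 t) (A t)) \<le> 2 * (4 * x ^ 3) * N" by (intro norm_lie_bracket_mono X2n An)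
    moreover have "norm (lie_bracket (X t) (Y2 t)) \<le> 2 * (5 * x) * (4 * N * x\<^sup>2)" by (intro norm_lie_bracket_mono Xn Y2n)
    ultimately have "norm z \<le> (6 * (N * x ^ 3) + 2 * (4 * x ^ 3) * N) + 2 * (5 * x) * (4 * N * x\<^sup>2)"
      unfolding z_def by (intro norm_triangle_mono)
    then show ?thesis by (simp add: power2_eq_square power3_eq_cube ac_simps)
  qed
  have Zn: "norm Z \<le> 55 * N * x\<^sup>2"
  proof -
    have "norm ((u\<^sup>2 / 2) *\<^sub>R c) \<le> N * x\<^sup>2" using u2c by simp
    then show ?thesis unfolding Zt using zn p2 by (intro norm_triangle_le) linarith
  qed
  define r3 where "r3 = lie_bracket (u *\<^sub>R a0) z + lie_bracket (f1 + X2 t) Z"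
  have r3: "lie_bracket (X t) Z = (u ^ 3 / 2) *\<^sub>R d + r3"
  proof -
    have "lie_bracket (u *\<^sub>R a0) Z = (u ^ 3 / 2) *\<^sub>R d + lie_bracket (u *\<^sub>R a0) z"
      unfolding Zt d_def by (simp add: lie_bracket_linear power2_eq_square power3_eq_cube)
    then show ?thesis unfolding X_def X1t r3_def by (simp add: lie_bracket.add_left)
  qed
  have r3n: "norm r3 \<le> 768 * (N * x ^ 4)"
  proof -
    have "norm (f1 + X2 t) \<le> 6 * x\<^sup>2" using f1 X2n p1 by (intro norm_triangle_le) linarith
    then have "norm (lie_bracket (f1 + X2 t) Z) \<le> 2 * (6 * x\<^sup>2) * (55 * N * x\<^sup>2)" by (intro norm_lie_bracket_mono Zn)
    moreover have "norm (lie_bracket (u *\<^sub>R a0) z) \<le> 2 * x * (54 * (N * x ^ 3))" by (intro norm_lie_bracket_mono ua0 zn)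
    ultimately have "norm r3 \<le> 2 * x * (54 * (N * x ^ 3)) + 2 * (6 * x\<^sup>2) * (55 * N * x\<^sup>2)"
      unfolding r3_def by (intro norm_triangle_mono)
    then show ?thesis by (simp add: eval_nat_numeral ac_simps)
  qed
  \<comment> \<open>\<open>Z\<close> is already of size \<open>N x^2\<close>, because
    \<open>[X1,A]\<close> has no linear term. Two more brackets with \<open>X\<close> give fourth
    order without any cancellation.\<close>
  have "norm (lie_bracket (X t) (lie_bracket (X t) Z)) \<le> 2 * (5 * x) * (2 * (5 * x) * (55 * N * x\<^sup>2))"
    by (intro norm_lie_bracket_mono Xn Zn)
  then have ad3: "norm (lie_bracket (X t) (lie_bracket (X t) Z)) \<le> 5500 * (N * x ^ 4)"
    by (simp add: eval_nat_numeral ac_simps)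
  have "dexp3 (X t) (Y t) - A t = (inverse 2 * (u ^ 3 / 12) + inverse 2 * - (u ^ 3 / 4) + inverse 6 * (u ^ 3 / 2)) *\<^sub>R d
      + ((r1 /\<^sub>R 2 + r2 /\<^sub>R 2) + r3 /\<^sub>R 6)"
    unfolding dexp3_residual Z_def[symmetric] r1 r2 r3 by (simp only: scaleR_right_distrib scaleR_left_distrib scaleR_scaleR add_ac)
  then have "dexp3 (X t) (Y t) - A t = (r1 /\<^sub>R 2 + r2 /\<^sub>R 2) + r3 /\<^sub>R 6" by simp
  also have "norm \<dots> \<le> (7 * (N * x ^ 4) / 2 + 54 * (N * x ^ 4) / 2) + 768 * (N * x ^ 4) / 6"
    using r1n r2n r3n by (intro norm_triangle_mono) auto
  \<comment> \<open>In units of \<open>N x^4\<close> the total is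
    \<open>3.5 + 27 + 128 + 5500 = 5658.5\<close>.\<close>
  finally have "residual t \<le> 6000 * (N * x ^ 4)"
    unfolding residual_def Z_def[symmetric]
    using ad3 mult_nonneg_nonneg[OF N(1) zero_le_power[OF x(1), of 4]] by linarith
  then show ?thesis by (simp add: x_def u_def eval_nat_numeral ac_simps)
qed

end

section \<open>Quadrature and the product of the steps\<close>

lemma norm_increment_le:
  fixes f :: "real \<Rightarrow> 'b::real_normed_vector"
  assumes "\<And>s. s \<in> {a..b} \<Longrightarrow> (f has_vector_derivative f' s) (at s within {a..b})"
    and "a \<le> u" "u \<le> v" "v \<le> b" "\<And>s. s \<in> {u..v} \<Longrightarrow> norm (f' s - c) \<le> B"
  shows "norm (f v - f u - (v - u) *\<^sub>R c) \<le> B * (v - u)"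
proof -
  have "norm ((f v - v *\<^sub>R c) - (f u - u *\<^sub>R c)) \<le> B * \<bar>v - u\<bar>"
  proof (rule norm_vector_derivative_bound[of u v])
    fix s assume s: "s \<in> {u..v}"
    have "(f has_vector_derivative f' s) (at s within {u..v})"
      by (rule has_vector_derivative_within_subset[of f _ _ "{a..b}"]) (use assms s in auto)
    then show "((\<lambda>s. f s - s *\<^sub>R c) has_vector_derivative f' s - 1 *\<^sub>R c) (at s within {u..v})"
      by (intro has_vector_derivative_diff has_vector_derivative_scaleR_const) (auto intro!: derivative_eq_intros)
    show "norm (f' s - 1 *\<^sub>R c) \<le> B" using assms s by simp
  qed (use assms in auto)
  then show ?thesis using assms by (simp add: algebra_simps)
qed

text \<open>The exponent of \<open>U2_step\<close> written with \<open>A = -iH\<close>; the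
  arguments of the bracket are interchanged because \<open>(-i)^2 = -1\<close>. The inner sum over
  \<open>1..p\<close> samples the cells before the p-th node at their right ends, while the outer
  sums sample at left ends.\<close>

definition magnus_quadrature :: "(real \<Rightarrow> 'a::real_normed_algebra) \<Rightarrow> nat \<Rightarrow> real \<Rightarrow> real \<Rightarrow> 'a" where
  "magnus_quadrature A M h a =
     (\<Sum>p<M. (h / real M) *\<^sub>R A (a + real p * h / real M))
     + (1 / 2) *\<^sub>R (\<Sum>p<M. (h / real M) *\<^sub>R lie_bracket (A (a + real p * h / real M))
          (\<Sum>q=1..p. (h / real M) *\<^sub>R A (a + real q * h / real M)))"

text \<open>With \<open>\<delta> = h/M\<close> all errors per unit length are multiples of
  \<open>\<delta> D1\<close>: one for \<open>X1\<close>, and three for \<open>X2\<close>, whose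
  integrand is half of a bracket altered in three places at a cost of \<open>2 \<delta> D1\<close>
  each. Factors \<alpha> are compensated by lengths of at most \<open>h\<close>. This makes the
  constant 4.\<close>

lemma (in magnus_terms) magnus_quadrature_error:
  assumes A_le: "\<And>t. t \<in> {a..b} \<Longrightarrow> norm (A t) \<le> \<alpha>" and small: "(b - a) * \<alpha> \<le> 1"
    and lip: "\<And>s t. s \<in> {a..b} \<Longrightarrow> t \<in> {a..b} \<Longrightarrow> norm (A s - A t) \<le> D1 * \<bar>s - t\<bar>"
    and "D1 \<ge> 0" "M > 0"
  shows "norm (magnus_quadrature A M (b - a) a - X b) \<le> 4 * (b - a) * ((b - a) / real M * D1)"
proof -
  define h \<delta> where "h = b - a" and "\<delta> = h / real M"
  define \<tau> where "\<tau> p = a + real p * \<delta>" for p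
  have \<tau>_alt: "a + real p * h / real M = \<tau> p" for p by (simp add: \<tau>_def \<delta>_def)
  have h0: "h \<ge> 0" "\<delta> \<ge> 0" using a_le_b by (auto simp: h_def \<delta>_def)
  have \<alpha>0: "\<alpha> \<ge> 0" using A_le[of a] norm_ge_zero[of "A a"] a_le_b by (meson atLeastAtMost_iff order_refl order_trans)
  have M\<delta>: "real M * \<delta> = h" using \<open>M > 0\<close> by (simp add: \<delta>_def)
  have p\<delta>: "real p * \<delta> \<le> h" if "p \<le> M" for p
    using mult_right_mono[of "real p" "real M" \<delta>] that h0 M\<delta> by simp
  have \<tau>_mem: "\<tau> p \<in> {a..b}" if "p \<le> M" for p
    using p\<delta>[OF that] h0 by (auto simp: \<tau>_def h_def)
  have \<tau>_Suc: "\<tau> (Suc p) = \<tau> p + \<delta>" for p by (simp add: \<tau>_def algebra_simps)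
  have \<tau>_0: "\<tau> 0 = a" by (simp add: \<tau>_def)
  have \<tau>_M: "\<tau> M = b" using M\<delta> by (simp add: \<tau>_def h_def)
  have \<delta>_le: "\<delta> \<le> h" using p\<delta>[of 1] \<open>M > 0\<close> by simp
  have h\<alpha>: "h * \<alpha> \<le> 1" using small by (simp add: h_def)
  define S where "S p = (\<Sum>q=1..p. \<delta> *\<^sub>R A (\<tau> q))" for p
  define E1 where "E1 p = (\<Sum>q<p. \<delta> *\<^sub>R A (\<tau> q))" for p
  define E2 where "E2 p = (\<Sum>q<p. \<delta> *\<^sub>R (lie_bracket (A (\<tau> q)) (S q) /\<^sub>R 2))" for p
  have cell: "t \<in> {a..b}" "\<bar>t - \<tau> p\<bar> \<le> \<delta>" "\<bar>t - \<tau> (Suc p)\<bar> \<le> \<delta>"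
    if "p < M" "t \<in> {\<tau> p..\<tau> (Suc p)}" for p t
    using that \<tau>_mem[of p] \<tau>_mem[of "Suc p"] by (auto simp: \<tau>_Suc)
  have lip': "norm (A t - A (\<tau> q)) \<le> \<delta> * D1"
    if "p < M" "t \<in> {\<tau> p..\<tau> (Suc p)}" "q = p \<or> q = Suc p" for p t q
  proof -
    have "norm (A t - A (\<tau> q)) \<le> D1 * \<bar>t - \<tau> q\<bar>"
      using that cell[OF that(1,2)] by (intro lip \<tau>_mem) auto
    also have "\<dots> \<le> D1 * \<delta>" using that(3) cell[OF that(1,2)] \<open>D1 \<ge> 0\<close> by (intro mult_left_mono) auto
    finally show ?thesis by (simp add: mult.commute)
  qed
  \<comment> \<open>Cell by cell, \<open>f\<close> moves by its derivative and \<open>F\<close> by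
    the sampled value \<open>c p\<close>, and the errors add up. Sampling at either end of the cell
    is allowed, which serves both the left sums and the right sum \<open>S\<close>.\<close>
  have telescope: "norm (f (\<tau> p) - F p) \<le> B * (real p * \<delta>)"
    if "p \<le> M" "f (\<tau> 0) = F 0" "\<And>p. p < M \<Longrightarrow> F (Suc p) = F p + \<delta> *\<^sub>R c p"
      "\<And>t. t \<in> {a..b} \<Longrightarrow> (f has_vector_derivative f' t) (at t within {a..b})"
      "\<And>p t. p < M \<Longrightarrow> t \<in> {\<tau> p..\<tau> (Suc p)} \<Longrightarrow> norm (f' t - c p) \<le> B"
    for f f' :: "real \<Rightarrow> 'a" and F c :: "nat \<Rightarrow> 'a" and B p
    using that(1)
  proof (induction p)
    case (Suc p)
    have "norm (f (\<tau> (Suc p)) - f (\<tau> p) - (\<tau> (Suc p) - \<tau> p) *\<^sub>R c p) \<le> B * (\<tau> (Suc p) - \<tau> p)"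
      using Suc.prems \<tau>_mem[of p] \<tau>_mem[of "Suc p"] h0 by (intro norm_increment_le[OF that(4)] that(5)) (auto simp: \<tau>_Suc)
    moreover have "f (\<tau> (Suc p)) - F (Suc p)
        = (f (\<tau> p) - F p) + (f (\<tau> (Suc p)) - f (\<tau> p) - (\<tau> (Suc p) - \<tau> p) *\<^sub>R c p)"
      using that(3)[of p] Suc.prems by (simp add: \<tau>_Suc)
    ultimately have "norm (f (\<tau> (Suc p)) - F (Suc p)) \<le> B * (real p * \<delta>) + B * \<delta>"
      using Suc by (simp only:) (rule norm_triangle_mono, auto simp: \<tau>_Suc)
    then show ?case by (simp add: algebra_simps)
  qed (use that(2) in simp)
  have X1_S: "norm (X1 (\<tau> p) - S p) \<le> \<delta> * D1 * (real p * \<delta>)" if "p \<le> M" for p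
    by (rule telescope[OF that, where c = "\<lambda>p. A (\<tau> (Suc p))"])
      (auto simp: S_def \<tau>_0 X1_a intro!: X1 lip')
  have X1_E1: "norm (X1 (\<tau> p) - E1 p) \<le> \<delta> * D1 * (real p * \<delta>)" if "p \<le> M" for p
    by (rule telescope[OF that, where c = "\<lambda>p. A (\<tau> p)"])
      (auto simp: E1_def \<tau>_0 X1_a intro!: X1 lip')
  have S_le: "norm (S p) \<le> 1" if "p < M" for p
  proof -
    have "norm (S p) \<le> (\<Sum>q=1..p. \<delta> * \<alpha>)"
      unfolding S_def using that h0 \<tau>_mem A_le
      by (intro sum_norm_le) (auto intro!: mult_left_mono)
    also have "\<dots> = (real p * \<delta>) * \<alpha>" by simp
    also have "\<dots> \<le> h * \<alpha>" using p\<delta>[of p] that \<alpha>0 by (intro mult_right_mono) auto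
    finally show ?thesis using h\<alpha> by simp
  qed
  have X2_E2: "norm (X2 (\<tau> M) - E2 M) \<le> 3 * (\<delta> * D1) * (real M * \<delta>)"
  proof (rule telescope[where c = "\<lambda>p. lie_bracket (A (\<tau> p)) (S p) /\<^sub>R 2"])
    fix p t assume p: "p < M" and t: "t \<in> {\<tau> p..\<tau> (Suc p)}"
    have At: "norm (A t) \<le> \<alpha>" by (rule A_le) (rule cell(1)[OF p t])
    have \<delta>D: "c * (\<delta> * D1) \<le> \<delta> * D1" if "c \<le> 1" for c
      using mult_right_mono[OF that, of "\<delta> * D1"] h0 \<open>D1 \<ge> 0\<close> by simp
    have 1: "norm (lie_bracket (A t - A (\<tau> p)) (S p)) \<le> 2 * (\<delta> * D1) * 1"
      by (intro norm_lie_bracket_mono lip'[OF p t] S_le p) simp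
    have 2: "norm (lie_bracket (A t) (X1 (\<tau> p) - S p)) \<le> 2 * (\<delta> * D1)"
    proof -
      have "norm (lie_bracket (A t) (X1 (\<tau> p) - S p)) \<le> 2 * \<alpha> * (\<delta> * D1 * (real p * \<delta>))"
        using p by (intro norm_lie_bracket_mono At X1_S) auto
      also have "\<dots> = 2 * ((real p * \<delta>) * \<alpha> * (\<delta> * D1))" by simp
      also have "\<dots> \<le> 2 * (\<delta> * D1)"
        using mult_right_mono[OF p\<delta>[of p] \<alpha>0] p h\<alpha> by (intro mult_left_mono \<delta>D) auto
      finally show ?thesis .
    qed
    have 3: "norm (lie_bracket (A t) (X1 t - X1 (\<tau> p))) \<le> 2 * (\<delta> * D1)"
    proof -
      have "norm (lie_bracket (A t) (X1 t) - lie_bracket (A t) (X1 (\<tau> p)) - (t - \<tau> p) *\<^sub>R 0)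
          \<le> 2 * (D1 * \<delta>) * \<alpha> * (t - \<tau> p)"
      proof (rule norm_increment_le[OF has_vector_derivative_lie_bracket_right[OF X1]])
        fix s assume s: "s \<in> {\<tau> p..t}"
        then have s': "s \<in> {\<tau> p..\<tau> (Suc p)}" using t by auto
        \<comment> \<open>Subtracting \<open>A s\<close> is free since
          \<open>[A s, A s] = 0\<close>, and it turns one factor \<alpha> into a difference
          controlled by \<open>D1\<close>. Otherwise the bound would not be proportional to
          \<open>D1\<close>.\<close>
        have "lie_bracket (A t) (A s) = lie_bracket (A t - A s) (A s)"
          by (simp add: lie_bracket.diff_left) (simp add: lie_bracket_def)
        moreover have "norm (A t - A s) \<le> D1 * \<bar>t - s\<bar>"
          by (intro lip cell(1)[OF p t] cell(1)[OF p s'])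
        moreover have "D1 * \<bar>t - s\<bar> \<le> D1 * \<delta>"
          using s t \<open>D1 \<ge> 0\<close> by (intro mult_left_mono) (auto simp: \<tau>_Suc)
        ultimately show "norm (lie_bracket (A t) (A s) - 0) \<le> 2 * (D1 * \<delta>) * \<alpha>"
          by (simp only: diff_zero) (intro norm_lie_bracket_mono A_le cell(1)[OF p s'], linarith)
      qed (use t cell(1)[OF p t] \<tau>_mem[of p] p in auto)
      also have "\<dots> \<le> 2 * (D1 * \<delta>) * \<alpha> * h"
        using t \<delta>_le \<alpha>0 h0 \<open>D1 \<ge> 0\<close> by (intro mult_left_mono) (auto simp: \<tau>_Suc)
      also have "\<dots> = 2 * (h * \<alpha> * (\<delta> * D1))" by simp
      also have "\<dots> \<le> 2 * (\<delta> * D1)" using h\<alpha> by (intro mult_left_mono \<delta>D) auto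
      finally show ?thesis by (simp add: lie_bracket.diff_right)
    qed
    have "lie_bracket (A t) (X1 t) /\<^sub>R 2 - lie_bracket (A (\<tau> p)) (S p) /\<^sub>R 2
      = ((lie_bracket (A t - A (\<tau> p)) (S p) + lie_bracket (A t) (X1 (\<tau> p) - S p))
          + lie_bracket (A t) (X1 t - X1 (\<tau> p))) /\<^sub>R 2"
      by (simp add: lie_bracket_linear algebra_simps)
    moreover have "norm ((lie_bracket (A t - A (\<tau> p)) (S p) + lie_bracket (A t) (X1 (\<tau> p) - S p))
          + lie_bracket (A t) (X1 t - X1 (\<tau> p))) \<le> 2 * (\<delta> * D1) * 1 + 2 * (\<delta> * D1) + 2 * (\<delta> * D1)"
      by (intro norm_triangle_mono 1 2 3)
    ultimately show "norm (lie_bracket (A t) (X1 t) /\<^sub>R 2 - lie_bracket (A (\<tau> p)) (S p) /\<^sub>R 2) \<le> 3 * (\<delta> * D1)"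
      by (simp add: mult.commute)
  qed (use X2 in \<open>auto simp: E2_def \<tau>_0 X2_a\<close>)
  have "magnus_quadrature A M h a = E1 M + E2 M"
    unfolding magnus_quadrature_def E1_def E2_def S_def \<tau>_alt \<delta>_def[symmetric]
    by (simp add: scaleR_sum_right)
  then have "magnus_quadrature A M h a - X b = - ((X1 (\<tau> M) - E1 M) + (X2 (\<tau> M) - E2 M))"
    by (simp add: X_def \<tau>_M)
  then have "norm (magnus_quadrature A M h a - X b) = norm ((X1 (\<tau> M) - E1 M) + (X2 (\<tau> M) - E2 M))"
    by (simp only: norm_minus_cancel)
  also have "\<dots> \<le> \<delta> * D1 * (real M * \<delta>) + 3 * (\<delta> * D1) * (real M * \<delta>)"
    by (intro norm_triangle_mono X1_E1 X2_E2) simp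
  finally show ?thesis unfolding M\<delta> h_def[symmetric] \<delta>_def[symmetric] by (simp add: algebra_simps)
qed

section \<open>Error of one quadrature step and of the product\<close>

context skew_algebra
begin

lemma magnus_quadrature_S:
  assumes "\<And>p. p \<le> M \<Longrightarrow> A (a + real p * h / real M) \<in> S"
  shows "magnus_quadrature A M h a \<in> S"
  unfolding magnus_quadrature_def by (intro S_intros assms) auto

lemma magnus_quadrature_step:
  assumes "a \<le> b" "M > 0"
    and V: "\<And>t. t \<in> {a..b} \<Longrightarrow> (V has_vector_derivative A t * V t) (at t within {a..b})"
    and Va: "norm (V a) \<le> 1"
    and AS: "\<And>t. t \<in> {a..b} \<Longrightarrow> A t \<in> S"
    and A': "\<And>t. t \<in> {a..b} \<Longrightarrow> (A has_vector_derivative A1 t) (at t within {a..b})"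
    and A'': "\<And>t. t \<in> {a..b} \<Longrightarrow> (A1 has_vector_derivative A2 t) (at t within {a..b})"
    and A_le: "\<And>t. t \<in> {a..b} \<Longrightarrow> norm (A t) \<le> \<alpha>"
    and A1_le: "\<And>t. t \<in> {a..b} \<Longrightarrow> norm (A1 t) \<le> D1"
    and A2_le: "\<And>t. t \<in> {a..b} \<Longrightarrow> norm (A2 t) \<le> D2"
    and small: "(b - a) * \<alpha> \<le> 1"
    and \<kappa>: "\<And>\<tau> s t. \<tau> \<in> {a..b} \<Longrightarrow> s \<in> {a..b} \<Longrightarrow> t \<in> {a..b} \<Longrightarrow>
        norm (lie_bracket (A \<tau>) (lie_bracket (A s) (A t))) \<le> \<kappa>"
  shows "norm (V b - exp (magnus_quadrature A M (b - a) a) * V a)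
    \<le> (b - a) * (min (90 * \<kappa> * (b - a)\<^sup>2) (6000 * (1 + \<alpha> + D1 + D2) ^ 5 * (b - a) ^ 4)
         + 4 * ((b - a) / real M * D1))"
proof -
  have "continuous_on {a..b} A" by (rule continuous_on_vector_derivative[OF A'])
  then obtain X1' where "\<And>t. t \<in> {a..b} \<Longrightarrow> (X1' has_vector_derivative A t) (at t within {a..b})"
    by (rule antiderivative_continuous) blast
  then have X1: "((\<lambda>t. X1' t - X1' a) has_vector_derivative A t) (at t within {a..b})" if "t \<in> {a..b}" for t
    using that by (auto intro!: derivative_eq_intros)
  define X1 where "X1 t = X1' t - X1' a" for t
  note X1 = X1[folded X1_def]
  have "continuous_on {a..b} (\<lambda>t. lie_bracket (A t) (X1 t) /\<^sub>R 2)"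
    by (intro continuous_intros lie_bracket.continuous_on continuous_on_vector_derivative[OF A']
        continuous_on_vector_derivative[OF X1])
  then obtain X2' where "\<And>t. t \<in> {a..b} \<Longrightarrow>
      (X2' has_vector_derivative lie_bracket (A t) (X1 t) /\<^sub>R 2) (at t within {a..b})"
    by (rule antiderivative_continuous) blast
  then have X2: "((\<lambda>t. X2' t - X2' a) has_vector_derivative lie_bracket (A t) (X1 t) /\<^sub>R 2) (at t within {a..b})"
    if "t \<in> {a..b}" for t
    using that by (auto intro!: derivative_eq_intros)
  define X2 where "X2 t = X2' t - X2' a" for t
  note X2 = X2[folded X2_def]
  interpret magnus_terms A X1 X2 a b
    by unfold_locales (fact X1 X2 \<open>a \<le> b\<close> | simp add: X1_def X2_def)+
  have sub: "(f has_vector_derivative f') (at s within {a..t})"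
    if "(f has_vector_derivative f') (at s within {a..b})" "t \<in> {a..b}" for f :: "real \<Rightarrow> 'a" and f' s t
    using that by (auto intro: has_vector_derivative_within_subset[of f _ _ "{a..b}"])
  have X1S: "X1 t \<in> S" if "t \<in> {a..b}" for t
    by (rule antiderivative_in_S[of a t _ A]) (use that in \<open>auto intro!: sub[OF X1] AS S_intros simp: X1_a\<close>)
  have X2S: "X2 t \<in> S" if t: "t \<in> {a..b}" for t
  proof (rule antiderivative_in_S[of a t _ "\<lambda>t. lie_bracket (A t) (X1 t) /\<^sub>R 2"])
    fix s assume "s \<in> {a..t}"
    then have s: "s \<in> {a..b}" using t by auto
    show "(X2 has_vector_derivative lie_bracket (A s) (X1 s) /\<^sub>R 2) (at s within {a..t})"
      by (rule sub[OF X2[OF s] t])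
    show "lie_bracket (A s) (X1 s) /\<^sub>R 2 \<in> S" by (intro S_intros AS X1S s)
  qed (use t S_intros in \<open>auto simp: X2_a\<close>)
  have XS: "X t \<in> S" if "t \<in> {a..b}" for t
    unfolding X_def using that by (intro S_intros X1S X2S)
  have D: "D1 \<ge> 0" "D2 \<ge> 0" "\<alpha> \<ge> 0"
    using A_le[of a] A1_le[of a] A2_le[of a] \<open>a \<le> b\<close> by (auto intro: order_trans[OF norm_ge_zero])
  define h N where "h = b - a" and "N = 1 + \<alpha> + D1 + D2"
  \<comment> \<open>\<open>N >= 1\<close> yields \<open>D1 <= N^2\<close> and
    \<open>D2 <= N^3\<close>. With these weights every estimate in
    \<open>residual_fourth_order\<close> becomes a power of \<open>N u\<close>.\<close>
  have N: "N \<ge> 1" "\<alpha> \<le> N" "D1 \<le> N" "D2 \<le> N" using D by (auto simp: N_def)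
  have h0: "h \<ge> 0" using \<open>a \<le> b\<close> by (simp add: h_def)
  have res1: "residual t \<le> 90 * \<kappa> * h\<^sup>2" if "t \<in> {a..b}" for t
    unfolding h_def by (rule residual_commutator_bound[OF A_le small that \<kappa>])
  have res2: "residual t \<le> 6000 * N ^ 5 * h ^ 4" if t: "t \<in> {a..b}" for t
  proof (cases "N * h \<le> 1")
    case True
    have taylor: "norm (A s - A a - (s - a) *\<^sub>R A1 a) \<le> N ^ 3 * (s - a)\<^sup>2" if s: "s \<in> {a..b}" for s
    proof -
      have "norm (A s - A a - (s - a) *\<^sub>R A1 a) \<le> D2 * (s - a) * (s - a)"
      proof (rule norm_increment_le[OF A'])
        fix w assume w: "w \<in> {a..s}"
        have "norm (A1 w - A1 a) \<le> D2 * \<bar>w - a\<bar>"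
          by (rule norm_vector_derivative_bound[OF A'' A2_le]) (use s w in auto)
        also have "\<dots> \<le> D2 * (s - a)" using w D by (intro mult_left_mono) auto
        finally show "norm (A1 w - A1 a) \<le> D2 * (s - a)" .
      qed (use s in auto)
      also have "\<dots> = D2 * (s - a)\<^sup>2" by (simp add: power2_eq_square)
      also have "\<dots> \<le> N ^ 3 * (s - a)\<^sup>2"
        using N power_increasing[of 1 3 N] by (intro mult_right_mono) auto
      finally show ?thesis .
    qed
    have "residual t \<le> 6000 * N ^ 5 * (t - a) ^ 4"
    proof (rule residual_fourth_order[OF t _ _ _ _ taylor])
      show "norm (A1 a) \<le> N\<^sup>2" using A1_le[of a] N power_increasing[of 1 2 N] \<open>a \<le> b\<close> by auto
    qed (use N True A_le in \<open>auto simp: h_def intro: order_trans\<close>)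
    also have "\<dots> \<le> 6000 * N ^ 5 * h ^ 4"
      using t N by (intro mult_left_mono power_mono) (auto simp: h_def)
    finally show ?thesis .
  next
    \<comment> \<open>Here the Taylor estimates do not apply, but the commutator bound with the
      trivial \<open>\<kappa> = 4 \<alpha>^3\<close> gives at most \<open>360 \<alpha>\<close>,
      while \<open>(N h)^4 >= 1\<close>. Thus the smallness assumption can involve \<alpha>
      alone.\<close>
    case False
    have "norm (lie_bracket (A \<tau>) (lie_bracket (A s) (A t))) \<le> 2 * \<alpha> * (2 * \<alpha> * \<alpha>)"
      if "\<tau> \<in> {a..b}" "s \<in> {a..b}" "t \<in> {a..b}" for \<tau> s t
      by (intro norm_lie_bracket_mono A_le that)
    then have "residual t \<le> 90 * (2 * \<alpha> * (2 * \<alpha> * \<alpha>)) * h\<^sup>2"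
      unfolding h_def by (intro residual_commutator_bound[OF A_le small t])
    also have "\<dots> = 360 * (\<alpha> * (h * \<alpha>)\<^sup>2)" by (simp add: power2_eq_square)
    also have "\<dots> \<le> 360 * (\<alpha> * 1)"
      using small D h0 by (intro mult_left_mono power_le_one) (auto simp: h_def)
    also have "\<dots> \<le> 6000 * (N * 1)" using N by simp
    also have "\<dots> \<le> 6000 * (N * (N * h) ^ 4)"
      using False N by (intro mult_left_mono one_le_power) auto
    also have "\<dots> = 6000 * N ^ 5 * h ^ 4" by (simp add: power_mult_distrib eval_nat_numeral)
    finally show ?thesis .
  qed
  define \<rho> where "\<rho> = min (90 * \<kappa> * h\<^sup>2) (6000 * N ^ 5 * h ^ 4)"
  define E where "E = magnus_quadrature A M h a"
  have "norm (V b - exp (X b) * V a) \<le> (b - a) * \<rho>"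
    by (rule magnus_step_error[OF \<open>a \<le> b\<close> V X_derivative X_a Va AS XS])
      (use res1 res2 in \<open>auto simp: residual_def \<rho>_def\<close>)
  moreover have "norm (exp (X b) * V a - exp E * V a) \<le> 4 * (b - a) * ((b - a) / real M * D1)"
  proof -
    have E_S: "E \<in> S" unfolding E_def h_def
    proof (rule magnus_quadrature_S)
      fix p assume "p \<le> M"
      then have "real p * (b - a) / real M \<le> b - a"
        using \<open>M > 0\<close> \<open>a \<le> b\<close> mult_right_mono[of "real p" "real M" "b - a"]
        by (simp add: divide_le_eq mult.commute)
      then show "A (a + real p * (b - a) / real M) \<in> S" using \<open>a \<le> b\<close> by (intro AS) auto
    qed
    have "norm (exp (X b) * V a - exp E * V a) \<le> norm (exp (X b) - exp E) * norm (V a)"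
      by (simp add: left_diff_distrib[symmetric] norm_mult_ineq)
    also have "\<dots> \<le> norm (exp (X b) - exp E)" using Va by (intro mult_left_le) auto
    also have "\<dots> \<le> norm (X b - E)" using \<open>a \<le> b\<close> by (intro norm_exp_diff_le XS E_S) auto
    also have "\<dots> \<le> 4 * (b - a) * ((b - a) / real M * D1)"
      unfolding E_def h_def norm_minus_commute[of "X b"]
      by (rule magnus_quadrature_error[OF A_le small])
        (use D \<open>M > 0\<close> norm_vector_derivative_bound[OF A' A1_le] in auto)
    finally show ?thesis .
  qed
  moreover have "V b - exp E * V a = (V b - exp (X b) * V a) + (exp (X b) * V a - exp E * V a)" by simp
  ultimately have "norm (V b - exp E * V a) \<le> (b - a) * \<rho> + 4 * (b - a) * ((b - a) / real M * D1)"
    by (simp only:) (rule norm_triangle_mono)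
  moreover have "4 * (b - a) * ((b - a) / real M * D1) = (b - a) * (4 * ((b - a) / real M * D1))"
    by (simp only: mult.assoc mult.left_commute[of 4])
  ultimately show ?thesis unfolding E_def \<rho>_def h_def N_def distrib_left by (simp only:)
qed

end

fun magnus_product :: "(real \<Rightarrow> 'a::{real_normed_algebra_1,banach}) \<Rightarrow> nat \<Rightarrow> real \<Rightarrow> nat \<Rightarrow> 'a" where
  "magnus_product A M h 0 = 1"
| "magnus_product A M h (Suc k) = exp (magnus_quadrature A M h (real k * h)) * magnus_product A M h k"

text \<open>Each factor \<open>exp E\<close> is a contraction, so earlier errors are not amplified
  and the local errors simply add up. The exact solution is bounded by 1 as well, which makes it an
  admissible start value for every step.\<close>

lemma (in skew_algebra) magnus_product_error:
  assumes "T \<ge> 0" "L > 0" "M > 0" and h: "h = T / real L"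
    and V: "\<And>t. t \<in> {0..T} \<Longrightarrow> (V has_vector_derivative A t * V t) (at t within {0..T})"
    and V0: "V 0 = 1"
    and AS: "\<And>t. t \<in> {0..T} \<Longrightarrow> A t \<in> S"
    and A': "\<And>t. t \<in> {0..T} \<Longrightarrow> (A has_vector_derivative A1 t) (at t within {0..T})"
    and A'': "\<And>t. t \<in> {0..T} \<Longrightarrow> (A1 has_vector_derivative A2 t) (at t within {0..T})"
    and A_le: "\<And>t. t \<in> {0..T} \<Longrightarrow> norm (A t) \<le> \<alpha>"
    and A1_le: "\<And>t. t \<in> {0..T} \<Longrightarrow> norm (A1 t) \<le> D1"
    and A2_le: "\<And>t. t \<in> {0..T} \<Longrightarrow> norm (A2 t) \<le> D2"
    and small: "h * \<alpha> \<le> 1"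
    and \<kappa>: "\<And>j \<tau> s t. j < L \<Longrightarrow> \<tau> \<in> {real j * h..real (Suc j) * h} \<Longrightarrow> s \<in> {real j * h..real (Suc j) * h} \<Longrightarrow>
        t \<in> {real j * h..real (Suc j) * h} \<Longrightarrow>
        norm (lie_bracket (A \<tau>) (lie_bracket (A s) (A t))) \<le> \<kappa>"
  shows "norm (V T - magnus_product A M h L)
    \<le> T * (min (90 * \<kappa> * h\<^sup>2) (6000 * (1 + \<alpha> + D1 + D2) ^ 5 * h ^ 4) + 4 * (h / real M * D1))"
proof -
  define B where "B = min (90 * \<kappa> * h\<^sup>2) (6000 * (1 + \<alpha> + D1 + D2) ^ 5 * h ^ 4) + 4 * (h / real M * D1)"
  have h0: "h \<ge> 0" and Lh: "real L * h = T" using assms by (auto simp: h)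
  have mem: "real k * h \<in> {0..T}" if "k \<le> L" for k
    using mult_right_mono[of "real k" "real L" h] that h0 Lh by simp
  have sub: "(f has_vector_derivative f') (at t within {a..b})"
    if "(f has_vector_derivative f') (at t within {0..T})" "0 \<le> a" "b \<le> T" for f :: "real \<Rightarrow> 'a" and f' t a b
    using that by (auto intro: has_vector_derivative_within_subset[of f _ _ "{0..T}"])
  have V_le: "norm (V t) \<le> 1" if "t \<in> {0..T}" for t
  proof -
    have "norm (V t) \<le> norm (V 0) + (t - 0) * 0"
      by (rule growth_derivative[where A = A and r = "\<lambda>_. 0"]) (use that in \<open>auto intro!: sub[OF V] AS\<close>)
    then show ?thesis by (simp add: V0)
  qed
  have "norm (V (real k * h) - magnus_product A M h k) \<le> real k * h * B" if "k \<le> L" for k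
    using that
  proof (induction k)
    case (Suc k)
    define a b where "a = real k * h" and "b = real (Suc k) * h"
    have ab: "b - a = h" "a \<le> b" using h0 by (auto simp: a_def b_def algebra_simps)
    have aT: "0 \<le> a" "a \<in> {0..T}" and bT: "b \<le> T"
      using mem[of k] mem[of "Suc k"] Suc.prems by (auto simp: a_def b_def)
    have \<tau>T: "t \<in> {0..T}" if "t \<in> {a..b}" for t using that aT bT by auto
    have \<kappa>': "norm (lie_bracket (A \<tau>) (lie_bracket (A s) (A t))) \<le> \<kappa>"
      if "\<tau> \<in> {a..b}" "s \<in> {a..b}" "t \<in> {a..b}" for \<tau> s t
      using \<kappa>[of k \<tau> s t] Suc.prems that unfolding a_def b_def by simp
    define E where "E = magnus_quadrature A M h a"
    have step: "norm (V b - exp E * V a) \<le> h * B"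
      unfolding E_def B_def ab(1)[symmetric]
      by (rule magnus_quadrature_step[where ?A1.0 = A1 and ?A2.0 = A2])
        (use ab aT bT \<tau>T \<kappa>' \<open>M > 0\<close> V_le small AS A_le A1_le A2_le
          in \<open>auto intro!: sub[OF V] sub[OF A'] sub[OF A'']\<close>)
    have "E \<in> S" unfolding E_def
    proof (rule magnus_quadrature_S)
      fix p assume "p \<le> M"
      then have "real p * h / real M \<le> h"
        using \<open>M > 0\<close> h0 by (simp add: divide_le_eq mult.commute mult_left_mono)
      then show "A (a + real p * h / real M) \<in> S" using ab h0 by (intro AS \<tau>T) auto
    qed
    have "norm (exp E * (V a - magnus_product A M h k)) \<le> norm (exp E) * norm (V a - magnus_product A M h k)"
      by (rule norm_mult_ineq)
    also have "\<dots> \<le> norm (V a - magnus_product A M h k)"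
      using norm_exp_le_1[OF \<open>E \<in> S\<close>] mult_right_mono[of "norm (exp E)" 1] by fastforce
    also have "\<dots> \<le> real k * h * B" using Suc by (simp add: a_def)
    finally have "norm ((V b - exp E * V a) + exp E * (V a - magnus_product A M h k)) \<le> h * B + real k * h * B"
      using step by (intro norm_triangle_mono)
    moreover have "(V b - exp E * V a) + exp E * (V a - magnus_product A M h k) = V b - magnus_product A M h (Suc k)"
      by (simp add: E_def a_def algebra_simps)
    ultimately show ?case by (simp add: b_def algebra_simps)
  qed (simp add: V0)
  from this[of L] show ?thesis by (simp add: Lh B_def)
qed

section \<open>The spectral norm\<close>

lemma vnorm_L2_set: "vnorm v = L2_set (\<lambda>i. cmod (v $ i)) {..<dim_vec v}"
  by (simp add: vnorm_def L2_set_def)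

lemma vnorm_nonneg [simp]: "0 \<le> vnorm v"
  by (simp add: vnorm_L2_set)

lemma vnorm_smult: "vnorm (c \<cdot>\<^sub>v v) = cmod c * vnorm v"
  by (auto simp: vnorm_L2_set norm_mult L2_set_right_distrib intro: L2_set_cong)

lemma vnorm_triangle:
  assumes "v \<in> carrier_vec n" "w \<in> carrier_vec n"
  shows "vnorm (v + w) \<le> vnorm v + vnorm w"
proof -
  have "vnorm (v + w) \<le> L2_set (\<lambda>i. cmod (v $ i) + cmod (w $ i)) {..<n}"
    unfolding vnorm_L2_set using assms by (auto intro!: L2_set_mono norm_triangle_ineq)
  also have "\<dots> \<le> vnorm v + vnorm w"
    unfolding vnorm_L2_set using assms L2_set_triangle_ineq by simp
  finally show ?thesis .
qed

lemma norm_index_le_vnorm: "i < dim_vec v \<Longrightarrow> cmod (v $ i) \<le> vnorm v"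
  unfolding vnorm_L2_set by (intro member_le_L2_set) auto

lemma index_mult_mat_vec_sum:
  assumes "A \<in> carrier_mat n n" "v \<in> carrier_vec n" "i < n"
  shows "(A *\<^sub>v v) $ i = (\<Sum>j<n. A $$ (i, j) * v $ j)"
  using assms by (auto simp: scalar_prod_def atLeast0LessThan intro!: sum.cong)

text \<open>A crude bound that makes the supremum in \<open>opnorm\<close> finite and later allows
  entrywise limits to be carried over to the norm.\<close>

lemma vnorm_mult_le_sum:
  assumes "A \<in> carrier_mat n n" "v \<in> carrier_vec n"
  shows "vnorm (A *\<^sub>v v) \<le> (\<Sum>i<n. \<Sum>j<n. cmod (A $$ (i, j))) * vnorm v"
proof -
  have "vnorm (A *\<^sub>v v) \<le> (\<Sum>i<n. cmod ((A *\<^sub>v v) $ i))"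
    unfolding vnorm_L2_set using assms L2_set_le_sum[of "{..<n}" "\<lambda>i. cmod ((A *\<^sub>v v) $ i)"] by simp
  also have "\<dots> \<le> (\<Sum>i<n. \<Sum>j<n. cmod (A $$ (i, j)) * vnorm v)"
  proof (rule sum_mono)
    fix i assume "i \<in> {..<n}"
    then have "cmod ((A *\<^sub>v v) $ i) = cmod (\<Sum>j<n. A $$ (i, j) * v $ j)"
      using assms by (simp add: index_mult_mat_vec_sum del: index_mult_mat_vec)
    also have "\<dots> \<le> (\<Sum>j<n. cmod (A $$ (i, j)) * vnorm v)"
      using assms norm_index_le_vnorm[of _ v] by (intro sum_norm_le) (auto simp: norm_mult intro!: mult_left_mono)
    finally show "cmod ((A *\<^sub>v v) $ i) \<le> (\<Sum>j<n. cmod (A $$ (i, j)) * vnorm v)" .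
  qed
  finally show ?thesis by (simp add: sum_distrib_right)
qed

lemma opnorm_upper:
  assumes "A \<in> carrier_mat n n" "v \<in> carrier_vec n" "vnorm v \<le> 1"
  shows "vnorm (A *\<^sub>v v) \<le> opnorm A"
  unfolding opnorm_def
proof (rule cSup_upper)
  show "vnorm (A *\<^sub>v v) \<in> {vnorm (A *\<^sub>v v) |v. v \<in> carrier_vec (dim_col A) \<and> vnorm v \<le> 1}"
    using assms by auto
  show "bdd_above {vnorm (A *\<^sub>v v) |v. v \<in> carrier_vec (dim_col A) \<and> vnorm v \<le> 1}"
  proof (rule bdd_aboveI)
    fix x assume "x \<in> {vnorm (A *\<^sub>v v) |v. v \<in> carrier_vec (dim_col A) \<and> vnorm v \<le> 1}"
    then obtain v where v: "x = vnorm (A *\<^sub>v v)" "v \<in> carrier_vec n" "vnorm v \<le> 1" using assms by auto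
    have "x \<le> (\<Sum>i<n. \<Sum>j<n. cmod (A $$ (i, j))) * vnorm v"
      unfolding v(1) by (rule vnorm_mult_le_sum[OF assms(1) v(2)])
    also have "\<dots> \<le> (\<Sum>i<n. \<Sum>j<n. cmod (A $$ (i, j)))"
      using v by (intro mult_left_le) (auto intro!: sum_nonneg)
    finally show "x \<le> (\<Sum>i<n. \<Sum>j<n. cmod (A $$ (i, j)))" .
  qed
qed

lemma vnorm_zero [simp]: "vnorm (0\<^sub>v n) = 0"
  by (simp add: vnorm_def)

lemma opnorm_nonneg: "A \<in> carrier_mat n n \<Longrightarrow> 0 \<le> opnorm A"
  using opnorm_upper[of A n "0\<^sub>v n"] by (auto intro: order_trans[OF vnorm_nonneg])

lemma vnorm_mult_le:
  assumes "A \<in> carrier_mat n n" "v \<in> carrier_vec n"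
  shows "vnorm (A *\<^sub>v v) \<le> opnorm A * vnorm v"
proof (cases "vnorm v = 0")
  case True
  then have "vnorm (A *\<^sub>v v) \<le> 0" using vnorm_mult_le_sum[OF assms] by simp
  with True show ?thesis by simp
next
  case False
  define c where "c = complex_of_real (1 / vnorm v)"
  have "vnorm (A *\<^sub>v (c \<cdot>\<^sub>v v)) \<le> opnorm A"
    using assms False by (intro opnorm_upper) (auto simp: vnorm_smult c_def norm_divide)
  also have "A *\<^sub>v (c \<cdot>\<^sub>v v) = c \<cdot>\<^sub>v (A *\<^sub>v v)"
    using assms by (intro mult_mat_vec)
  finally show ?thesis using False 
    by (simp add: vnorm_smult c_def norm_divide divide_le_eq less_le)
qed

lemma opnorm_le:
  assumes "A \<in> carrier_mat n n" "K \<ge> 0" "\<And>v. v \<in> carrier_vec n \<Longrightarrow> vnorm (A *\<^sub>v v) \<le> K * vnorm v"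
  shows "opnorm A \<le> K"
  unfolding opnorm_def
proof (rule cSup_least)
  show "{vnorm (A *\<^sub>v v) |v. v \<in> carrier_vec (dim_col A) \<and> vnorm v \<le> 1} \<noteq> {}"
    by (auto intro!: exI[of _ "0\<^sub>v (dim_col A)"])
  fix x assume "x \<in> {vnorm (A *\<^sub>v v) |v. v \<in> carrier_vec (dim_col A) \<and> vnorm v \<le> 1}"
  then obtain v where v: "x = vnorm (A *\<^sub>v v)" "v \<in> carrier_vec n" "vnorm v \<le> 1" using assms by auto
  have "x \<le> K * vnorm v" using assms v by simp
  also have "\<dots> \<le> K" using v assms by (intro mult_left_le) auto
  finally show "x \<le> K" .
qed

lemma opnorm_le_sum:
  "A \<in> carrier_mat n n \<Longrightarrow> opnorm A \<le> (\<Sum>i<n. \<Sum>j<n. cmod (A $$ (i, j)))"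
  by (rule opnorm_le) (auto intro!: sum_nonneg vnorm_mult_le_sum)

lemma norm_index_le_opnorm:
  assumes "A \<in> carrier_mat n n" "i < n" "j < n"
  shows "cmod (A $$ (i, j)) \<le> opnorm A"
proof -
  have "vnorm (unit_vec n j :: complex vec) \<le> 1"
  proof -
    have "vnorm (unit_vec n j :: complex vec) \<le> (\<Sum>i<n. cmod (unit_vec n j $ i))"
      unfolding vnorm_L2_set using L2_set_le_sum[of "{..<n}" "\<lambda>i. cmod (unit_vec n j $ i)"] by simp
    also have "\<dots> = (\<Sum>i<n. if i = j then 1 else 0)"
      by (intro sum.cong) (auto simp: unit_vec_def)
    also have "\<dots> \<le> 1" by (subst sum.delta) auto
    finally show ?thesis .
  qed
  then have "vnorm (A *\<^sub>v unit_vec n j) \<le> opnorm A" using assms by (intro opnorm_upper) auto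
  moreover have "cmod ((A *\<^sub>v unit_vec n j) $ i) \<le> vnorm (A *\<^sub>v unit_vec n j)"
    using assms by (intro norm_index_le_vnorm) auto
  moreover have "(A *\<^sub>v unit_vec n j) $ i = A $$ (i, j)" using assms by simp
  ultimately show ?thesis by simp
qed

lemma opnorm_add:
  assumes "A \<in> carrier_mat n n" "B \<in> carrier_mat n n"
  shows "opnorm (A + B) \<le> opnorm A + opnorm B"
proof (rule opnorm_le)
  fix v :: "complex vec" assume v: "v \<in> carrier_vec n"
  have "vnorm ((A + B) *\<^sub>v v) \<le> vnorm (A *\<^sub>v v) + vnorm (B *\<^sub>v v)"
    using assms v by (subst add_mult_distrib_mat_vec[of _ n n]) (auto intro!: vnorm_triangle[of _ n])
  also have "\<dots> \<le> opnorm A * vnorm v + opnorm B * vnorm v"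
    using assms v by (intro add_mono vnorm_mult_le)
  finally show "vnorm ((A + B) *\<^sub>v v) \<le> (opnorm A + opnorm B) * vnorm v" by (simp add: algebra_simps)
qed (use assms in \<open>auto simp: opnorm_nonneg\<close>)

lemma opnorm_mult:
  assumes "A \<in> carrier_mat n n" "B \<in> carrier_mat n n"
  shows "opnorm (A * B) \<le> opnorm A * opnorm B"
proof (rule opnorm_le)
  fix v :: "complex vec" assume v: "v \<in> carrier_vec n"
  have "vnorm ((A * B) *\<^sub>v v) = vnorm (A *\<^sub>v (B *\<^sub>v v))" using assms v by (simp add: assoc_mult_mat_vec)
  also have "\<dots> \<le> opnorm A * vnorm (B *\<^sub>v v)" using assms v by (intro vnorm_mult_le) auto
  also have "\<dots> \<le> opnorm A * (opnorm B * vnorm v)"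
    using assms v by (intro mult_left_mono vnorm_mult_le opnorm_nonneg)
  finally show "vnorm ((A * B) *\<^sub>v v) \<le> opnorm A * opnorm B * vnorm v" by (simp add: mult.assoc)
qed (use assms in \<open>auto simp: opnorm_nonneg\<close>)

lemma smult_mat_mult_vec:
  fixes c :: complex
  assumes "A \<in> carrier_mat n n" "v \<in> carrier_vec n"
  shows "(c \<cdot>\<^sub>m A) *\<^sub>v v = c \<cdot>\<^sub>v (A *\<^sub>v v)"
  using assms by (intro eq_vecI) (auto simp: row_smult)

text \<open>One inequality holds for all scalars; applied to \<open>inverse c\<close> it gives the
  converse.\<close>

lemma opnorm_smult:
  assumes A: "A \<in> carrier_mat n n"
  shows "opnorm (c \<cdot>\<^sub>m A) = cmod c * opnorm A"
proof -
  have le: "opnorm (c \<cdot>\<^sub>m A) \<le> cmod c * opnorm A" if "A \<in> carrier_mat n n" for c A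
    using that by (intro opnorm_le)
      (auto simp: smult_mat_mult_vec vnorm_smult mult.assoc opnorm_nonneg intro!: mult_left_mono vnorm_mult_le)
  show ?thesis
  proof (cases "c = 0")
    case True
    then show ?thesis using le[OF A, of 0] opnorm_nonneg[of "0 \<cdot>\<^sub>m A" n] A by simp
  next
    case False
    have "opnorm (inverse c \<cdot>\<^sub>m (c \<cdot>\<^sub>m A)) \<le> cmod (inverse c) * opnorm (c \<cdot>\<^sub>m A)"
      using A by (intro le) auto
    moreover have "inverse c \<cdot>\<^sub>m (c \<cdot>\<^sub>m A) = A" using False A by (intro eq_matI) auto
    ultimately have "cmod c * opnorm A \<le> opnorm (c \<cdot>\<^sub>m A)"
      using False by (simp add: norm_inverse norm_divide field_simps)
    with le[OF A, of c] show ?thesis by simp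
  qed
qed

lemma opnorm_zero [simp]: "opnorm (0\<^sub>m n n) = 0"
proof -
  have "0 \<cdot>\<^sub>m (0\<^sub>m n n) = (0\<^sub>m n n :: complex mat)" by (intro eq_matI) auto
  then show ?thesis using opnorm_smult[of "0\<^sub>m n n" n 0] by simp
qed

lemma opnorm_one_le: "opnorm (1\<^sub>m n) \<le> 1"
  by (rule opnorm_le[of _ n]) auto

text \<open>For skew-Hermitian \<open>X\<close> the cross term \<open>Re <v, X v>\<close> vanishes.\<close>

lemma opnorm_one_plus_skew:
  assumes X: "X \<in> carrier_mat n n" and skew: "\<And>i j. i < n \<Longrightarrow> j < n \<Longrightarrow> X $$ (i, j) = - cnj (X $$ (j, i))"
  shows "opnorm (1\<^sub>m n + X) \<le> sqrt (1 + (opnorm X)\<^sup>2)"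
proof (rule opnorm_le)
  fix v :: "complex vec" assume v: "v \<in> carrier_vec n"
  define w where "w = X *\<^sub>v v"
  have w: "w \<in> carrier_vec n" unfolding w_def using X v by simp
  define s where "s = (\<Sum>i<n. cnj (v $ i) * w $ i)"
  have wi: "w $ i = (\<Sum>j<n. X $$ (i, j) * v $ j)" if "i < n" for i
    unfolding w_def by (rule index_mult_mat_vec_sum[OF X v that])
  have "s = (\<Sum>i<n. \<Sum>j<n. cnj (v $ i) * X $$ (i, j) * v $ j)"
    by (simp add: s_def wi sum_distrib_left mult.assoc)
  also have "\<dots> = (\<Sum>j<n. \<Sum>i<n. cnj (v $ i) * X $$ (i, j) * v $ j)" by (rule sum.swap)
  \<comment> \<open>Skewness, applied after the sums are exchanged, shows that \<open>s\<close>, the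
    inner product of \<open>v\<close> with \<open>X v\<close>, equals \<open>- cnj s\<close> and so
    is purely imaginary.\<close>
  also have "\<dots> = (\<Sum>j<n. \<Sum>i<n. - (v $ j * (cnj (X $$ (j, i)) * cnj (v $ i))))"
  proof (intro sum.cong refl)
    fix i j assume "j \<in> {..<n}" "i \<in> {..<n}"
    then show "cnj (v $ i) * X $$ (i, j) * v $ j = - (v $ j * (cnj (X $$ (j, i)) * cnj (v $ i)))"
      by (subst skew[of i j]) (auto simp: mult_ac)
  qed
  also have "\<dots> = - cnj s"
    by (simp add: s_def wi sum_distrib_left sum_negf)
  finally have "Re s = - Re s" by (metis cnj.sel(1) uminus_complex.sel(1))
  then have s: "Re s = 0" by simp
  have sq: "(vnorm u)\<^sup>2 = (\<Sum>i<n. (cmod (u $ i))\<^sup>2)" if "u \<in> carrier_vec n" for u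
    using that by (simp add: vnorm_def sum_nonneg)
  have cmod_add_sq: "(cmod (x + y))\<^sup>2 = (cmod x)\<^sup>2 + (cmod y)\<^sup>2 + 2 * Re (cnj x * y)" for x y
    unfolding cmod_power2 by (simp add: power2_eq_square algebra_simps)
  have "(vnorm (v + w))\<^sup>2 = (\<Sum>i<n. (cmod (v $ i))\<^sup>2 + (cmod (w $ i))\<^sup>2 + 2 * Re (cnj (v $ i) * w $ i))"
    using v w by (simp add: sq) (intro sum.cong refl, simp add: cmod_add_sq)
  also have "\<dots> = (vnorm v)\<^sup>2 + (vnorm w)\<^sup>2 + 2 * Re s"
    using v w by (simp add: sq sum.distrib s_def sum_distrib_left)
  also have "\<dots> \<le> (vnorm v)\<^sup>2 + (opnorm X * vnorm v)\<^sup>2"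
    using vnorm_mult_le[OF X v] s by (auto simp: w_def intro!: power_mono)
  also have "\<dots> = (sqrt (1 + (opnorm X)\<^sup>2) * vnorm v)\<^sup>2"
    by (simp add: power_mult_distrib algebra_simps)
  finally have "vnorm (v + w) \<le> sqrt (1 + (opnorm X)\<^sup>2) * vnorm v"
    by (rule power2_le_imp_le) simp
  moreover have "(1\<^sub>m n + X) *\<^sub>v v = v + w"
    unfolding w_def using X v by (subst add_mult_distrib_mat_vec[of _ n n]) auto
  ultimately show "vnorm ((1\<^sub>m n + X) *\<^sub>v v) \<le> sqrt (1 + (opnorm X)\<^sup>2) * vnorm v" by simp
qed (use X in auto)

section \<open>A Banach algebra containing all matrix algebras\<close>

text \<open>The bounded sequences whose \<open>n\<close>-th entry is an \<open>n\<close> by \<open>n\<close> matrix form a single Banach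
  algebra that contains an isometric copy of the matrices of every size, so that the
  exponential of the library is available although the dimension is a variable.\<close>

typedef matseq = "{f :: nat \<Rightarrow> complex mat. (\<forall>n. f n \<in> carrier_mat n n) \<and> (\<exists>K. \<forall>n. opnorm (f n) \<le> K)}"
  morphisms coord Matseq
  by (rule exI[of _ "\<lambda>n. 0\<^sub>m n n"]) (auto intro!: exI[of _ 0])

setup_lifting type_definition_matseq

lemma uminus_mat_smult: "- A = (-1 :: complex) \<cdot>\<^sub>m A"
  by (intro eq_matI) auto

lemma minus_mat_smult: "dim_row A = dim_row B \<Longrightarrow> dim_col A = dim_col B \<Longrightarrow> A - B = A + (-1 :: complex) \<cdot>\<^sub>m B"
  by (intro eq_matI) auto

instantiation matseq :: "{zero, one, plus, minus, uminus, times, scaleR}"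
begin

lift_definition zero_matseq :: matseq is "\<lambda>n. 0\<^sub>m n n"
  by (auto intro!: exI[of _ 0])

lift_definition one_matseq :: matseq is "\<lambda>n. 1\<^sub>m n"
  using opnorm_one_le by auto

lift_definition plus_matseq :: "matseq \<Rightarrow> matseq \<Rightarrow> matseq" is "\<lambda>f g n. f n + g n"
proof safe
  fix f g :: "nat \<Rightarrow> complex mat" and K L
  assume *: "\<forall>n. f n \<in> carrier_mat n n" "\<forall>n. g n \<in> carrier_mat n n"
    "\<forall>n. opnorm (f n) \<le> K" "\<forall>n. opnorm (g n) \<le> L"
  then show "\<exists>K. \<forall>n. opnorm (f n + g n) \<le> K"
    by (intro exI[of _ "K + L"]) (meson add_mono opnorm_add order_trans)
  show "f n + g n \<in> carrier_mat n n" for n using * by simp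
qed

lift_definition scaleR_matseq :: "real \<Rightarrow> matseq \<Rightarrow> matseq" is "\<lambda>r f n. complex_of_real r \<cdot>\<^sub>m f n"
proof safe
  fix f :: "nat \<Rightarrow> complex mat" and r K
  assume *: "\<forall>n. f n \<in> carrier_mat n n" "\<forall>n. opnorm (f n) \<le> K"
  have "opnorm (complex_of_real r \<cdot>\<^sub>m f n) \<le> \<bar>r\<bar> * K" for n
    using * by (subst opnorm_smult[of _ n]) (auto intro: mult_left_mono)
  then show "\<exists>K. \<forall>n. opnorm (complex_of_real r \<cdot>\<^sub>m f n) \<le> K"
    by blast
  show "complex_of_real r \<cdot>\<^sub>m f n \<in> carrier_mat n n" for n using * by simp
qed

lift_definition times_matseq :: "matseq \<Rightarrow> matseq \<Rightarrow> matseq" is "\<lambda>f g n. f n * g n"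
proof safe
  fix f g :: "nat \<Rightarrow> complex mat" and K L
  assume *: "\<forall>n. f n \<in> carrier_mat n n" "\<forall>n. g n \<in> carrier_mat n n"
    "\<forall>n. opnorm (f n) \<le> K" "\<forall>n. opnorm (g n) \<le> L"
  have "opnorm (f n * g n) \<le> K * L" for n
    using * opnorm_mult[of "f n" n "g n"] opnorm_nonneg[of "f n" n] opnorm_nonneg[of "g n" n]
    by (meson mult_mono order_trans)
  then show "\<exists>K. \<forall>n. opnorm (f n * g n) \<le> K" by blast
  show "f n * g n \<in> carrier_mat n n" for n using *[rule_format, of n] by simp
qed

text \<open>Derived from scaling instead of lifted, so boundedness of the sequence need not be
  proved again.\<close>

definition uminus_matseq :: "matseq \<Rightarrow> matseq" where "uminus_matseq x = (-1) *\<^sub>R x"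

definition minus_matseq :: "matseq \<Rightarrow> matseq \<Rightarrow> matseq" where "minus_matseq x y = x + - y"

instance ..
end

lemma coord_carrier [simp]: "coord x n \<in> carrier_mat n n"
  by transfer auto

lemma coord_simps:
  "coord 0 n = 0\<^sub>m n n" "coord 1 n = 1\<^sub>m n" "coord (x + y) n = coord x n + coord y n"
  "coord (x * y) n = coord x n * coord y n" "coord (r *\<^sub>R x) n = complex_of_real r \<cdot>\<^sub>m coord x n"
  "coord (x - y) n = coord x n - coord y n" "coord (- x) n = - coord x n"
proof -
  show "coord 0 n = 0\<^sub>m n n" "coord 1 n = 1\<^sub>m n" "coord (x + y) n = coord x n + coord y n"
  "coord (x * y) n = coord x n * coord y n" "coord (r *\<^sub>R x) n = complex_of_real r \<cdot>\<^sub>m coord x n" for x y r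
    by (transfer, simp)+
  note * = this
  show "coord (- x) n = - coord x n" for x by (simp add: uminus_matseq_def * uminus_mat_smult)
  note ** = this
  show "coord (x - y) n = coord x n - coord y n"
    using coord_carrier[of x n] coord_carrier[of y n]
    by (simp add: minus_matseq_def * ** uminus_mat_smult minus_mat_smult del: coord_carrier)
qed

lemma coord_dim [simp]: "dim_row (coord x n) = n" "dim_col (coord x n) = n"
  using coord_carrier[of x n] by (blast dest: carrier_matD)+

text \<open>Outside the matrix, \<open>entry\<close> is zero, which makes it linear without side conditions.\<close>

definition entry :: "nat \<Rightarrow> nat \<Rightarrow> nat \<Rightarrow> matseq \<Rightarrow> complex" where
  "entry n i j x = (if i < n \<and> j < n then coord x n $$ (i, j) else 0)"

lemma matseq_eqI: "(\<And>n i j. i < n \<Longrightarrow> j < n \<Longrightarrow> entry n i j x = entry n i j y) \<Longrightarrow> x = y"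
  unfolding entry_def coord_inject[symmetric] by (intro ext eq_matI) auto

lemma entry_simps:
  "entry n i j 0 = 0" "entry n i j (x + y) = entry n i j x + entry n i j y"
  "entry n i j (r *\<^sub>R x) = r *\<^sub>R entry n i j x"
  "entry n i j (x - y) = entry n i j x - entry n i j y" "entry n i j (- x) = - entry n i j x"
  by (simp_all add: entry_def coord_simps) (simp add: scaleR_conv_of_real)?

lemma entry_one: "entry n i j 1 = (if i = j \<and> i < n then 1 else 0)"
  by (auto simp: entry_def coord_simps)

lemma entry_mult: "entry n i j (x * y) = (\<Sum>k<n. entry n i k x * entry n k j y)"
  by (auto simp: entry_def coord_simps scalar_prod_def atLeast0LessThan intro!: sum.cong)

lift_definition supnorm :: "matseq \<Rightarrow> real" is "\<lambda>f. SUP n. opnorm (f n)" .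

lemma opnorm_coord_le_supnorm: "opnorm (coord x n) \<le> supnorm x"
  by transfer (auto intro!: cSUP_upper bdd_aboveI2)

lemma supnorm_le: "(\<And>n. opnorm (coord x n) \<le> K) \<Longrightarrow> supnorm x \<le> K"
  by transfer (auto intro!: cSUP_least)

lemma norm_entry_le_supnorm: "cmod (entry n i j x) \<le> supnorm x"
  using norm_index_le_opnorm[OF coord_carrier, of i n j x] opnorm_coord_le_supnorm[of x n] opnorm_nonneg[OF coord_carrier, of x n]
  by (auto simp: entry_def)

instantiation matseq :: real_normed_algebra_1
begin

definition "norm_matseq = supnorm"
definition "dist_matseq x y = supnorm (x - y)"
definition "sgn_matseq x = x /\<^sub>R supnorm x"
definition "uniformity_matseq = (INF e\<in>{0<..}. principal {(x :: matseq, y). dist x y < e})"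
definition "open_matseq (U :: matseq set) \<longleftrightarrow>
  (\<forall>x\<in>U. eventually (\<lambda>(x', y). x' = x \<longrightarrow> y \<in> U) uniformity)"

instance
proof
  fix x y z :: matseq and a b :: real
  note [simp] = entry_simps entry_one entry_mult
  show "x + y + z = x + (y + z)" "x + y = y + x" "0 + x = x" "- x + x = 0" "x - y = x + - y"
    "a *\<^sub>R (x + y) = a *\<^sub>R x + a *\<^sub>R y" "(a + b) *\<^sub>R x = a *\<^sub>R x + b *\<^sub>R x"
    "a *\<^sub>R b *\<^sub>R x = (a * b) *\<^sub>R x" "1 *\<^sub>R x = x"
    by (rule matseq_eqI; simp add: algebra_simps)+
  show "(x + y) * z = x * z + y * z" "x * (y + z) = x * y + x * z"
    by (rule matseq_eqI; simp add: algebra_simps sum.distrib)+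
  show "a *\<^sub>R x * y = a *\<^sub>R (x * y)" "x * a *\<^sub>R y = a *\<^sub>R (x * y)"
    by (rule matseq_eqI; simp add: scaleR_sum_right)+
  show "x * y * z = x * (y * z)"
    by (rule matseq_eqI)
      (simp add: sum_distrib_left sum_distrib_right mult.assoc, rule sum.swap)
  show "1 * x = x" "x * 1 = x"
    by (rule matseq_eqI; simp add: if_distrib if_distribR sum.delta cong: if_cong)+
  show "(0::matseq) \<noteq> 1"
  proof
    assume "(0::matseq) = 1"
    \<comment> \<open>In coordinate 0 the matrices have size 0 and zero equals one; coordinate 1 is
      the first that separates them.\<close>
    then have "entry 1 0 0 0 = entry 1 0 0 1" by simp
    then show False by simp
  qed
  show "dist x y = norm (x - y)" by (simp add: dist_matseq_def norm_matseq_def)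
  show "sgn x = x /\<^sub>R norm x" by (simp add: sgn_matseq_def norm_matseq_def)
  show "uniformity = (INF e\<in>{0<..}. principal {(x :: matseq, y). dist x y < e})" by (rule uniformity_matseq_def)
  show "open U \<longleftrightarrow> (\<forall>x\<in>U. eventually (\<lambda>(x', y). x' = x \<longrightarrow> y \<in> U) uniformity)" for U :: "matseq set"
    by (rule open_matseq_def)
  note [simp] = norm_matseq_def
  have norm0: "supnorm x \<ge> 0" for x :: matseq
    using norm_entry_le_supnorm[of 0 0 0 x] norm_ge_zero order_trans by blast
  show "norm x = 0 \<longleftrightarrow> x = 0"
    unfolding norm_matseq_def
  proof
    assume "supnorm x = 0"
    then show "x = 0" using norm_entry_le_supnorm[of _ _ _ x] by (intro matseq_eqI) simp
  next
    assume "x = 0"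
    then have "supnorm x \<le> 0" by (intro supnorm_le) (simp add: coord_simps)
    with norm0[of x] show "supnorm x = 0" by simp
  qed
  show "norm (x + y) \<le> norm x + norm y"
    unfolding norm_matseq_def
    by (rule supnorm_le)
      (metis add_mono coord_carrier coord_simps(3) opnorm_add opnorm_coord_le_supnorm order_trans)
  have scale: "supnorm (a *\<^sub>R x) \<le> \<bar>a\<bar> * supnorm x" for a x
    by (rule supnorm_le)
      (simp add: coord_simps opnorm_smult[OF coord_carrier] mult_left_mono opnorm_coord_le_supnorm)
  show "norm (a *\<^sub>R x) = \<bar>a\<bar> * norm x"
  proof (cases "a = 0")
    case True
    then show ?thesis using scale[of a x] norm0[of "a *\<^sub>R x"] by simp
  next
    case False
    have "inverse a *\<^sub>R a *\<^sub>R x = x" using False by (intro matseq_eqI) simp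
    then have "supnorm x \<le> \<bar>inverse a\<bar> * supnorm (a *\<^sub>R x)" using scale[of "inverse a" "a *\<^sub>R x"] by simp
    then have "\<bar>a\<bar> * supnorm x \<le> supnorm (a *\<^sub>R x)"
      using False by (simp add: abs_inverse field_simps)
    with scale[of a x] show ?thesis by simp
  qed
  show "norm (x * y) \<le> norm x * norm y"
    unfolding norm_matseq_def
  proof (rule supnorm_le)
    fix n
    have "opnorm (coord (x * y) n) \<le> opnorm (coord x n) * opnorm (coord y n)"
      unfolding coord_simps by (rule opnorm_mult[OF coord_carrier coord_carrier])
    also have "\<dots> \<le> supnorm x * supnorm y"
      by (intro mult_mono opnorm_coord_le_supnorm norm0 opnorm_nonneg[OF coord_carrier])
    finally show "opnorm (coord (x * y) n) \<le> supnorm x * supnorm y" .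
  qed
  have "supnorm (1::matseq) \<le> 1" by (rule supnorm_le) (simp only: coord_simps opnorm_one_le)
  moreover have "1 \<le> supnorm (1::matseq)" using norm_entry_le_supnorm[of 1 0 0 1] by simp
  ultimately show "norm (1::matseq) = 1" by simp
qed

end

lemmas opnorm_coord_le = opnorm_coord_le_supnorm[folded norm_matseq_def]
lemmas norm_matseq_le = supnorm_le[folded norm_matseq_def]
lemmas norm_entry_le_norm = norm_entry_le_supnorm[folded norm_matseq_def]

lemma bounded_linear_entry: "bounded_linear (entry n i j)"
  by (rule bounded_linear_intro[where K = 1]) (simp_all add: entry_simps norm_entry_le_norm)

instance matseq :: banach
proof
  fix f :: "nat \<Rightarrow> matseq" assume C: "Cauchy f"
  have conv: "convergent (\<lambda>k. entry n i j (f k))" for n i j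
    using bounded_linear.Cauchy[OF bounded_linear_entry C] by (simp add: Cauchy_convergent_iff)
  define g where "g n = mat n n (\<lambda>(i, j). lim (\<lambda>k. entry n i j (f k)))" for n
  have g: "g n \<in> carrier_mat n n" for n by (simp add: g_def)
  have lim: "(\<lambda>k. coord (f k) n $$ (i, j)) \<longlonglongrightarrow> g n $$ (i, j)" if "i < n" "j < n" for n i j
    using convergent_LIMSEQ_iff[THEN iffD1, OF conv, of n i j] that by (simp add: g_def entry_def)
  \<comment> \<open>Entrywise convergence controls the image of each fixed vector, so the bound
    \<open>e\<close> passes to the limit vector by vector. Neither \<open>N\<close> nor
    \<open>e\<close> depends on the coordinate, which makes the convergence uniform.\<close>
  have close: "opnorm (coord (f m) n + (-1) \<cdot>\<^sub>m g n) \<le> e"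
    if "\<And>k. k \<ge> N \<Longrightarrow> norm (f m - f k) \<le> e" "e \<ge> 0" for m n N e
  proof (rule opnorm_le)
    show "coord (f m) n + (-1) \<cdot>\<^sub>m g n \<in> carrier_mat n n" using g by simp
    fix v :: "complex vec" assume v: "v \<in> carrier_vec n"
    have vn: "vnorm (A *\<^sub>v v) = sqrt (\<Sum>i<n. (cmod (\<Sum>j<n. A $$ (i, j) * v $ j))\<^sup>2)"
      if "A \<in> carrier_mat n n" for A
      using that v by (auto simp: vnorm_def index_mult_mat_vec_sum simp del: index_mult_mat_vec)
    have "(\<lambda>k. sqrt (\<Sum>i<n. (cmod (\<Sum>j<n. (coord (f m) n $$ (i, j) - coord (f k) n $$ (i, j)) * v $ j))\<^sup>2))
       \<longlonglongrightarrow> sqrt (\<Sum>i<n. (cmod (\<Sum>j<n. (coord (f m) n $$ (i, j) - g n $$ (i, j)) * v $ j))\<^sup>2)"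
      by (intro tendsto_intros lim) auto
    moreover have "sqrt (\<Sum>i<n. (cmod (\<Sum>j<n. (coord (f m) n $$ (i, j) - coord (f k) n $$ (i, j)) * v $ j))\<^sup>2)
        = vnorm (coord (f m - f k) n *\<^sub>v v)" for k
      by (subst vn) (simp_all add: coord_simps minus_carrier_mat)
    moreover have "sqrt (\<Sum>i<n. (cmod (\<Sum>j<n. (coord (f m) n $$ (i, j) - g n $$ (i, j)) * v $ j))\<^sup>2)
        = vnorm ((coord (f m) n + (-1) \<cdot>\<^sub>m g n) *\<^sub>v v)"
      using g[of n] by (subst vn) auto
    ultimately have "(\<lambda>k. vnorm (coord (f m - f k) n *\<^sub>v v)) \<longlonglongrightarrow> vnorm ((coord (f m) n + (-1) \<cdot>\<^sub>m g n) *\<^sub>v v)"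
      by simp
    then show "vnorm ((coord (f m) n + (-1) \<cdot>\<^sub>m g n) *\<^sub>v v) \<le> e * vnorm v"
    proof (rule LIMSEQ_le_const2, intro exI[of _ N] allI impI)
      fix k assume "N \<le> k"
      have "vnorm (coord (f m - f k) n *\<^sub>v v) \<le> opnorm (coord (f m - f k) n) * vnorm v"
        using v by (intro vnorm_mult_le) auto
      also have "\<dots> \<le> e * vnorm v"
        using that(1)[OF \<open>N \<le> k\<close>] by (intro mult_right_mono order_trans[OF opnorm_coord_le]) auto
      finally show "vnorm (coord (f m - f k) n *\<^sub>v v) \<le> e * vnorm v" .
    qed
  qed fact
  have Cd: "\<exists>N. \<forall>m\<ge>N. \<forall>k\<ge>N. norm (f m - f k) \<le> e" if "e > 0" for e
    using C that unfolding Cauchy_def dist_norm by (meson less_imp_le)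
  obtain N where N: "\<And>k. k \<ge> N \<Longrightarrow> norm (f N - f k) \<le> 1" using Cd[of 1] by auto
  \<comment> \<open>Without a uniform bound the limit \<open>g\<close> would not represent an
    element of \<open>matseq\<close>.\<close>
  have "opnorm (g n) \<le> norm (f N) + 1" for n
  proof -
    have "g n = coord (f N) n + (-1) \<cdot>\<^sub>m (coord (f N) n + (-1) \<cdot>\<^sub>m g n)"
      using g[of n] by (intro eq_matI) auto
    then have "opnorm (g n) \<le> opnorm (coord (f N) n) + opnorm ((-1) \<cdot>\<^sub>m (coord (f N) n + (-1) \<cdot>\<^sub>m g n))"
      by (metis add_carrier_mat coord_carrier g opnorm_add smult_carrier_mat)
    also have "\<dots> = opnorm (coord (f N) n) + opnorm (coord (f N) n + (-1) \<cdot>\<^sub>m g n)"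
      using g[of n] by (subst opnorm_smult[of _ n]) auto
    also have "\<dots> \<le> norm (f N) + 1" by (intro add_mono opnorm_coord_le close[OF N]) auto
    finally show ?thesis .
  qed
  then have "coord (Matseq g) = g" using g by (intro Matseq_inverse) auto
  then have conv: "norm (f m - Matseq g) \<le> e" if "\<And>k. k \<ge> N \<Longrightarrow> norm (f m - f k) \<le> e" "e \<ge> 0" for m N e
    using close[OF that] g by (intro norm_matseq_le) (simp add: coord_simps minus_mat_smult carrier_matD[OF g])
  have "f \<longlonglongrightarrow> Matseq g"
  proof (rule LIMSEQ_I)
    fix e :: real assume "e > 0"
    then obtain N where "\<forall>m\<ge>N. \<forall>k\<ge>N. norm (f m - f k) \<le> e / 2" using Cd[of "e / 2"] by auto
    then have "norm (f m - Matseq g) \<le> e / 2" if "m \<ge> N" for m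
      using that \<open>e > 0\<close> by (intro conv[of N]) auto
    then show "\<exists>N. \<forall>m\<ge>N. norm (f m - Matseq g) < e"
      using \<open>e > 0\<close> by (intro exI[of _ N]) (fastforce intro: le_less_trans)
  qed
  then show "convergent f" by (auto simp: convergent_def)
qed

section \<open>Skew-Hermitian elements of the sequence algebra\<close>

definition skew_matseq :: "matseq set" where
  "skew_matseq = {x. \<forall>n i j. entry n i j x = - cnj (entry n j i x)}"

lemma skew_matseqD: "x \<in> skew_matseq \<Longrightarrow> entry n i j x = - cnj (entry n j i x)"
  unfolding skew_matseq_def by blast

lemma skew_matseqI: "(\<And>n i j. entry n i j x = - cnj (entry n j i x)) \<Longrightarrow> x \<in> skew_matseq"
  unfolding skew_matseq_def by blast

interpretation skew_matseq: skew_algebra skew_matseq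
proof
  show "subspace skew_matseq"
  proof (rule subspaceI)
    show "0 \<in> skew_matseq" by (rule skew_matseqI) (simp add: entry_simps)
    show "x + y \<in> skew_matseq" if "x \<in> skew_matseq" "y \<in> skew_matseq" for x y
    proof (rule skew_matseqI)
      show "entry n i j (x + y) = - cnj (entry n j i (x + y))" for n i j
        using that[THEN skew_matseqD, of n i j] by (simp add: entry_simps)
    qed
    show "r *\<^sub>R x \<in> skew_matseq" if "x \<in> skew_matseq" for r x
    proof (rule skew_matseqI)
      show "entry n i j (r *\<^sub>R x) = - cnj (entry n j i (r *\<^sub>R x))" for n i j
        using skew_matseqD[OF that, of n i j] by (simp add: entry_simps)
    qed
  qed
  show "closed skew_matseq"
    unfolding skew_matseq_def
    by (intro closed_Collect_all closed_Collect_eq continuous_intros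
        linear_continuous_on[OF bounded_linear_entry])
  fix x y :: matseq assume x: "x \<in> skew_matseq"
  note xs = skew_matseqD[OF x]
  show "(norm (1 + x))\<^sup>2 \<le> 1 + (norm x)\<^sup>2"
  proof -
    have "norm (1 + x) \<le> sqrt (1 + (norm x)\<^sup>2)"
    proof (rule norm_matseq_le)
      fix n
      have "opnorm (coord (1 + x) n) \<le> sqrt (1 + (opnorm (coord x n))\<^sup>2)"
        unfolding coord_simps
      proof (rule opnorm_one_plus_skew[OF coord_carrier])
        show "coord x n $$ (i, j) = - cnj (coord x n $$ (j, i))" if "i < n" "j < n" for i j
          using xs[of n i j] that by (simp add: entry_def)
      qed
      also have "\<dots> \<le> sqrt (1 + (norm x)\<^sup>2)"
        by (intro real_sqrt_le_mono add_left_mono power_mono opnorm_coord_le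
            opnorm_nonneg[OF coord_carrier])
      finally show "opnorm (coord (1 + x) n) \<le> sqrt (1 + (norm x)\<^sup>2)" .
    qed
    then have "(norm (1 + x))\<^sup>2 \<le> (sqrt (1 + (norm x)\<^sup>2))\<^sup>2" by (intro power_mono) auto
    then show ?thesis by simp
  qed
  assume y: "y \<in> skew_matseq"
  note ys = skew_matseqD[OF y]
  \<comment> \<open>The two signs cancel, so the adjoint of a product of skew elements is the
    product in reverse order. This makes the bracket skew.\<close>
  have xy: "entry n i j (x * y) = cnj (entry n j i (y * x))" for n i j
    unfolding entry_mult cnj_sum
    by (intro sum.cong refl) (simp add: xs[of n i] ys[of n _ j] mult.commute)
  have yx: "entry n i j (y * x) = cnj (entry n j i (x * y))" for n i j
    unfolding entry_mult cnj_sum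
    by (intro sum.cong refl) (simp add: ys[of n i] xs[of n _ j] mult.commute)
  show "lie_bracket x y \<in> skew_matseq"
  proof (rule skew_matseqI)
    fix n i j
    show "entry n i j (lie_bracket x y) = - cnj (entry n j i (lie_bracket x y))"
      unfolding lie_bracket_def entry_simps xy[of n i j] yx[of n i j] by simp
  qed
qed

section \<open>Embedding the matrices of one size\<close>

lemma comm_carrier [simp]: "A \<in> carrier_mat n n \<Longrightarrow> B \<in> carrier_mat n n \<Longrightarrow> comm A B \<in> carrier_mat n n"
  unfolding comm_def by (intro minus_carrier_mat mult_carrier_mat)

lemma index_comm:
  assumes "A \<in> carrier_mat n n" "B \<in> carrier_mat n n" "i < n" "j < n"
  shows "comm A B $$ (i, j) = (\<Sum>k<n. A $$ (i, k) * B $$ (k, j)) - (\<Sum>k<n. B $$ (i, k) * A $$ (k, j))"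
  using assms by (auto simp: comm_def scalar_prod_def atLeast0LessThan)

lemma comm_smult:
  assumes "A \<in> carrier_mat n n" "B \<in> carrier_mat n n"
  shows "comm (c \<cdot>\<^sub>m A) (d \<cdot>\<^sub>m B) = (c * d) \<cdot>\<^sub>m comm A B"
proof (rule eq_matI)
  fix i j assume "i < dim_row ((c * d) \<cdot>\<^sub>m comm A B)" "j < dim_col ((c * d) \<cdot>\<^sub>m comm A B)"
  then have ij: "i < n" "j < n" using carrier_matD[OF comm_carrier[OF assms]] by auto
  have "comm (c \<cdot>\<^sub>m A) (d \<cdot>\<^sub>m B) $$ (i, j) =
      (\<Sum>k<n. (c * d) * (A $$ (i, k) * B $$ (k, j))) - (\<Sum>k<n. (c * d) * (B $$ (i, k) * A $$ (k, j)))"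
    using assms ij by (subst index_comm[of _ n]) (auto intro!: arg_cong2[of _ _ _ _ "(-)"] sum.cong)
  also have "\<dots> = ((c * d) \<cdot>\<^sub>m comm A B) $$ (i, j)"
    using assms ij carrier_matD[OF comm_carrier[OF assms]]
    by (simp add: index_comm sum_distrib_left right_diff_distrib)
  finally show "comm (c \<cdot>\<^sub>m A) (d \<cdot>\<^sub>m B) $$ (i, j) = ((c * d) \<cdot>\<^sub>m comm A B) $$ (i, j)" .
qed (use carrier_matD[OF comm_carrier[OF assms]]
    carrier_matD[OF comm_carrier[of "c \<cdot>\<^sub>m A" n "d \<cdot>\<^sub>m B"]] assms in auto)

lemma msum_carrier [simp]: "msum n f P \<in> carrier_mat n n"
  by (simp add: msum_def)

text \<open>Zero in all other coordinates: additive, multiplicative and isometric on matrices of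
  size \<open>n\<close>, but not unital.\<close>

definition mat_embed :: "nat \<Rightarrow> complex mat \<Rightarrow> matseq" where
  "mat_embed n A = Matseq (\<lambda>m. if m = n then A else 0\<^sub>m m m)"

lemma coord_mat_embed:
  assumes "A \<in> carrier_mat n n"
  shows "coord (mat_embed n A) = (\<lambda>m. if m = n then A else 0\<^sub>m m m)"
  unfolding mat_embed_def using assms opnorm_nonneg[OF assms]
  by (intro Matseq_inverse) (auto intro!: exI[of _ "opnorm A"])

lemma entry_embed:
  "A \<in> carrier_mat n n \<Longrightarrow>
    entry m i j (mat_embed n A) = (if m = n \<and> i < n \<and> j < n then A $$ (i, j) else 0)"
  by (auto simp: entry_def coord_mat_embed)

lemma norm_embed: "A \<in> carrier_mat n n \<Longrightarrow> norm (mat_embed n A) = opnorm A"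
proof (rule antisym)
  assume A: "A \<in> carrier_mat n n"
  show "norm (mat_embed n A) \<le> opnorm A"
    by (rule norm_matseq_le) (auto simp: coord_mat_embed[OF A] opnorm_nonneg[OF A])
  show "opnorm A \<le> norm (mat_embed n A)"
    using opnorm_coord_le[of "mat_embed n A" n] by (simp add: coord_mat_embed[OF A])
qed

lemma embed_add:
  "A \<in> carrier_mat n n \<Longrightarrow> B \<in> carrier_mat n n \<Longrightarrow> mat_embed n (A + B) = mat_embed n A + mat_embed n B"
  by (rule matseq_eqI) (auto simp: entry_embed entry_simps)

lemma embed_diff:
  "A \<in> carrier_mat n n \<Longrightarrow> B \<in> carrier_mat n n \<Longrightarrow> mat_embed n (A - B) = mat_embed n A - mat_embed n B"
  by (rule matseq_eqI) (auto simp: entry_embed[OF minus_carrier_mat] entry_embed entry_simps)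

lemma embed_mult:
  "A \<in> carrier_mat n n \<Longrightarrow> B \<in> carrier_mat n n \<Longrightarrow> mat_embed n (A * B) = mat_embed n A * mat_embed n B"
  by (rule matseq_eqI)
    (auto simp: entry_embed[OF mult_carrier_mat] entry_embed entry_mult scalar_prod_def atLeast0LessThan
      intro!: sum.cong)

lemma embed_comm:
  "A \<in> carrier_mat n n \<Longrightarrow> B \<in> carrier_mat n n \<Longrightarrow> mat_embed n (comm A B) = lie_bracket (mat_embed n A) (mat_embed n B)"
  unfolding comm_def lie_bracket_def
  by (subst embed_diff) (auto simp: embed_mult intro!: mult_carrier_mat)

text \<open>\<open>matseq\<close> is an algebra over the reals only. The factor \<open>-i\<close>
  must therefore stay inside the embedding while real weights are pulled out.\<close>

lemma embed_smult_of_real: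
  "A \<in> carrier_mat n n \<Longrightarrow> mat_embed n (c \<cdot>\<^sub>m (complex_of_real r \<cdot>\<^sub>m A)) = r *\<^sub>R mat_embed n (c \<cdot>\<^sub>m A)"
  by (rule matseq_eqI) (auto simp: entry_embed entry_simps scaleR_conv_of_real[where 'a = complex])

lemma entry_sum: "entry n i j (\<Sum>p\<in>P. f p) = (\<Sum>p\<in>P. entry n i j (f p))"
  by (rule linear_sum) (rule bounded_linear.linear[OF bounded_linear_entry])

lemma embed_smult_msum:
  assumes "\<And>p. p \<in> P \<Longrightarrow> f p \<in> carrier_mat n n"
  shows "mat_embed n (c \<cdot>\<^sub>m msum n f P) = (\<Sum>p\<in>P. mat_embed n (c \<cdot>\<^sub>m f p))"
  using assms
  by (intro matseq_eqI) (auto simp: entry_embed entry_sum msum_def sum_distrib_left carrier_matD[OF assms]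
      intro!: sum.cong sum.neutral)

text \<open>The operator norm is at most the sum of the moduli of the entries, so finitely many
  entrywise difference quotients control the quotient in norm.\<close>

lemma embed_has_vector_derivative:
  assumes F: "\<And>s. s \<in> D \<Longrightarrow> F s \<in> carrier_mat n n" and F': "F' \<in> carrier_mat n n" and t: "t \<in> D"
    and der: "\<And>i j. i < n \<Longrightarrow> j < n \<Longrightarrow>
       ((\<lambda>s. F s $$ (i, j)) has_vector_derivative F' $$ (i, j)) (at t within D)"
  shows "((\<lambda>s. mat_embed n (F s)) has_vector_derivative mat_embed n F') (at t within D)"
  unfolding has_vector_derivative_def has_derivative_iff_norm
proof (intro conjI)
  show "bounded_linear (\<lambda>h. h *\<^sub>R mat_embed n F')" by (rule bounded_linear_scaleR_left)
  define q where "q i j s = norm (F s $$ (i, j) - F t $$ (i, j) - (s - t) *\<^sub>R F' $$ (i, j)) / norm (s - t)" for i j s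
  have q: "(q i j \<longlongrightarrow> 0) (at t within D)" if "i < n" "j < n" for i j
    using der[OF that] unfolding has_vector_derivative_def has_derivative_iff_norm q_def by simp
  show "((\<lambda>s. norm (mat_embed n (F s) - mat_embed n (F t) - (s - t) *\<^sub>R mat_embed n F') / norm (s - t)) \<longlongrightarrow> 0) (at t within D)"
  proof (rule Lim_null_comparison)
    have "((\<lambda>s. \<Sum>i<n. \<Sum>j<n. q i j s) \<longlongrightarrow> (\<Sum>i<n. \<Sum>j<n. 0)) (at t within D)"
      by (intro tendsto_sum q) auto
    then show "((\<lambda>s. \<Sum>i<n. \<Sum>j<n. q i j s) \<longlongrightarrow> 0) (at t within D)" by simp
    have "\<forall>\<^sub>F s in at t within D. s \<in> D" by (simp add: eventually_at_filter)
    then show "\<forall>\<^sub>F s in at t within D.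
       norm (norm (mat_embed n (F s) - mat_embed n (F t) - (s - t) *\<^sub>R mat_embed n F') / norm (s - t)) \<le> (\<Sum>i<n. \<Sum>j<n. q i j s)"
    proof eventually_elim
      case (elim s)
      define B where "B = mat n n (\<lambda>(i, j). F s $$ (i, j) - F t $$ (i, j) - (s - t) *\<^sub>R F' $$ (i, j))"
      have "mat_embed n (F s) - mat_embed n (F t) - (s - t) *\<^sub>R mat_embed n F' = mat_embed n B"
        using F[OF elim] F[OF t] F' by (intro matseq_eqI) (auto simp: entry_embed entry_simps B_def)
      moreover have "norm (mat_embed n B) \<le> (\<Sum>i<n. \<Sum>j<n. cmod (B $$ (i, j)))"
        by (subst norm_embed) (auto simp: B_def intro!: order_trans[OF opnorm_le_sum[of _ n]])
      moreover have "(\<Sum>i<n. \<Sum>j<n. cmod (B $$ (i, j))) / norm (s - t) = (\<Sum>i<n. \<Sum>j<n. q i j s)"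
        by (simp add: q_def B_def sum_divide_distrib)
      ultimately show ?case by (simp add: divide_right_mono flip: \<open>_ = (\<Sum>i<n. \<Sum>j<n. q i j s)\<close>)
    qed
  qed
qed

text \<open>Filling the remaining coordinates with identity matrices makes the embedding unital.\<close>

definition mat_embed1 :: "nat \<Rightarrow> complex mat \<Rightarrow> matseq" where
  "mat_embed1 n A = 1 + mat_embed n A - mat_embed n (1\<^sub>m n)"

lemma embed1_one: "mat_embed1 n (1\<^sub>m n) = 1"
  by (simp add: mat_embed1_def)

lemma embed1_mult:
  assumes "A \<in> carrier_mat n n" "B \<in> carrier_mat n n"
  shows "mat_embed1 n (A * B) = mat_embed1 n A * mat_embed1 n B"
proof -
  have "mat_embed n C * mat_embed n (1\<^sub>m n) = mat_embed n C" "mat_embed n (1\<^sub>m n) * mat_embed n C = mat_embed n C"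
    if "C \<in> carrier_mat n n" for C
    using that by (simp_all flip: embed_mult)
  then show ?thesis
    using assms by (simp add: mat_embed1_def embed_mult algebra_simps)
qed

lemma entry_embed1:
  "A \<in> carrier_mat n n \<Longrightarrow>
    entry m i j (mat_embed1 n A) = (if m = n then if i < n \<and> j < n then A $$ (i, j) else 0 else entry m i j 1)"
  by (auto simp: mat_embed1_def entry_simps entry_embed entry_one)

text \<open>Coordinate \<open>n\<close> carries the exponential series of \<open>X\<close> entry by
  entry. Elsewhere only the zeroth power survives, and it is the identity, which is why
  \<open>mat_embed1\<close> stands on the right.\<close>

lemma exp_embed:
  assumes X: "X \<in> carrier_mat n n"
  shows "exp (mat_embed n X) = mat_embed1 n (mexp X)"
proof (rule matseq_eqI)
  fix m i j :: nat assume ij: "i < m" "j < m"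
  have carr: "mexp X \<in> carrier_mat n n" using X by (auto simp: mexp_def)
  have "entry m i j (exp (mat_embed n X)) = (\<Sum>k. entry m i j (mat_embed n X ^ k /\<^sub>R fact k))"
    unfolding exp_def by (rule bounded_linear.suminf[OF bounded_linear_entry summable_exp_generic])
  also have "\<dots> = entry m i j (mat_embed1 n (mexp X))"
  proof (cases "m = n")
    case True
    have "entry n i j (mat_embed n X ^ k) = (X ^\<^sub>m k) $$ (i, j)" if "i < n" "j < n" for i j k
      using that
    proof (induction k arbitrary: i j)
      case 0
      then show ?case using X by (simp add: entry_one)
    next
      case (Suc k)
      have "entry n i j (mat_embed n X ^ Suc k) = (\<Sum>l<n. entry n i l (mat_embed n X ^ k) * entry n l j (mat_embed n X))"
        unfolding power_Suc2 entry_mult ..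
      also have "\<dots> = (\<Sum>l<n. (X ^\<^sub>m k) $$ (i, l) * X $$ (l, j))"
        using Suc X by (intro sum.cong) (auto simp: entry_embed)
      also have "\<dots> = (X ^\<^sub>m Suc k) $$ (i, j)"
        using Suc.prems X by (simp add: scalar_prod_def atLeast0LessThan)
      finally show ?case .
    qed
    then have "entry m i j (mat_embed n X ^ k /\<^sub>R fact k) = (X ^\<^sub>m k) $$ (i, j) / of_nat (fact k)" for k
      using True ij by (simp add: entry_simps scaleR_conv_of_real[where 'a = complex] divide_inverse mult.commute)
    moreover have "entry m i j (mat_embed1 n (mexp X)) = (\<Sum>k. (X ^\<^sub>m k) $$ (i, j) / of_nat (fact k))"
      using True ij X carr by (simp add: entry_embed1 mexp_def)
    ultimately show ?thesis by simp
  next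
    case False
    have "entry m i j (mat_embed n X ^ k /\<^sub>R fact k) = 0" if "k \<notin> {0}" for k
      using that False X by (cases k) (auto simp: entry_simps entry_mult entry_embed)
    then have "(\<Sum>k. entry m i j (mat_embed n X ^ k /\<^sub>R fact k)) = (\<Sum>k\<in>{0}. entry m i j (mat_embed n X ^ k /\<^sub>R fact k))"
      by (intro suminf_finite) auto
    then show ?thesis using False carr by (simp add: entry_embed1)
  qed
  finally show "entry m i j (exp (mat_embed n X)) = entry m i j (mat_embed1 n (mexp X))" .
qed

section \<open>From the abstract estimate to the statement about matrices\<close>

lemma embed_hermitian_skew:
  assumes "hermitian_mat n A"
  shows "mat_embed n ((- \<i>) \<cdot>\<^sub>m A) \<in> skew_matseq"
proof (rule skew_matseqI)
  have A: "A \<in> carrier_mat n n" using assms by (simp add: hermitian_mat_def)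
  show "entry m i j (mat_embed n ((- \<i>) \<cdot>\<^sub>m A)) = - cnj (entry m j i (mat_embed n ((- \<i>) \<cdot>\<^sub>m A)))" for m i j
    using A assms[unfolded hermitian_mat_def, THEN conjunct2, rule_format, of i j] by (auto simp: entry_embed)
qed

text \<open>\<open>Sup\<close> dominates its set only when the set is bounded above. Continuity on a
  compact interval ensures this for the suprema \<open>D1\<close> and \<open>D2\<close>.\<close>

lemma bdd_above_opnorm:
  assumes "\<And>t. t \<in> {a..b} \<Longrightarrow> F t \<in> carrier_mat n n" "mat_continuous_on n F {a..b}"
  shows "bdd_above ((\<lambda>t. opnorm (F t)) ` {a..b})"
proof -
  have "continuous_on {a..b} (\<lambda>t. \<Sum>i<n. \<Sum>j<n. cmod (F t $$ (i, j)))"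
    using assms(2) by (auto simp: mat_continuous_on_def intro!: continuous_intros)
  then have "bdd_above ((\<lambda>t. \<Sum>i<n. \<Sum>j<n. cmod (F t $$ (i, j))) ` {a..b})"
    by (intro bounded_imp_bdd_above compact_imp_bounded compact_continuous_image) auto
  then obtain K where "\<forall>t\<in>{a..b}. (\<Sum>i<n. \<Sum>j<n. cmod (F t $$ (i, j))) \<le> K"
    by (auto simp: bdd_above_def)
  then have "opnorm (F t) \<le> K" if "t \<in> {a..b}" for t
    using opnorm_le_sum[OF assms(1)[OF that]] that by force
  then show ?thesis by (rule bdd_aboveI2)
qed

lemma mat_deriv_on_continuous: "mat_deriv_on n F F' D \<Longrightarrow> mat_continuous_on n F D"
  unfolding mat_deriv_on_def mat_continuous_on_def
  by (auto intro!: continuous_on_vector_derivative)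

lemma embed_U2_step:
  fixes H :: "real \<Rightarrow> complex mat"
  assumes H: "\<And>p. p \<le> M \<Longrightarrow> H (a + real p * h / real M) \<in> carrier_mat n n"
  shows "mat_embed1 n (U2_step n H M h a) = exp (magnus_quadrature (\<lambda>t. mat_embed n ((- \<i>) \<cdot>\<^sub>m H t)) M h a)"
    and "U2_step n H M h a \<in> carrier_mat n n"
proof -
  define G where "G p = H (a + real p * h / real M)" for p
  define c where "c = h / real M"
  define S where "S p = msum n (\<lambda>q. complex_of_real c \<cdot>\<^sub>m G q) {1..p}" for p
  define X1 where "X1 = (- \<i>) \<cdot>\<^sub>m msum n (\<lambda>p. complex_of_real c \<cdot>\<^sub>m G p) {..<M}"
  define X2 where "X2 = (1/2) \<cdot>\<^sub>m msum n (\<lambda>p. complex_of_real c \<cdot>\<^sub>m comm (S p) (G p)) {..<M}"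
  have G: "G p \<in> carrier_mat n n" if "p \<le> M" for p unfolding G_def by (rule H[OF that])
  have S: "S p \<in> carrier_mat n n" for p by (simp add: S_def)
  have X: "X1 \<in> carrier_mat n n" "X2 \<in> carrier_mat n n" by (simp_all add: X1_def X2_def)
  have U: "U2_step n H M h a = mexp (X1 + X2)"
    unfolding U2_step_def X1_def X2_def S_def G_def c_def ..
  show "U2_step n H M h a \<in> carrier_mat n n" unfolding U mexp_def using X by simp
  have eX1: "mat_embed n X1 = (\<Sum>p<M. c *\<^sub>R mat_embed n ((- \<i>) \<cdot>\<^sub>m G p))"
    unfolding X1_def using G by (subst embed_smult_msum) (auto simp: embed_smult_of_real intro!: sum.cong)
  have eS: "mat_embed n (S p) = (\<Sum>q=1..p. c *\<^sub>R mat_embed n (G q))" if "p < M" for p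
  proof -
    have one: "1 \<cdot>\<^sub>m A = A" for A :: "complex mat" by (intro eq_matI) auto
    have "mat_embed n (1 \<cdot>\<^sub>m S p) = (\<Sum>q=1..p. mat_embed n (1 \<cdot>\<^sub>m (complex_of_real c \<cdot>\<^sub>m G q)))"
      unfolding S_def using that G by (intro embed_smult_msum) auto
    also have "\<dots> = (\<Sum>q=1..p. c *\<^sub>R mat_embed n (1 \<cdot>\<^sub>m G q))"
      using that G by (intro sum.cong embed_smult_of_real) auto
    finally show ?thesis by (simp add: one)
  qed
  have swap: "lie_bracket (mat_embed n ((- \<i>) \<cdot>\<^sub>m G p)) (mat_embed n ((- \<i>) \<cdot>\<^sub>m G q)) = lie_bracket (mat_embed n (G q)) (mat_embed n (G p))"
    if "p \<le> M" "q \<le> M" for p q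
  proof -
    have "lie_bracket (mat_embed n ((- \<i>) \<cdot>\<^sub>m G p)) (mat_embed n ((- \<i>) \<cdot>\<^sub>m G q)) = mat_embed n (comm ((- \<i>) \<cdot>\<^sub>m G p) ((- \<i>) \<cdot>\<^sub>m G q))"
      using G that by (subst embed_comm) auto
    also have "comm ((- \<i>) \<cdot>\<^sub>m G p) ((- \<i>) \<cdot>\<^sub>m G q) = comm (G q) (G p)"
      using G[OF that(1)] G[OF that(2)]
      by (subst comm_smult[of _ n]) (auto simp: comm_def intro!: eq_matI)
    finally show ?thesis using G that by (simp add: embed_comm)
  qed
  have "mat_embed n X2 = (\<Sum>p<M. c *\<^sub>R mat_embed n ((1/2) \<cdot>\<^sub>m comm (S p) (G p)))"
    unfolding X2_def using G S by (subst embed_smult_msum) (auto simp: embed_smult_of_real intro!: sum.cong)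
  also have "\<dots> = (\<Sum>p<M. (1 / 2) *\<^sub>R (c *\<^sub>R lie_bracket (mat_embed n ((- \<i>) \<cdot>\<^sub>m G p))
        (\<Sum>q=1..p. c *\<^sub>R mat_embed n ((- \<i>) \<cdot>\<^sub>m G q))))"
  proof (rule sum.cong[OF refl])
    fix p assume "p \<in> {..<M}"
    then have p: "p < M" by simp
    \<comment> \<open>The scalars are rewritten to fit \<open>embed_smult_of_real\<close>, which
      expects a real factor inside a complex one.\<close>
    have one: "(1/2) \<cdot>\<^sub>m A = 1 \<cdot>\<^sub>m (complex_of_real (1/2) \<cdot>\<^sub>m A)" "1 \<cdot>\<^sub>m A = A" for A :: "complex mat"
      by (intro eq_matI, auto)+
    have "mat_embed n ((1/2) \<cdot>\<^sub>m comm (S p) (G p)) = (1 / 2) *\<^sub>R mat_embed n (comm (S p) (G p))"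
      unfolding one(1) using S G p by (subst embed_smult_of_real) (auto simp: one(2))
    also have "mat_embed n (comm (S p) (G p)) = lie_bracket (\<Sum>q=1..p. c *\<^sub>R mat_embed n (G q)) (mat_embed n (G p))"
      using S G p by (simp add: embed_comm eS)
    also have "\<dots> = (\<Sum>q=1..p. c *\<^sub>R lie_bracket (mat_embed n (G q)) (mat_embed n (G p)))"
      by (simp add: lie_bracket.sum_left lie_bracket.scaleR_left)
    also have "\<dots> = (\<Sum>q=1..p. c *\<^sub>R lie_bracket (mat_embed n ((- \<i>) \<cdot>\<^sub>m G p)) (mat_embed n ((- \<i>) \<cdot>\<^sub>m G q)))"
      using p by (intro sum.cong refl arg_cong2[of _ _ _ _ "(*\<^sub>R)"] swap[symmetric]) auto
    also have "\<dots> = lie_bracket (mat_embed n ((- \<i>) \<cdot>\<^sub>m G p)) (\<Sum>q=1..p. c *\<^sub>R mat_embed n ((- \<i>) \<cdot>\<^sub>m G q))"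
      by (simp add: lie_bracket.sum_right lie_bracket.scaleR_right)
    finally show "c *\<^sub>R mat_embed n ((1/2) \<cdot>\<^sub>m comm (S p) (G p)) = (1 / 2) *\<^sub>R (c *\<^sub>R lie_bracket (mat_embed n ((- \<i>) \<cdot>\<^sub>m G p))
        (\<Sum>q=1..p. c *\<^sub>R mat_embed n ((- \<i>) \<cdot>\<^sub>m G q)))" by simp
  qed
  finally have "mat_embed n (X1 + X2) = magnus_quadrature (\<lambda>t. mat_embed n ((- \<i>) \<cdot>\<^sub>m H t)) M h a"
    using X by (simp only: embed_add eX1 magnus_quadrature_def G_def c_def scaleR_sum_right)
  then show "mat_embed1 n (U2_step n H M h a) = exp (magnus_quadrature (\<lambda>t. mat_embed n ((- \<i>) \<cdot>\<^sub>m H t)) M h a)"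
    unfolding U using X by (subst exp_embed[symmetric]) auto
qed

text \<open>Membership in the carrier is part of the induction because \<open>embed1_mult\<close>
  requires it of both factors.\<close>

lemma embed_U2_prod:
  assumes H: "\<And>t. t \<in> {0..T} \<Longrightarrow> H t \<in> carrier_mat n n" and "T \<ge> 0" "L > 0" "M > 0" "h = T / real L" "k \<le> L"
  shows "mat_embed1 n (U2_prod n H M h k) = magnus_product (\<lambda>t. mat_embed n ((- \<i>) \<cdot>\<^sub>m H t)) M h k
    \<and> U2_prod n H M h k \<in> carrier_mat n n"
  using \<open>k \<le> L\<close>
proof (induction k)
  case (Suc k)
  have Hk: "H (real k * h + real p * h / real M) \<in> carrier_mat n n" if "p \<le> M" for p
  proof (rule H)
    have h0: "h \<ge> 0" and Lh: "real L * h = T" using assms by simp_all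
    have "real p * h / real M \<le> h"
      using that \<open>M > 0\<close> mult_right_mono[OF _ h0, of "real p" "real M"] by (simp add: divide_le_eq mult.commute)
    moreover have "real (Suc k) * h \<le> real L * h"
      using Suc.prems h0 by (intro mult_right_mono) auto
    then have "real k * h + h \<le> T" unfolding Lh by (simp add: distrib_right)
    moreover have "0 \<le> real k * h" "0 \<le> real p * h / real M" using h0 by auto
    ultimately show "real k * h + real p * h / real M \<in> {0..T}" by simp
  qed
  show ?case
    using Suc embed_U2_step[of M H "real k * h" h n, OF Hk] by (simp add: embed1_mult)
qed (simp add: embed1_one)

lemma U2_prod_error:
  fixes H H1 H2 U :: "real \<Rightarrow> complex mat" and T \<alpha> h :: real and n L M :: nat
  assumes "0 \<le> T" "0 < L" "0 < M" and h: "h = T / real L" and small: "h * \<alpha> \<le> 1"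
    and H: "\<And>t. t \<in> {0..T} \<Longrightarrow> hermitian_mat n (H t)"
    and H_le: "\<And>t. t \<in> {0..T} \<Longrightarrow> opnorm (H t) \<le> \<alpha>"
    and H': "mat_deriv_on n H H1 {0..T}" and H'': "mat_deriv_on n H1 H2 {0..T}"
    and H2: "mat_continuous_on n H2 {0..T}"
    and U: "mat_deriv_on n U (\<lambda>t. (- \<i>) \<cdot>\<^sub>m (H t * U t)) {0..T}" and U0: "U 0 = 1\<^sub>m n"
    and Ccomm: "Ccomm = Sup {opnorm (comm (H \<tau>) (comm (H s) (H t))) | j s t \<tau>.
                         j < L \<and> s \<in> {real j * h .. real (Suc j) * h}
                               \<and> t \<in> {real j * h .. real (Suc j) * h}
                               \<and> \<tau> \<in> {real j * h .. real (Suc j) * h}}"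
    and D1: "D1 = Sup ((\<lambda>t. opnorm (H1 t)) ` {0..T})"
    and D2: "D2 = Sup ((\<lambda>t. opnorm (H2 t)) ` {0..T})"
  shows "opnorm (U T - U2_prod n H M h L)
           \<le> 90 * T * (min (Ccomm * h ^ 2) (6000 * (1 + \<alpha> + D1 + D2) ^ 5 * h ^ 4) + h / real M * D1)"
proof -
  have Hc: "H t \<in> carrier_mat n n" "H1 t \<in> carrier_mat n n" "H2 t \<in> carrier_mat n n" "U t \<in> carrier_mat n n"
    if "t \<in> {0..T}" for t
    using H' H'' U that by (auto simp: mat_deriv_on_def)
  define A A1 A2 where "A t = mat_embed n ((- \<i>) \<cdot>\<^sub>m H t)" and "A1 t = mat_embed n ((- \<i>) \<cdot>\<^sub>m H1 t)"
    and "A2 t = mat_embed n ((- \<i>) \<cdot>\<^sub>m H2 t)" for t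
  \<comment> \<open>The unital embedding is taken so that \<open>V 0 = 1\<close>.\<close>
  define V where "V t = mat_embed1 n (U t)" for t
  have norm_i: "norm (mat_embed n ((- \<i>) \<cdot>\<^sub>m B)) = opnorm B" if "B \<in> carrier_mat n n" for B
    using that by (simp add: norm_embed opnorm_smult[OF that])
  have A_le: "norm (A t) \<le> \<alpha>" if "t \<in> {0..T}" for t
    unfolding A_def using Hc that H_le by (simp add: norm_i)
  have A1_le: "norm (A1 t) \<le> D1" if "t \<in> {0..T}" for t
    unfolding A1_def D1 norm_i[OF Hc(2)[OF that]]
    by (rule cSUP_upper[OF that bdd_above_opnorm[OF Hc(2) mat_deriv_on_continuous[OF H'']]])
  have A2_le: "norm (A2 t) \<le> D2" if "t \<in> {0..T}" for t
    unfolding A2_def D2 norm_i[OF Hc(3)[OF that]]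
    by (rule cSUP_upper[OF that bdd_above_opnorm[OF Hc(3) H2]])
  have der: "((\<lambda>t. mat_embed n ((- \<i>) \<cdot>\<^sub>m F t)) has_vector_derivative mat_embed n ((- \<i>) \<cdot>\<^sub>m F' t)) (at t within {0..T})"
    if F: "mat_deriv_on n F F' {0..T}" and t: "t \<in> {0..T}" for F F' t
  proof (rule embed_has_vector_derivative[OF _ _ t])
    fix i j assume ij: "i < n" "j < n"
    have d: "((\<lambda>s. - \<i> * F s $$ (i, j)) has_vector_derivative - \<i> * F' t $$ (i, j)) (at t within {0..T})"
      using F t ij by (intro has_vector_derivative_mult_right) (auto simp: mat_deriv_on_def)
    have eq: "((- \<i>) \<cdot>\<^sub>m B) $$ (i, j) = - \<i> * B $$ (i, j)" if "B \<in> carrier_mat n n" for B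
      using that ij by simp
    have c: "F' t \<in> carrier_mat n n" "\<And>s. s \<in> {0..T} \<Longrightarrow> F s \<in> carrier_mat n n"
      using F t by (auto simp: mat_deriv_on_def)
    show "((\<lambda>s. ((- \<i>) \<cdot>\<^sub>m F s) $$ (i, j)) has_vector_derivative ((- \<i>) \<cdot>\<^sub>m F' t) $$ (i, j)) (at t within {0..T})"
      unfolding eq[OF c(1)] by (rule has_vector_derivative_transform[OF t _ d]) (rule eq[OF c(2)])
  qed (use F t in \<open>auto simp: mat_deriv_on_def\<close>)
  have V': "(V has_vector_derivative A t * V t) (at t within {0..T})" if t: "t \<in> {0..T}" for t
  proof -
    have "((\<lambda>s. mat_embed n (U s)) has_vector_derivative mat_embed n ((- \<i>) \<cdot>\<^sub>m (H t * U t))) (at t within {0..T})"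
      by (rule embed_has_vector_derivative[OF _ _ t]) (use U t in \<open>auto simp: mat_deriv_on_def\<close>)
    then have "(V has_vector_derivative mat_embed n ((- \<i>) \<cdot>\<^sub>m (H t * U t))) (at t within {0..T})"
      unfolding V_def mat_embed1_def by (auto intro!: derivative_eq_intros)
    also have "(- \<i>) \<cdot>\<^sub>m (H t * U t) = ((- \<i>) \<cdot>\<^sub>m H t) * U t"
      by (rule mult_smult_assoc_mat[OF Hc(1,4)[OF t], symmetric])
    also have "mat_embed n (((- \<i>) \<cdot>\<^sub>m H t) * U t) = A t * V t"
    proof -
      \<comment> \<open>Embedded matrices annihilate the identity blocks that
        \<open>mat_embed1\<close> adds, so the product with \<open>V t\<close> only sees coordinate
        \<open>n\<close>.\<close>
      have "mat_embed n ((- \<i>) \<cdot>\<^sub>m H t) * mat_embed n (1\<^sub>m n) = mat_embed n ((- \<i>) \<cdot>\<^sub>m H t)"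
        using Hc[OF t] by (subst embed_mult[symmetric]) auto
      then show ?thesis
        using Hc[OF t] by (simp add: A_def V_def mat_embed1_def embed_mult algebra_simps)
    qed
    finally show ?thesis .
  qed
  have h0: "h \<ge> 0" and Lh: "real L * h = T" using assms by auto
  have \<tau>T: "\<tau> \<in> {0..T}" if "j < L" "\<tau> \<in> {real j * h..real (Suc j) * h}" for j \<tau>
  proof -
    have "real (Suc j) * h \<le> real L * h" "0 \<le> real j * h"
      using that h0 by (auto intro!: mult_right_mono simp del: of_nat_Suc)
    then show ?thesis using that Lh by auto
  qed
  have bracket: "opnorm (comm (H \<tau>) (comm (H s) (H t))) = norm (lie_bracket (A \<tau>) (lie_bracket (A s) (A t)))"
    if "\<tau> \<in> {0..T}" "s \<in> {0..T}" "t \<in> {0..T}" for \<tau> s t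
  proof -
    note c = Hc(1)[OF that(1)] Hc(1)[OF that(2)] Hc(1)[OF that(3)]
    have "lie_bracket (A \<tau>) (lie_bracket (A s) (A t))
       = mat_embed n (comm ((- \<i>) \<cdot>\<^sub>m H \<tau>) (comm ((- \<i>) \<cdot>\<^sub>m H s) ((- \<i>) \<cdot>\<^sub>m H t)))"
      unfolding A_def using c by (simp add: embed_comm)
    \<comment> \<open>The scalar is \<open>(-i)^3\<close>, of modulus 1, so the norm of the bracket
      is unchanged.\<close>
    also have "\<dots> = mat_embed n ((- \<i> * (- \<i> * - \<i>)) \<cdot>\<^sub>m comm (H \<tau>) (comm (H s) (H t)))"
      using c by (simp only: comm_smult[OF c(2,3)] comm_smult[OF c(1) comm_carrier[OF c(2,3)]])
    finally show ?thesis
      using c by (simp add: norm_embed opnorm_smult[OF comm_carrier[OF c(1) comm_carrier[OF c(2,3)]]] norm_mult)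
  qed
  have Ccomm_ge: "norm (lie_bracket (A \<tau>) (lie_bracket (A s) (A t))) \<le> Ccomm"
    if j: "j < L" "\<tau> \<in> {real j * h..real (Suc j) * h}" "s \<in> {real j * h..real (Suc j) * h}"
      "t \<in> {real j * h..real (Suc j) * h}" for j \<tau> s t
  proof -
    have "opnorm (comm (H \<tau>) (comm (H s) (H t))) \<le> Ccomm"
      unfolding Ccomm
    proof (rule cSup_upper)
      show "bdd_above {opnorm (comm (H \<tau>) (comm (H s) (H t))) | j s t \<tau>.
                         j < L \<and> s \<in> {real j * h .. real (Suc j) * h}
                               \<and> t \<in> {real j * h .. real (Suc j) * h}
                               \<and> \<tau> \<in> {real j * h .. real (Suc j) * h}}"
      \<comment> \<open>The trivial bound \<open>4 \<alpha>^3\<close> for a double commutator makes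
        the supremum finite, so that \<open>Ccomm\<close> dominates each bracket.\<close>
      proof (rule bdd_aboveI[of _ "2 * \<alpha> * (2 * \<alpha> * \<alpha>)"], clarify)
        fix j s t \<tau> assume *: "j < L" "s \<in> {real j * h..real (Suc j) * h}"
          "t \<in> {real j * h..real (Suc j) * h}" "\<tau> \<in> {real j * h..real (Suc j) * h}"
        show "opnorm (comm (H \<tau>) (comm (H s) (H t))) \<le> 2 * \<alpha> * (2 * \<alpha> * \<alpha>)"
          unfolding bracket[OF \<tau>T[OF *(1,4)] \<tau>T[OF *(1,2)] \<tau>T[OF *(1,3)]]
          by (intro norm_lie_bracket_mono A_le \<tau>T[OF *(1,4)] \<tau>T[OF *(1,2)] \<tau>T[OF *(1,3)])
      qed
    qed (use j in blast)
    then show ?thesis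
      unfolding bracket[OF \<tau>T[OF j(1,2)] \<tau>T[OF j(1,3)] \<tau>T[OF j(1,4)]] .
  qed
  define m where "m = min (Ccomm * h ^ 2) (6000 * (1 + \<alpha> + D1 + D2) ^ 5 * h ^ 4)"
  have m: "min (90 * Ccomm * h ^ 2) (6000 * (1 + \<alpha> + D1 + D2) ^ 5 * h ^ 4) \<le> 90 * m"
  and q: "0 \<le> h / real M * D1"
  proof -
    have "0 \<le> \<alpha>" "0 \<le> D1" "0 \<le> D2"
      using A_le[of 0] A1_le[of 0] A2_le[of 0] \<open>0 \<le> T\<close> by (auto intro: order_trans[OF norm_ge_zero])
    then show "0 \<le> h / real M * D1" using h0 by simp
    \<comment> \<open>The constant 90 has to stand in front of the whole minimum; multiplying the
      second entry by it is harmless because that entry is nonnegative.\<close>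
    have min90: "min (90 * x) y \<le> 90 * min x y" if "0 \<le> y" for x y :: real
      using that by (simp add: min_def)
    have "0 \<le> 6000 * (1 + \<alpha> + D1 + D2) ^ 5 * h ^ 4"
      using \<open>0 \<le> \<alpha>\<close> \<open>0 \<le> D1\<close> \<open>0 \<le> D2\<close> by simp
    then show "min (90 * Ccomm * h ^ 2) (6000 * (1 + \<alpha> + D1 + D2) ^ 5 * h ^ 4) \<le> 90 * m"
      using min90[of _ "Ccomm * h ^ 2"] unfolding m_def by (simp add: mult.assoc)
  qed
  have "norm (V T - magnus_product A M h L)
    \<le> T * (min (90 * Ccomm * h\<^sup>2) (6000 * (1 + \<alpha> + D1 + D2) ^ 5 * h ^ 4) + 4 * (h / real M * D1))"
  proof (rule skew_matseq.magnus_product_error[OF \<open>0 \<le> T\<close> \<open>0 < L\<close> \<open>0 < M\<close> h V' _ _ _ _ A_le A1_le A2_le small Ccomm_ge])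
    show "V 0 = 1" by (simp add: V_def U0 embed1_one)
    show "A t \<in> skew_matseq" if "t \<in> {0..T}" for t
      unfolding A_def by (intro embed_hermitian_skew H that)
    show "(A has_vector_derivative A1 t) (at t within {0..T})" if "t \<in> {0..T}" for t
      using der[OF H' that] by (simp add: A_def[abs_def] A1_def)
    show "(A1 has_vector_derivative A2 t) (at t within {0..T})" if "t \<in> {0..T}" for t
      using der[OF H'' that] by (simp add: A1_def[abs_def] A2_def)
  qed
  also have "\<dots> \<le> T * (90 * m + 90 * (h / real M * D1))"
    using m q \<open>0 \<le> T\<close> by (intro mult_left_mono add_mono mult_right_mono) auto
  also have "\<dots> = 90 * T * (m + h / real M * D1)" by (simp add: algebra_simps)
  finally have "norm (V T - magnus_product A M h L) \<le> 90 * T * (m + h / real M * D1)" .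
  moreover have P: "mat_embed1 n (U2_prod n H M h L) = magnus_product A M h L" "U2_prod n H M h L \<in> carrier_mat n n"
    using embed_U2_prod[of T H n L M h L] Hc(1) assms by (simp_all add: A_def[abs_def])
  have "U T \<in> carrier_mat n n" using Hc(4)[of T] \<open>0 \<le> T\<close> by simp
  \<comment> \<open>The added identity blocks cancel in the difference, and \<open>mat_embed\<close>
    is isometric.\<close>
  then have "norm (V T - magnus_product A M h L) = opnorm (U T - U2_prod n H M h L)"
    using P(2) unfolding P(1)[symmetric] V_def mat_embed1_def
    by (simp add: norm_embed[OF minus_carrier_mat, symmetric] embed_diff)
  ultimately show ?thesis unfolding m_def by simp
qed

theorem theorem4:
  "\<exists>c>0. \<exists>C>0. \<exists>CH :: real \<Rightarrow> real \<Rightarrow> real \<Rightarrow> real.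
   \<forall>(n::nat) (H :: real \<Rightarrow> complex mat) H1 H2 (U :: real \<Rightarrow> complex mat)
     (T::real) (\<alpha>::real) (L::nat) (M::nat).
     0 \<le> T \<longrightarrow> 0 < L \<longrightarrow> 0 < M \<longrightarrow>
     (\<forall>t\<in>{0..T}. hermitian_mat n (H t) \<and> opnorm (H t) \<le> \<alpha>) \<longrightarrow>
     mat_deriv_on n H H1 {0..T} \<longrightarrow>
     mat_deriv_on n H1 H2 {0..T} \<longrightarrow>
     mat_continuous_on n H2 {0..T} \<longrightarrow>
     \<comment> \<open>U is the exact propagator: i U'(t) = H(t) U(t), U(0) = I\<close>
     mat_deriv_on n U (\<lambda>t. (- \<i>) \<cdot>\<^sub>m (H t * U t)) {0..T} \<longrightarrow>
     U 0 = 1\<^sub>m n \<longrightarrow>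
     (let h = T / real L;
          Ccomm = Sup {opnorm (comm (H \<tau>) (comm (H s) (H t))) | j s t \<tau>.
                         j < L \<and> s \<in> {real j * h .. real (Suc j) * h}
                               \<and> t \<in> {real j * h .. real (Suc j) * h}
                               \<and> \<tau> \<in> {real j * h .. real (Suc j) * h}};
          D1 = Sup ((\<lambda>t. opnorm (H1 t)) ` {0..T});
          D2 = Sup ((\<lambda>t. opnorm (H2 t)) ` {0..T})
      in h * \<alpha> \<le> c \<longrightarrow>
         opnorm (U T - U2_prod n H M h L)
           \<le> C * T * (min (Ccomm * h ^ 2) (CH \<alpha> D1 D2 * h ^ 4) + h / real M * D1))"
\<comment> \<open>\<open>c = 1\<close> is the condition \<open>h \<alpha> <= 1\<close> of the
  residual bound, 90 and 6000 are the constants of the two residual bounds, and the fifth power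
  arises from \<open>N x^4\<close> with \<open>x = N u\<close>.\<close>
proof (rule exI[of _ "1 :: real"], rule conjI, simp, rule exI[of _ "90 :: real"], rule conjI, simp,
    rule exI[of _ "\<lambda>\<alpha> D1 D2 :: real. 6000 * (1 + \<alpha> + D1 + D2) ^ 5"], intro allI impI)
  fix n :: nat and H H1 H2 U :: "real \<Rightarrow> complex mat" and T \<alpha> :: real and L M :: nat
  assume "0 \<le> T" "0 < L" "0 < M"
    and H: "\<forall>t\<in>{0..T}. hermitian_mat n (H t) \<and> opnorm (H t) \<le> \<alpha>"
    and "mat_deriv_on n H H1 {0..T}" "mat_deriv_on n H1 H2 {0..T}" "mat_continuous_on n H2 {0..T}"
      "mat_deriv_on n U (\<lambda>t. (- \<i>) \<cdot>\<^sub>m (H t * U t)) {0..T}" "U 0 = 1\<^sub>m n"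
  then show "let h = T / real L;
          Ccomm = Sup {opnorm (comm (H \<tau>) (comm (H s) (H t))) | j s t \<tau>.
                         j < L \<and> s \<in> {real j * h .. real (Suc j) * h}
                               \<and> t \<in> {real j * h .. real (Suc j) * h}
                               \<and> \<tau> \<in> {real j * h .. real (Suc j) * h}};
          D1 = Sup ((\<lambda>t. opnorm (H1 t)) ` {0..T});
          D2 = Sup ((\<lambda>t. opnorm (H2 t)) ` {0..T})
      in h * \<alpha> \<le> 1 \<longrightarrow>
         opnorm (U T - U2_prod n H M h L)
           \<le> 90 * T * (min (Ccomm * h ^ 2) (6000 * (1 + \<alpha> + D1 + D2) ^ 5 * h ^ 4) + h / real M * D1)"
    unfolding Let_def by (intro impI U2_prod_error[OF _ _ _ refl]) auto
qed

end
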